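(* Let $1\le\alpha<\beta<\infty$, let $p_1,p_2>0$ with $p_1+p_2=1$, and let $S(x,\omega)=(\tilde T_{a(\omega)}(x),\varphi\omega)$ be the skew product of the piecewise affine random system defined in the context. Let $\Delta_0=(\frac12,1]\times[0,1]$. The following hold: (1) $S$ admits a unique (subject to the normalizing condition $\nu(\Delta_0)=1$) absolutely continuous invariant infinite ($\sigma$-finite) measure $\nu$. (2) Let $\mathcal L_\nu$ be the transfer operator associated with $S$ with respect to the invariant measure $\nu$. For $\alpha>1$, let $f$ be a Lipschitz function supported on $\Delta_0$. Then $$\lim_{n\to\infty}\Bigl\|n^{1-\frac1\alpha}\mathbf 1_{\Delta_0}\mathcal L_\nu^nf-c\int_{\Delta_0}f\,d\nu\Bigr\|_\infty=0,$$ where $c$ is a constant independent of $f$ and the supremum norm is taken over $\Delta_0$. In particular, if $g\in L^1(\Delta_0)$, then $$\lim_{n\to\infty}n^{1-\frac1\alpha}\int_{\Delta_0}f\cdot g\circ S^n\,d\nu=c\int_{\Delta_0}f\,d\nu\int_{\Delta_0}g\,d\nu.$$ (3) For $\alpha=1$ and $f$ a Lipschitz function supported on $\Delta_0$, the same two conclusions as in (2) hold with the normalizing sequence $n^{1-\frac1\alpha}$ replaced by $\ln n$.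
   Context: For $0<\gamma<\infty$ let $T_\gamma:[0,1]\to[0,1]$ be $T_\gamma(x)=x(1+2^\gamma x^\gamma)$ for $x\in[0,\frac12]$ and $T_\gamma(x)=2x-1$ for $x\in(\frac12,1]$; its left branch is a bijection $[0,\frac12]\to[0,1]$ with inverse $(T_\gamma|_{[0,1/2]})^{-1}$. Define on $[0,1]$: $a(\omega)=\alpha$ and $\varphi(\omega)=\omega/p_1$ if $\omega\in[0,p_1)$; $a(\omega)=\beta$ and $\varphi(\omega)=(\omega-p_1)/p_2$ if $\omega\in[p_1,1]$. Random points: $x_0(\omega)\equiv1$, $x_1(\omega)\equiv\frac12$, and $x_n(\omega)=(T_{a(\omega)}|_{[0,1/2]})^{-1}(x_{n-1}(\varphi\omega))$ for $n\ge2$. Piecewise affine random map: for $x\in(x_n(\omega),x_{n-1}(\omega)]$ with $n\ge2$, $$\tilde T_{a(\omega)}(x)=\frac{x_{n-2}(\varphi\omega)-x_{n-1}(\varphi\omega)}{x_{n-1}(\omega)-x_n(\omega)}\,(x-x_n(\omega))+x_{n-1}(\varphi\omega),$$ for $x\in(\frac12,1]$, $\tilde T_{a(\omega)}(x)=2x-1$, and $\tilde T_{a(\omega)}(0)=0$. (The map depends on $\omega$, not only on $a(\omega)$.) The skew product is $S(x,\omega)=(\tilde T_{a(\omega)}(x),\varphi\omega)$ on $[0,1]\times[0,1]$. Absolute continuity is with respect to two-dimensional Lebesgue measure. The transfer operator with respect to $\nu$ is defined by $\int(\mathcal L_\nu u)\,v\,d\nu=\int u\cdot v\circ S\,d\nu$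 for $u\in L^1(\nu)$, $v\in L^\infty(\nu)$. "$f$ Lipschitz supported on $\Delta_0$" means $f$ vanishes outside $\Delta_0$ and its restriction to $\Delta_0$ is Lipschitz; $g\in L^1(\Delta_0)$ is extended by $0$ outside $\Delta_0$. *)

theory Defs
  imports "HOL-Probability.Essential_Supremum"
begin

definition T_map :: "real \<Rightarrow> real \<Rightarrow> real" where
  "T_map \<gamma> x = (if x \<le> 1/2 then x * (1 + 2 powr \<gamma> * x powr \<gamma>) else 2 * x - 1)"

definition left_inv :: "real \<Rightarrow> real \<Rightarrow> real" where
  "left_inv \<gamma> = the_inv_into {0..1/2} (T_map \<gamma>)"

definition param :: "real \<Rightarrow> real \<Rightarrow> real \<Rightarrow> real \<Rightarrow> real" where
  "param \<alpha> \<beta> p1 \<omega> = (if \<omega> < p1 then \<alpha> else \<beta>)"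

definition base_map :: "real \<Rightarrow> real \<Rightarrow> real \<Rightarrow> real" where
  "base_map p1 p2 \<omega> = (if \<omega> < p1 then \<omega> / p1 else (\<omega> - p1) / p2)"

fun xpt :: "real \<Rightarrow> real \<Rightarrow> real \<Rightarrow> real \<Rightarrow> nat \<Rightarrow> real \<Rightarrow> real" where
  "xpt \<alpha> \<beta> p1 p2 0 \<omega> = 1"
| "xpt \<alpha> \<beta> p1 p2 (Suc 0) \<omega> = 1/2"
| "xpt \<alpha> \<beta> p1 p2 (Suc (Suc n)) \<omega> =
     left_inv (param \<alpha> \<beta> p1 \<omega>) (xpt \<alpha> \<beta> p1 p2 (Suc n) (base_map p1 p2 \<omega>))"

text \<open>
  For every \<open>\<omega>\<close> the intervals \<open>(x\<^sub>n(\<omega>), x\<^sub>n\<^sub>-\<^sub>1(\<omega>)]\<close>, \<open>n \<ge> 2\<close>, partition \<open>(0, 1/2]\<close>, so that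
  the index selected below is well defined.
\<close>

definition pw_affine :: "real \<Rightarrow> real \<Rightarrow> real \<Rightarrow> real \<Rightarrow> real \<Rightarrow> real \<Rightarrow> real" where
  "pw_affine \<alpha> \<beta> p1 p2 \<omega> x =
    (if 1/2 < x then 2 * x - 1
     else if 0 < x then
       (let X = xpt \<alpha> \<beta> p1 p2; \<omega>' = base_map p1 p2 \<omega>;
            n = (THE n. 2 \<le> n \<and> X n \<omega> < x \<and> x \<le> X (n - 1) \<omega>)
        in (X (n - 2) \<omega>' - X (n - 1) \<omega>') / (X (n - 1) \<omega> - X n \<omega>) * (x - X n \<omega>) + X (n - 1) \<omega>')
     else 0)"

definition skew :: "real \<Rightarrow> real \<Rightarrow> real \<Rightarrow> real \<Rightarrow> real \<times> real \<Rightarrow> real \<times> real" where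
  "skew \<alpha> \<beta> p1 p2 = (\<lambda>(x, \<omega>). (pw_affine \<alpha> \<beta> p1 p2 \<omega> x, base_map p1 p2 \<omega>))"

definition Delta0 :: "(real \<times> real) set" where
  "Delta0 = {1/2<..1} \<times> {0..1}"

definition square_lebesgue :: "(real \<times> real) measure" where
  "square_lebesgue = restrict_space lborel ({0..1} \<times> {0..1})"

definition invariant_measure :: "('a \<Rightarrow> 'a) \<Rightarrow> 'a measure \<Rightarrow> bool" where
  "invariant_measure S \<nu> \<longleftrightarrow> S \<in> measurable \<nu> \<nu> \<and> distr \<nu> \<nu> S = \<nu>"

definition infinite_acim :: "(real \<times> real \<Rightarrow> real \<times> real) \<Rightarrow> (real \<times> real) measure \<Rightarrow> bool" where
  "infinite_acim S \<nu> \<longleftrightarrow>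
     sets \<nu> = sets square_lebesgue \<and>
     absolutely_continuous square_lebesgue \<nu> \<and>
     invariant_measure S \<nu> \<and>
     sigma_finite_measure \<nu> \<and>
     emeasure \<nu> (space \<nu>) = \<infinity>"

definition Linf :: "'a measure \<Rightarrow> ('a \<Rightarrow> real) set" where
  "Linf M = {v \<in> borel_measurable M. esssup M (\<lambda>z. ereal \<bar>v z\<bar>) < \<infinity>}"

text \<open>
  \<open>transfer_op \<nu> S u\<close> is a representative of a class in \<open>L\<^sup>1(\<nu>)\<close>: it is determined by the duality
  relation only up to \<open>\<nu>\<close>-null sets, and only for \<open>\<nu>\<close>-integrable \<open>u\<close>.
\<close>

definition transfer_op :: "'a measure \<Rightarrow> ('a \<Rightarrow> 'a) \<Rightarrow> ('a \<Rightarrow> real) \<Rightarrow> 'a \<Rightarrow> real" where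
  "transfer_op \<nu> S u = (SOME w. integrable \<nu> w \<and>
     (\<forall>v\<in>Linf \<nu>. (\<integral>z. w z * v z \<partial>\<nu>) = (\<integral>z. u z * v (S z) \<partial>\<nu>)))"

text \<open>
  The supremum norm over \<open>A\<close> of a function defined \<open>\<nu>\<close>-almost everywhere.
\<close>

definition sup_norm_on :: "'a measure \<Rightarrow> 'a set \<Rightarrow> ('a \<Rightarrow> real) \<Rightarrow> ereal" where
  "sup_norm_on \<nu> A h = esssup (restrict_space \<nu> A) (\<lambda>z. ereal \<bar>h z\<bar>)"

definition lipschitz_supported :: "(real \<times> real) set \<Rightarrow> (real \<times> real \<Rightarrow> real) \<Rightarrow> bool" where
  "lipschitz_supported A f \<longleftrightarrow> (\<forall>z. z \<notin> A \<longrightarrow> f z = 0) \<and> (\<exists>L. L-lipschitz_on A f)"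

end

theory Submission
  imports Defs "HOL-Probability.Probability" "HOL-Real_Asymp.Real_Asymp"
begin

text \<open>
  Let \<open>\<mu>\<close> be normalised Lebesgue measure on \<open>\<Delta>\<^sub>0\<close>. The first-return map to \<open>\<Delta>\<^sub>0\<close> maps countably many
  rectangles, indexed by nonempty binary words with return time the length of the word, affinely
  onto \<open>\<Delta>\<^sub>0\<close> (up to null sets), so successive return times are independent under \<open>\<mu>\<close>. Hence
  \<open>\<mu>(S\<^sup>-\<^sup>n A) = u\<^sub>n \<mu>(A)\<close> for every measurable \<open>A \<subseteq> \<Delta>\<^sub>0\<close>, where \<open>u\<close> is the renewal sequence
  \<open>\<Sum>\<^sub>k\<^sub>\<le>\<^sub>n u\<^sub>k r\<^sub>n\<^sub>-\<^sub>k = 1\<close> with \<open>r\<^sub>n\<close> the probability that the return time exceeds \<open>n\<close>, which is the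
  mean of \<open>x\<^sub>n(\<omega>)\<close> over \<open>\<omega>\<close>. Approximating a Lipschitz function by functions that
  are constant on the rectangles of the iterated first-return map reduces the limit theorem to the asymptotics of \<open>u\<close>.

  The sequence \<open>r\<close> is log-convex, so \<open>u\<close> is decreasing by Kaluza's theorem, and Jensen's inequality,
  applied to both \<open>y\<^sup>\<alpha>\<^sup>+\<^sup>1\<close> and \<open>y\<^sup>-\<^sup>\<alpha>\<close>, gives \<open>r\<^sub>n \<sim> \<rho> n\<^sup>-\<^sup>1\<^sup>/\<^sup>\<alpha>\<close>. For \<open>\<alpha> > 1\<close>
  Karamata's Tauberian theorem for monotone coefficients yields \<open>u\<^sub>n \<sim> c n\<^sup>1\<^sup>/\<^sup>\<alpha>\<^sup>-\<^sup>1\<close>; for \<open>\<alpha> = 1\<close> an elementary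
  estimate of the convolution yields \<open>u\<^sub>n \<sim> c / ln n\<close>.

  The invariant measure is \<open>\<nu>(A) = \<Sum>\<^sub>j \<mu>(S\<^sup>-\<^sup>1 A\<^sub>j)\<close>, where \<open>A\<^sub>j\<close> is the set of points that stay outside
  \<open>\<Delta>\<^sub>0\<close> for \<open>j\<close> steps and then are in \<open>A\<close>. Uniqueness holds because such a measure is determined by its
  restriction to \<open>\<Delta>\<^sub>0\<close>, which is invariant under the first-return map, and that map is mixing.
\<close>

section \<open>Renewal sequences\<close>

text \<open>The supremum norm asks for errors proportional to \<open>u n\<close> \<mu>(A), uniformly
  in A. Bounding the discarded rectangles by their measure loses that factor. What they contribute
  to the preimage of A is therefore computed as the total minus the contributions of the retained
  rectangles, both of which are exact because the return branches are affine and full.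

  For \<alpha> \<ge> 2 the tail exponent 1/\<alpha> is at most 1/2, where regular variation of the
  tail alone does not determine the decay of a renewal sequence. Monotonicity of \<open>u\<close>,
  supplied by log-convexity, closes this gap and lets one Tauberian theorem serve all \<alpha> > 1.

  The exponent \<beta> leaves no trace in the constants: its share in the growth of the mean of
  y^(-\<alpha>) per step tends to 0, like the power \<beta> - \<alpha> of a bound for the orbit.
  Hence \<rho> = (\<alpha> p1 2^\<alpha>)^(-1/\<alpha>), with c = 1 / (\<rho> Gamma(1 - 1/\<alpha>)
  Gamma(1/\<alpha>)) for \<alpha> > 1 and c = 1/\<rho> = 2 p1 for \<alpha> = 1.\<close>

lemma weighted_mean_tendsto:
  fixes a b :: "nat \<Rightarrow> real"
  assumes b: "\<And>k. 0 < b k" and div: "filterlim (\<lambda>n. \<Sum>k<n. b k) at_top sequentially"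
    and lim: "(\<lambda>k. a k / b k) \<longlonglongrightarrow> c"
  shows "(\<lambda>n. (\<Sum>k<n. a k) / (\<Sum>k<n. b k)) \<longlonglongrightarrow> c"
proof (rule LIMSEQ_I)
  fix e :: real assume e: "0 < e"
  from LIMSEQ_D[OF lim, of "e/2"] e obtain N where
    N: "\<And>k. k \<ge> N \<Longrightarrow> \<bar>a k / b k - c\<bar> < e/2" by auto
  define K where "K = (\<Sum>k<N. \<bar>a k - c * b k\<bar>)"
  \<comment> \<open>Past this threshold the contribution \<open>K\<close> of the first
    \<open>N\<close> terms is less than \<open>e/2\<close> times the denominator, the same share as
    the tail.\<close>
  have ev: "eventually (\<lambda>n. (\<Sum>k<n. b k) > 2 * K / e + 1) sequentially"
    using div by (simp add: filterlim_at_top_dense)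
  then obtain M where M: "\<And>n. n \<ge> M \<Longrightarrow> (\<Sum>k<n. b k) > 2 * K / e + 1"
    by (auto simp: eventually_sequentially)
  have K0: "K \<ge> 0" unfolding K_def by (intro sum_nonneg) auto
  show "\<exists>no. \<forall>n\<ge>no. norm ((\<Sum>k<n. a k) / (\<Sum>k<n. b k) - c) < e"
  proof (intro exI[of _ "max M N"] allI impI)
    fix n assume n: "max M N \<le> n"
    let ?B = "\<Sum>k<n. b k"
    have B: "?B > 2 * K / e + 1" using M n by auto
    have B0: "?B > 0" using B K0 e by (smt (verit) divide_nonneg_pos)
    have pt: "\<bar>a k - c * b k\<bar> \<le> e/2 * b k" if "k \<ge> N" for k
    proof -
      have "\<bar>a k - c * b k\<bar> = \<bar>(a k / b k - c) * b k\<bar>"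
        using less_imp_neq[OF b[of k]] by (simp add: left_diff_distrib)
      also have "\<dots> = \<bar>a k / b k - c\<bar> * b k" using b[of k] by (simp add: abs_mult)
      also have "\<dots> \<le> e/2 * b k" using N[OF that] b[of k] by (intro mult_right_mono) auto
      finally show ?thesis .
    qed
    have "\<bar>(\<Sum>k<n. a k) - c * ?B\<bar> = \<bar>\<Sum>k<n. a k - c * b k\<bar>"
      by (simp add: sum_subtractf sum_distrib_left)
    also have "\<dots> \<le> (\<Sum>k<n. \<bar>a k - c * b k\<bar>)" by (rule sum_abs)
    also have "\<dots> = K + (\<Sum>k=N..<n. \<bar>a k - c * b k\<bar>)"
      unfolding K_def using n by (metis (no_types, lifting) atLeast0LessThan max.boundedE sum.atLeastLessThan_concat zero_le)
    also have "(\<Sum>k=N..<n. \<bar>a k - c * b k\<bar>) \<le> (\<Sum>k=N..<n. e/2 * b k)"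
      by (intro sum_mono pt) auto
    also have "\<dots> \<le> (\<Sum>k<n. e/2 * b k)"
      using b e by (intro sum_mono2) (auto intro!: mult_nonneg_nonneg simp: less_imp_le)
    also have "\<dots> = e/2 * ?B" by (simp add: sum_distrib_left)
    finally have "\<bar>(\<Sum>k<n. a k) - c * ?B\<bar> \<le> K + e/2 * ?B" by simp
    also have "K < e/2 * ?B" using B e by (simp add: field_simps)
    finally have "\<bar>(\<Sum>k<n. a k) - c * ?B\<bar> < e * ?B" by simp
    moreover have "(\<Sum>k<n. a k) / ?B - c = ((\<Sum>k<n. a k) - c * ?B) / ?B"
      using B0 by (simp add: field_simps)
    ultimately show "norm ((\<Sum>k<n. a k) / ?B - c) < e"
      using B0 by (simp add: field_simps)
  qed
qed

text \<open>With \<open>b\<^sub>k = u\<^sub>k\<^sub>-\<^sub>1 - u\<^sub>k\<close> the renewal equation becomes \<open>r\<^sub>n = \<Sum>\<^sub>k b\<^sub>k r\<^sub>n\<^sub>-\<^sub>k\<close>; log-convexity makes the ratios \<open>r\<^sub>k\<^sub>+\<^sub>1 / r\<^sub>k\<close> increasing, which forces \<open>b\<^sub>n \<ge> 0\<close> inductively.\<close>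

lemma Kaluza_decreasing:
  fixes r u :: "nat \<Rightarrow> real"
  assumes r0: "r 0 = 1" and rpos: "\<And>n. 0 < r n"
    and logconvex: "\<And>n. (r (Suc n))\<^sup>2 \<le> r n * r (Suc (Suc n))"
    and renewal: "\<And>n. (\<Sum>k\<le>n. u k * r (n - k)) = 1"
  shows "decseq u"
proof -
  define b where "b k = u (k - 1) - u k" for k
  have u0: "u 0 = 1" using renewal[of 0] r0 by simp
  have ratio: "r (Suc m) / r m \<le> r (Suc n) / r n" if "m \<le> n" for m n
  proof (rule lift_Suc_mono_le[of "\<lambda>n. r (Suc n) / r n", OF _ that])
    fix n show "r (Suc n) / r n \<le> r (Suc (Suc n)) / r (Suc n)"
      using logconvex[of n] rpos[of n] rpos[of "Suc n"]
      by (simp add: field_simps power2_eq_square)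
  qed
  have eq: "r n = (\<Sum>k=1..n. b k * r (n - k))" if n1: "n \<ge> 1" for n
  proof -
    obtain m where m: "n = Suc m" using n1 by (cases n) auto
    have "(\<Sum>k\<le>n. u k * r (n - k)) = u 0 * r n + (\<Sum>k=1..n. u k * r (n - k))"
      by (simp add: atMost_atLeast0 sum.atLeast_Suc_atMost)
    moreover have "(\<Sum>k=1..n. u (k - 1) * r (n - k)) = (\<Sum>k\<le>m. u k * r (m - k))"
      unfolding m by (rule sum.reindex_bij_witness[of _ Suc "\<lambda>k. k - 1"]) auto
    ultimately show ?thesis
      using renewal[of n] renewal[of m] u0 by (simp add: b_def left_diff_distrib sum_subtractf)
  qed
  have bpos: "b n \<ge> 0" if "n \<ge> 1" for n
    using that
  proof (induction n rule: less_induct)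
    case (less n)
    show ?case
    proof (cases "n = 1")
      case True
      then show ?thesis using eq[of 1] r0 rpos[of 1] by simp
    next
      case False
      then obtain m where m: "n = Suc m" "m \<ge> 1" using less.prems by (cases n) auto
      \<comment> \<open>Monotone ratios give \<open>r (n - k) / r (m - k) \<le> r n / r m\<close>.
        After this replacement the sum is the equation for \<open>r m\<close> scaled by
        \<open>r n / r m\<close>, so what remains for \<open>b n\<close> is nonnegative.\<close>
      have "(\<Sum>k=1..m. b k * r (n - k)) \<le> (\<Sum>k=1..m. b k * (r (m - k) * (r n / r m)))"
      proof (intro sum_mono mult_left_mono)
        fix k assume k: "k \<in> {1..m}"
        have "r (Suc (m - k)) / r (m - k) \<le> r (Suc m) / r m" by (rule ratio) simp
        moreover have "n - k = Suc (m - k)" using k m by auto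
        ultimately show "r (n - k) \<le> r (m - k) * (r n / r m)"
          using rpos[of "m - k"] m by (simp add: field_simps)
        show "0 \<le> b k" using less.IH k m by auto
      qed
      also have "\<dots> = (\<Sum>k=1..m. b k * r (m - k)) * (r n / r m)"
        by (simp add: sum_distrib_right sum_distrib_left mult_ac sum_divide_distrib)
      also have "\<dots> = r n" using eq[of m] m rpos[of m] by simp
      finally have "(\<Sum>k=1..m. b k * r (n - k)) \<le> r n" .
      moreover have "r n = (\<Sum>k=1..m. b k * r (n - k)) + b n"
        using eq[of n] m r0 by simp
      ultimately show ?thesis by simp
    qed
  qed
  show ?thesis
  proof (rule decseq_SucI)
    fix n show "u (Suc n) \<le> u n" using bpos[of "Suc n"] by (simp add: b_def)
  qed
qed

text \<open>Every \<open>u k\<close> with \<open>k \<le> n\<close> is at least \<open>u n\<close>,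
  so the renewal equation bounds \<open>u n\<close> times the tail sum by 1. This is the upper half
  of the logarithmic law.\<close>

lemma renewal_le_inverse_sum:
  fixes r u :: "nat \<Rightarrow> real"
  assumes "decseq u" and "\<And>n. 0 \<le> r n" and r0: "r 0 = 1"
    and renewal: "\<And>n. (\<Sum>k\<le>n. u k * r (n - k)) = 1"
  shows "u n \<le> 1 / (\<Sum>k\<le>n. r k)"
proof -
  have "u n * (\<Sum>k\<le>n. r k) = (\<Sum>k\<le>n. u n * r (n - k))"
    by (simp add: sum_distrib_left sum.atLeastAtMost_rev[of r 0 n] flip: atLeast0AtMost)
  also have "\<dots> \<le> (\<Sum>k\<le>n. u k * r (n - k))"
    using assms by (intro sum_mono mult_right_mono) (auto simp: decseq_def)
  finally have "u n * (\<Sum>k\<le>n. r k) \<le> 1" using renewal by simp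
  moreover have "(\<Sum>k\<le>n. r k) > 0" using assms(2) r0
    by (intro sum_pos2[where i = 0]) auto
  ultimately show ?thesis by (simp add: field_simps)
qed

lemma sum_tail_log_asymptotic:
  fixes r :: "nat \<Rightarrow> real"
  assumes lim: "(\<lambda>n. real n * r n) \<longlonglongrightarrow> \<rho>"
  shows "(\<lambda>n. (\<Sum>k\<le>n. r k) / ln (real n)) \<longlonglongrightarrow> \<rho>"
proof -
  \<comment> \<open>These weights imitate 1/k: \<open>k * b k\<close> tends to 1, they telescope to
    \<open>ln (n + 1)\<close>, and they are positive at \<open>k = 0\<close> too.\<close>
  define b where "b k = ln (real k + 2) - ln (real k + 1)" for k :: nat
  have sb: "(\<Sum>k<n. b k) = ln (real n + 1)" for n
    by (induction n) (auto simp: b_def)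
  have "(\<lambda>n. (\<Sum>k<n. r k) / (\<Sum>k<n. b k)) \<longlonglongrightarrow> \<rho>"
  proof (rule weighted_mean_tendsto)
    show "0 < b k" for k by (simp add: b_def)
    show "filterlim (\<lambda>n. \<Sum>k<n. b k) at_top sequentially"
      unfolding sb by real_asymp
    have "(\<lambda>k. real k * r k / (real k * b k)) \<longlonglongrightarrow> \<rho> / 1"
    proof (rule tendsto_divide[OF lim])
      show "(\<lambda>k. real k * b k) \<longlonglongrightarrow> 1" unfolding b_def by real_asymp
    qed simp
    then have "(\<lambda>k. real k * r k / (real k * b k)) \<longlonglongrightarrow> \<rho>" by simp
    then show "(\<lambda>k. r k / b k) \<longlonglongrightarrow> \<rho>"
    proof (rule Lim_transform_eventually)
      show "\<forall>\<^sub>F k in sequentially. real k * r k / (real k * b k) = r k / b k"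
        using eventually_gt_at_top[of 0] by eventually_elim simp
    qed
  qed
  then have "(\<lambda>n. (\<Sum>k<Suc n. r k) / (\<Sum>k<Suc n. b k)) \<longlonglongrightarrow> \<rho>"
    by (rule LIMSEQ_Suc)
  then have "(\<lambda>n. (\<Sum>k\<le>n. r k) / ln (real n + 2)) \<longlonglongrightarrow> \<rho>"
    unfolding sb by (simp add: lessThan_Suc_atMost add_ac)
  moreover have "(\<lambda>n. ln (real n + 2) / ln (real n)) \<longlonglongrightarrow> 1" by real_asymp
  ultimately have "(\<lambda>n. (\<Sum>k\<le>n. r k) / ln (real n + 2) * (ln (real n + 2) / ln (real n))) \<longlonglongrightarrow> \<rho> * 1"
    by (rule tendsto_mult)
  moreover have "ln (real n + 2) \<noteq> 0" for n by (simp add: add_pos_nonneg)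
  ultimately show ?thesis by simp
qed

text \<open>The lower half evaluates the renewal equation at a time \<open>N m\<close> that exceeds
  \<open>m\<close> by a factor of order \<open>ln m\<close>. The terms before \<open>m\<close> meet
  only tails of index close to \<open>N m\<close> and sum to at most \<open>C / (j m - 1)\<close>,
  which vanishes; the others sum to at most \<open>u m\<close> times \<open>R (N m)\<close>. A
  logarithmic factor does not change \<open>ln m\<close> to first order, so both halves have the
  same limit.\<close>

lemma renewal_log_asymptotic:
  fixes r u :: "nat \<Rightarrow> real"
  assumes dec: "decseq u" and u0: "\<And>n. 0 \<le> u n" and rn: "\<And>n. 0 \<le> r n" and r0: "r 0 = 1"
    and renewal: "\<And>n. (\<Sum>k\<le>n. u k * r (n - k)) = 1"
    and lim: "(\<lambda>n. real n * r n) \<longlonglongrightarrow> \<rho>" and \<rho>: "0 < \<rho>"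
  shows "(\<lambda>n. ln (real n) * u n) \<longlonglongrightarrow> 1 / \<rho>"
proof -
  define R where "R n = (\<Sum>k\<le>n. r k)" for n
  have R: "(\<lambda>n. R n / ln (real n)) \<longlonglongrightarrow> \<rho>"
    unfolding R_def by (rule sum_tail_log_asymptotic[OF lim])
  have Rpos: "R n > 0" for n unfolding R_def using rn r0 by (intro sum_pos2[where i = 0]) auto
  have u1: "u n \<le> 1" for n
    using decseqD[OF dec, of 0 n] renewal[of 0] r0 by simp
  obtain C where C: "\<And>n. \<bar>real n * r n\<bar> \<le> C"
    using convergent_imp_Bseq[of "\<lambda>n. real n * r n"] lim unfolding convergent_def Bseq_def by auto
  \<comment> \<open>The offset 2 gives \<open>j m - 1 \<ge> 1\<close> for every \<open>m\<close>, so
    that no denominator vanishes.\<close>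
  define j where "j m = nat \<lceil>ln (real m)\<rceil> + 2" for m :: nat
  define N where "N m = m * j m" for m
  have jb: "ln (real m) + 2 \<le> real (j m)" "m \<ge> 1 \<Longrightarrow> real (j m) \<le> ln (real m) + 3" for m
    unfolding j_def by (linarith, smt (verit, best) ln_ge_zero of_nat_1 of_nat_add of_nat_ceiling of_nat_le_iff of_nat_numeral one_add_one real_of_nat_ge_one_iff nat_add_distrib of_int_ceiling_le_add_one of_nat_nat zero_le_ceiling)
  have low: "(1 - C / (real (j m) - 1)) / R (N m) \<le> u m" if m: "m \<ge> 1" for m
  proof -
    have jge: "real (j m) \<ge> 2" unfolding j_def by simp
    have mN: "m \<le> N m" unfolding N_def j_def by simp
    have "1 = (\<Sum>k\<le>N m. u k * r (N m - k))" using renewal by simp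
    also have "\<dots> = (\<Sum>k<m. u k * r (N m - k)) + (\<Sum>k=m..N m. u k * r (N m - k))"
    proof -
      have "{..N m} = {..<m} \<union> {m..N m}" using mN by auto
      then show ?thesis by (simp add: sum.union_disjoint ivl_disj_int)
    qed
    also have "(\<Sum>k<m. u k * r (N m - k)) \<le> (\<Sum>k<m. C / (real m * (real (j m) - 1)))"
    proof (intro sum_mono)
      fix k assume k: "k \<in> {..<m}"
      have pos: "real m * (real (j m) - 1) > 0" using m jge by simp
      have "real m * (real (j m) - 1) \<le> real (N m - k)"
      proof -
        have "real (N m - k) = real m * real (j m) - real k"
          using k mN unfolding N_def by (subst of_nat_diff) (auto intro: order_trans[OF less_imp_le])
        then show ?thesis using k by (simp add: right_diff_distrib)
      qed
      then have "real m * (real (j m) - 1) * r (N m - k) \<le> real (N m - k) * r (N m - k)"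
        using rn by (intro mult_right_mono)
      also have "\<dots> \<le> C" using C[of "N m - k"] by simp
      finally have "r (N m - k) \<le> C / (real m * (real (j m) - 1))"
        using pos by (simp add: field_simps)
      moreover have "u k * r (N m - k) \<le> 1 * r (N m - k)" using u1 rn by (intro mult_right_mono)
      ultimately show "u k * r (N m - k) \<le> C / (real m * (real (j m) - 1))" by simp
    qed
    also have "\<dots> = C / (real (j m) - 1)" using m by simp
    also have "(\<Sum>k=m..N m. u k * r (N m - k)) \<le> (\<Sum>k=m..N m. u m * r (N m - k))"
      using rn by (intro sum_mono mult_right_mono) (auto intro: decseqD[OF dec])
    also have "\<dots> \<le> (\<Sum>k\<le>N m. u m * r (N m - k))"
      using u0 rn by (intro sum_mono2) auto
    also have "\<dots> = u m * R (N m)" unfolding R_def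
      by (simp add: sum_distrib_left sum.atLeastAtMost_rev[of r 0 "N m"] flip: atLeast0AtMost)
    finally show ?thesis using Rpos[of "N m"] by (simp add: field_simps)
  qed
  have Ntop: "filterlim N at_top sequentially"
  proof (rule filterlim_at_top_mono[of "\<lambda>m. m"])
    show "filterlim (\<lambda>m::nat. m) at_top sequentially" by (rule filterlim_ident)
    show "\<forall>\<^sub>F m in sequentially. m \<le> N m" by (auto simp: N_def j_def)
  qed
  have RN: "(\<lambda>m. R (N m) / ln (real (N m))) \<longlonglongrightarrow> \<rho>"
    using filterlim_compose[OF R Ntop] .
  have lnN: "(\<lambda>m. ln (real (N m)) / ln (real m)) \<longlonglongrightarrow> 1"
  proof (rule tendsto_sandwich[of "\<lambda>m. 1" _ _ "\<lambda>m. (ln (real m) + ln (ln (real m) + 3)) / ln (real m)"])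
    show "\<forall>\<^sub>F m in sequentially. 1 \<le> ln (real (N m)) / ln (real m)"
      using eventually_gt_at_top[of 1]
    proof eventually_elim
      case (elim m)
      have "ln (real m) \<le> ln (real (N m))"
        using elim by (intro ln_mono) (simp_all add: N_def j_def del: of_nat_mult)
      then show ?case using elim by (simp add: field_simps)
    qed
    show "\<forall>\<^sub>F m in sequentially. ln (real (N m)) / ln (real m) \<le> (ln (real m) + ln (ln (real m) + 3)) / ln (real m)"
      using eventually_gt_at_top[of 1]
    proof eventually_elim
      case (elim m)
      have "ln (real (N m)) = ln (real m) + ln (real (j m))"
      proof -
        have "real (j m) > 0" by (simp add: j_def)
        then show ?thesis using ln_mult_pos[of "real m" "real (j m)"] elim by (simp add: N_def)
      qed
      moreover have "ln (real (j m)) \<le> ln (ln (real m) + 3)"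
      proof (rule ln_mono)
        show "0 < real (j m)" by (simp add: j_def)
      qed (use jb[of m] elim in auto)
      ultimately show ?case using elim by (intro divide_right_mono) auto
    qed
    show "(\<lambda>m. (ln (real m) + ln (ln (real m) + 3)) / ln (real m)) \<longlonglongrightarrow> 1" by real_asymp
  qed simp
  have "(\<lambda>m. R (N m) / ln (real (N m)) * (ln (real (N m)) / ln (real m))) \<longlonglongrightarrow> \<rho> * 1"
    by (intro tendsto_mult RN lnN)
  then have RNl: "(\<lambda>m. R (N m) / ln (real (N m)) * (ln (real (N m)) / ln (real m))) \<longlonglongrightarrow> \<rho>"
    by simp
  then have RN': "(\<lambda>m. R (N m) / ln (real m)) \<longlonglongrightarrow> \<rho>"
  proof -
    have "\<forall>\<^sub>F m in sequentially. R (N m) / ln (real (N m)) * (ln (real (N m)) / ln (real m)) = R (N m) / ln (real m)"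
      using eventually_gt_at_top[of 1]
    proof eventually_elim
      case (elim m)
      have "ln (real m) \<le> ln (real (N m))"
        using elim by (intro ln_mono) (simp_all add: N_def j_def del: of_nat_mult)
      moreover have "ln (real m) > 0" using elim by simp
      ultimately show ?case by simp
    qed
    with RNl show ?thesis by (rule Lim_transform_eventually)
  qed
  have jtop: "filterlim (\<lambda>m. real (j m) - 1) at_top sequentially"
  proof (rule filterlim_at_top_mono[of "\<lambda>m. ln (real m)"])
    show "filterlim (\<lambda>m. ln (real m)) at_top sequentially" by real_asymp
    show "\<forall>\<^sub>F m in sequentially. ln (real m) \<le> real (j m) - 1"
    proof (rule always_eventually, rule allI)
      fix m show "ln (real m) \<le> real (j m) - 1" using jb(1)[of m] by linarith
    qed
  qed
  have "(\<lambda>m. (1 - C / (real (j m) - 1)) / (R (N m) / ln (real m))) \<longlonglongrightarrow> (1 - 0) / \<rho>"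
    by (intro tendsto_intros RN' tendsto_divide_0[OF tendsto_const filterlim_at_top_imp_at_infinity[OF jtop]])
       (use \<rho> in auto)
  then have l1: "(\<lambda>m. (1 - C / (real (j m) - 1)) / (R (N m) / ln (real m))) \<longlonglongrightarrow> 1 / \<rho>" by simp
  have l2: "(\<lambda>m. 1 / (R m / ln (real m))) \<longlonglongrightarrow> 1 / \<rho>"
    by (intro tendsto_intros R) (use \<rho> in auto)
  show ?thesis
  proof (rule tendsto_sandwich[OF _ _ l1 l2])
    show "\<forall>\<^sub>F m in sequentially. (1 - C / (real (j m) - 1)) / (R (N m) / ln (real m)) \<le> ln (real m) * u m"
      using eventually_gt_at_top[of 1]
    proof eventually_elim
      case (elim m)
      have "ln (real m) * ((1 - C / (real (j m) - 1)) / R (N m)) \<le> ln (real m) * u m"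
        using low[of m] elim by (intro mult_left_mono) auto
      then show ?case by (simp add: mult_ac)
    qed
    show "\<forall>\<^sub>F m in sequentially. ln (real m) * u m \<le> 1 / (R m / ln (real m))"
      using eventually_gt_at_top[of 1]
    proof eventually_elim
      case (elim m)
      have "ln (real m) * u m \<le> ln (real m) * (1 / R m)"
        using renewal_le_inverse_sum[OF dec rn r0 renewal, of m] elim
        by (intro mult_left_mono) (auto simp: R_def)
      then show ?case by simp
    qed
  qed
qed

text \<open>The power-series coefficients of \<open>(1 - x)\<^sup>-\<^sup>s\<close>: an explicit sequence to compare with in the Tauberian theorem.\<close>

definition binom_coeff :: "real \<Rightarrow> nat \<Rightarrow> real" where
  "binom_coeff s k = pochhammer s k / fact k"

lemma binom_coeff_eq: "binom_coeff s k = (-1) ^ k * ((- s) gchoose k)"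
  by (simp add: binom_coeff_def gbinomial_pochhammer flip: power_add mult_2)

lemma binom_coeff_pos: "0 < s \<Longrightarrow> 0 < binom_coeff s k"
  by (simp add: binom_coeff_def pochhammer_pos)

lemma binom_coeff_decreasing:
  assumes "0 < s" "s < 1"
  shows "decseq (binom_coeff s)"
proof (rule decseq_SucI)
  fix n
  have "binom_coeff s (Suc n) = binom_coeff s n * ((s + real n) / (1 + real n))"
    by (simp add: binom_coeff_def pochhammer_Suc)
  also have "\<dots> \<le> binom_coeff s n * 1"
    using assms binom_coeff_pos[of s n] by (intro mult_left_mono) auto
  finally show "binom_coeff s (Suc n) \<le> binom_coeff s n" by simp
qed

lemma binom_coeff_sums:
  assumes "\<bar>x\<bar> < 1"
  shows "(\<lambda>k. binom_coeff s k * x ^ k) sums (1 - x) powr (- s)"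
proof -
  have "(\<lambda>k. (- s gchoose k) * (- x) ^ k) sums (1 + (- x)) powr (- s)"
    using assms by (intro gen_binomial_real) simp
  moreover have "(- s gchoose k) * (- x) ^ k = binom_coeff s k * x ^ k" for k
    unfolding binom_coeff_eq by (subst power_minus) simp
  ultimately show ?thesis by simp
qed

lemma binom_coeff_asymptotic:
  assumes "0 < s"
  shows "(\<lambda>n. real n powr (1 - s) * binom_coeff s n) \<longlonglongrightarrow> 1 / Gamma s"
proof -
  have "(\<lambda>n. (- s gchoose n) / ((-1)^n / exp ((- s + 1) * ln (real n)))) \<longlonglongrightarrow> inverse (Gamma (- (- s)))"
    using gbinomial_asymptotic[of "- s"] by simp
  then have "(\<lambda>n. (- s gchoose n) / ((-1)^n / exp ((- s + 1) * ln (real n)))) \<longlonglongrightarrow> 1 / Gamma s"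
    by (simp add: field_simps)
  then show ?thesis
  proof (rule Lim_transform_eventually)
    show "\<forall>\<^sub>F n in sequentially. (- s gchoose n) / ((-1)^n / exp ((- s + 1) * ln (real n))) =
      real n powr (1 - s) * binom_coeff s n"
      using eventually_gt_at_top[of 0]
    proof eventually_elim
      case (elim n)
      have "((-1)::real) ^ n * (-1) ^ n = 1" by (simp flip: power_add mult_2)
      then have "(g::real) / ((-1) ^ n / e) = e * ((-1) ^ n * g)" for g e
        by (simp add: field_simps)
      then show ?case using elim
        by (simp add: binom_coeff_eq powr_def field_simps)
    qed
  qed
qed

section \<open>Power series near 1 and Karamata's Tauberian theorem\<close>

lemma ratio_bounded_by_limit:
  fixes a b :: "nat \<Rightarrow> real"
  assumes "\<And>k. 0 < b k" and "(\<lambda>k. a k / b k) \<longlonglongrightarrow> c"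
  obtains C where "\<And>k. \<bar>a k\<bar> \<le> C * b k" and "0 \<le> C"
proof -
  obtain C where C: "C > 0" "\<And>k. norm (a k / b k) \<le> C"
    using convergent_imp_Bseq[of "\<lambda>k. a k / b k"] assms(2) unfolding convergent_def Bseq_def by auto
  have "\<bar>a k\<bar> \<le> C * b k" for k
    using C(2)[of k] assms(1)[of k] by (simp add: field_simps)
  with C(1) show ?thesis by (intro that[of C]) auto
qed

text \<open>Abelian counterpart of \<open>weighted_mean_tendsto\<close>: the first \<open>N\<close>
  terms contribute at most the constant \<open>K\<close>, since the powers of \<open>x\<close> are
  at most 1, and the divergence of the denominator as \<open>x\<close> tends to 1 absorbs
  it.\<close>

lemma power_series_ratio_limit:
  fixes a b :: "nat \<Rightarrow> real"
  assumes b: "\<And>k. 0 < b k" and sb: "\<And>x. 0 < x \<Longrightarrow> x < 1 \<Longrightarrow> summable (\<lambda>k. b k * x ^ k)"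
    and div: "filterlim (\<lambda>x. \<Sum>k. b k * x ^ k) at_top (at_left 1)"
    and lim: "(\<lambda>k. a k / b k) \<longlonglongrightarrow> c"
  shows "((\<lambda>x. (\<Sum>k. a k * x ^ k) / (\<Sum>k. b k * x ^ k)) \<longlongrightarrow> c) (at_left 1)"
proof (rule tendstoI)
  fix e :: real assume e: "0 < e"
  from LIMSEQ_D[OF lim, of "e/2"] e obtain N where
    N: "\<And>k. k \<ge> N \<Longrightarrow> \<bar>a k / b k - c\<bar> < e/2" by auto
  obtain C where C: "\<And>k. \<bar>a k\<bar> \<le> C * b k" using ratio_bounded_by_limit[OF b lim] by metis
  define K where "K = (\<Sum>k<N. \<bar>a k - c * b k\<bar>)"
  have K0: "K \<ge> 0" unfolding K_def by (intro sum_nonneg) auto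
  have "\<forall>\<^sub>F x in at_left 1. (\<Sum>k. b k * x ^ k) > 2 * K / e + 1"
    using div by (simp add: filterlim_at_top_dense)
  moreover have "\<forall>\<^sub>F x in at_left (1::real). x \<in> {0<..<1}"
    by (rule eventually_at_leftI[of 0]) auto
  ultimately show "\<forall>\<^sub>F x in at_left 1. dist ((\<Sum>k. a k * x ^ k) / (\<Sum>k. b k * x ^ k)) c < e"
  proof eventually_elim
    case (elim x)
    let ?B = "\<Sum>k. b k * x ^ k"
    have x: "0 < x" "x < 1" using elim by auto
    have B0: "?B > 0"
    proof -
      have "0 \<le> 2 * K / e" using K0 e by simp
      then show ?thesis using elim(1) by linarith
    qed
    have sbx: "summable (\<lambda>k. b k * x ^ k)" using sb x by blast
    have sC: "summable (\<lambda>k. C * (b k * x ^ k))" by (rule summable_mult[OF sbx])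
    have sa: "summable (\<lambda>k. a k * x ^ k)"
    proof (rule summable_comparison_test'[OF sC, of 0])
      fix k show "norm (a k * x ^ k) \<le> C * (b k * x ^ k)"
        using mult_right_mono[OF C[of k], of "x ^ k"] x by (simp add: abs_mult mult_ac)
    qed
    have pt: "\<bar>(a k - c * b k) * x ^ k\<bar> \<le> (if k < N then \<bar>a k - c * b k\<bar> else 0) + e/2 * (b k * x ^ k)" for k
    proof (cases "k < N")
      case True
      have "\<bar>(a k - c * b k) * x ^ k\<bar> \<le> \<bar>a k - c * b k\<bar> * 1"
        using x unfolding abs_mult by (intro mult_left_mono) (auto simp: power_le_one)
      then show ?thesis using True b[of k] x e by (simp add: add_increasing2 less_imp_le)
    next
      case False
      have "\<bar>a k - c * b k\<bar> = \<bar>(a k / b k - c) * b k\<bar>"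
        using less_imp_neq[OF b[of k]] by (simp add: left_diff_distrib)
      also have "\<dots> = \<bar>a k / b k - c\<bar> * b k" using b[of k] by (simp add: abs_mult)
      also have "\<dots> \<le> e/2 * b k" using N[of k] False b[of k] by (intro mult_right_mono) auto
      finally have "\<bar>a k - c * b k\<bar> * x ^ k \<le> e/2 * b k * x ^ k"
        using x by (intro mult_right_mono) auto
      then show ?thesis using False x by (simp add: abs_mult mult_ac)
    qed
    have s1: "summable (\<lambda>k. if k < N then \<bar>a k - c * b k\<bar> else 0)"
      by (rule summable_finite[of "{..<N}"]) auto
    have K: "(\<Sum>k. if k < N then \<bar>a k - c * b k\<bar> else 0) = K"
      unfolding K_def by (subst suminf_finite[of "{..<N}"]) auto
    have s2: "summable (\<lambda>k. (if k < N then \<bar>a k - c * b k\<bar> else 0) + e/2 * (b k * x ^ k))"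
      by (intro summable_add s1 summable_mult sbx)
    have s3: "summable (\<lambda>k. \<bar>(a k - c * b k) * x ^ k\<bar>)"
      by (rule summable_comparison_test'[OF s2, of 0]) (use pt in auto)
    have "(\<Sum>k. a k * x ^ k) - c * ?B = (\<Sum>k. (a k - c * b k) * x ^ k)"
      using suminf_diff[OF sa summable_mult[OF sbx, of c]] suminf_mult[OF sbx, of c]
      by (simp add: left_diff_distrib mult.assoc)
    also have "\<bar>\<dots>\<bar> \<le> (\<Sum>k. \<bar>(a k - c * b k) * x ^ k\<bar>)" by (rule summable_rabs[OF s3])
    also have "\<dots> \<le> (\<Sum>k. (if k < N then \<bar>a k - c * b k\<bar> else 0) + e/2 * (b k * x ^ k))"
      by (rule suminf_le[OF pt s3 s2])
    also have "\<dots> = K + e/2 * ?B"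
      using suminf_add[OF s1 summable_mult[OF sbx, of "e/2"]] K suminf_mult[OF sbx, of "e/2"] by simp
    also have "K < e/2 * ?B" using elim(1) e by (simp add: field_simps)
    finally have "\<bar>(\<Sum>k. a k * x ^ k) - c * ?B\<bar> < e * ?B" by simp
    moreover have "(\<Sum>k. a k * x ^ k) / ?B - c = ((\<Sum>k. a k * x ^ k) - c * ?B) / ?B"
      using B0 by (simp add: field_simps)
    ultimately show ?case
      using B0 by (simp add: dist_real_def field_simps)
  qed
qed

text \<open>Karamata's argument. For \<open>\<phi> y = y ^ j\<close> the sum is the original one at
  \<open>x ^ Suc j\<close>, and linearity covers polynomials. Uniform approximation passes to
  continuous \<open>\<phi>\<close> because the majorant \<open>C * binom_coeff s k\<close> has the
  transform \<open>C * (1 - x) powr (- s)\<close>, which the prefactor cancels exactly.\<close>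

lemma Karamata_continuous:
  fixes d :: "nat \<Rightarrow> real" and s :: real
  assumes s: "0 < s" and bound: "\<And>k. \<bar>d k\<bar> \<le> C * binom_coeff s k" and C: "0 \<le> C"
    and lim: "((\<lambda>x. (1 - x) powr s * (\<Sum>k. d k * x ^ k)) \<longlongrightarrow> 0) (at_left 1)"
    and cont: "continuous_on {0..1} \<phi>"
  shows "((\<lambda>x. (1 - x) powr s * (\<Sum>k. d k * x ^ k * \<phi> (x ^ k))) \<longlongrightarrow> 0) (at_left 1)"
proof -
  have in01: "\<forall>\<^sub>F x in at_left (1::real). x \<in> {0<..<1}"
    by (rule eventually_at_leftI[of 0]) auto
  have summ: "summable (\<lambda>k. d k * x ^ k * \<psi> (x ^ k))" "summable (\<lambda>k. \<bar>d k * x ^ k * \<psi> (x ^ k)\<bar>)"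
    and est: "\<bar>(1 - x) powr s * (\<Sum>k. d k * x ^ k * \<psi> (x ^ k))\<bar> \<le> C * B"
    if x: "x \<in> {0<..<1}" and B: "\<And>y. y \<in> {0..1} \<Longrightarrow> \<bar>\<psi> y\<bar> \<le> B" for x B and \<psi> :: "real \<Rightarrow> real"
  proof -
    have B0: "B \<ge> 0" using B[of 0] by auto
    have pt: "\<bar>d k * x ^ k * \<psi> (x ^ k)\<bar> \<le> C * B * (binom_coeff s k * x ^ k)" for k
    proof -
      have "\<bar>d k\<bar> * x ^ k * \<bar>\<psi> (x ^ k)\<bar> \<le> (C * binom_coeff s k) * x ^ k * B"
        using x C B0 binom_coeff_pos[OF s, of k]
        by (intro mult_mono bound B) (auto simp: power_le_one)
      then show ?thesis using x by (simp add: abs_mult mult_ac)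
    qed
    have sv: "(\<lambda>k. binom_coeff s k * x ^ k) sums (1 - x) powr (- s)"
      using x by (intro binom_coeff_sums) auto
    have sv': "summable (\<lambda>k. C * B * (binom_coeff s k * x ^ k))"
      by (intro summable_mult) (rule sums_summable[OF sv])
    show 1: "summable (\<lambda>k. \<bar>d k * x ^ k * \<psi> (x ^ k)\<bar>)"
      by (rule summable_comparison_test'[OF sv', of 0]) (use pt in auto)
    then show "summable (\<lambda>k. d k * x ^ k * \<psi> (x ^ k))" by (rule summable_rabs_cancel)
    have "\<bar>\<Sum>k. d k * x ^ k * \<psi> (x ^ k)\<bar> \<le> (\<Sum>k. \<bar>d k * x ^ k * \<psi> (x ^ k)\<bar>)"
      by (rule summable_rabs[OF 1])
    also have "\<dots> \<le> (\<Sum>k. C * B * (binom_coeff s k * x ^ k))"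
      by (rule suminf_le[OF pt 1 sv'])
    also have "\<dots> = C * B * (1 - x) powr (- s)"
      using sums_mult[OF sv, of "C * B"] by (simp add: sums_iff)
    finally have "(1 - x) powr s * \<bar>\<Sum>k. d k * x ^ k * \<psi> (x ^ k)\<bar> \<le> (1 - x) powr s * (C * B * (1 - x) powr (- s))"
      by (intro mult_left_mono) auto
    also have "\<dots> = C * B" using x by (simp add: powr_minus field_simps)
    finally show "\<bar>(1 - x) powr s * (\<Sum>k. d k * x ^ k * \<psi> (x ^ k))\<bar> \<le> C * B"
      by (simp add: abs_mult)
  qed
  \<comment> \<open>The prefactor at \<open>x\<close> is at most the one at
    \<open>x ^ Suc j\<close>, which also tends to 1 from the left; so the hypothesis along
    \<open>x ^ Suc j\<close> dominates.\<close>
  have mono: "((\<lambda>x. (1 - x) powr s * (\<Sum>k. d k * x ^ k * (x ^ k) ^ j)) \<longlongrightarrow> 0) (at_left 1)" for j :: nat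
  proof -
    have f: "filterlim (\<lambda>x::real. x ^ Suc j) (at_left 1) (at_left 1)"
    proof (rule filterlim_at_withinI)
      have "((\<lambda>x::real. x ^ Suc j) \<longlongrightarrow> 1 ^ Suc j) (at_left 1)" by (intro tendsto_intros)
      then show "((\<lambda>x::real. x ^ Suc j) \<longlongrightarrow> 1) (at_left 1)" by simp
      show "\<forall>\<^sub>F x::real in at_left 1. x ^ Suc j \<in> {..<1} - {1}"
        using in01 by eventually_elim (auto simp: power_less_one_iff simp del: power_Suc)
    qed
    have l: "((\<lambda>x. \<bar>(1 - x ^ Suc j) powr s * (\<Sum>k. d k * (x ^ Suc j) ^ k)\<bar>) \<longlongrightarrow> 0) (at_left 1)"
      using tendsto_rabs[OF filterlim_compose[OF lim f]] by simp
    show ?thesis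
    proof (rule tendsto_rabs_zero_cancel, rule tendsto_sandwich[OF _ _ tendsto_const l])
      show "\<forall>\<^sub>F x in at_left 1. \<bar>(1 - x) powr s * (\<Sum>k. d k * x ^ k * (x ^ k) ^ j)\<bar> \<le>
        \<bar>(1 - x ^ Suc j) powr s * (\<Sum>k. d k * (x ^ Suc j) ^ k)\<bar>"
        using in01
      proof eventually_elim
        case (elim x)
        have "d k * x ^ k * (x ^ k) ^ j = d k * (x ^ Suc j) ^ k" for k
        proof -
          have "x ^ k * (x ^ k) ^ j = (x ^ Suc j) ^ k" by (metis mult.commute power_Suc power_mult)
          then show ?thesis by (simp only: mult.assoc)
        qed
        moreover have "x ^ Suc j \<le> x" using elim
          by (metis greaterThanLessThan_iff less_eq_real_def power_decreasing power_one_right Suc_le_mono le0 One_nat_def)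
        then have "(1 - x) powr s \<le> (1 - x ^ Suc j) powr s"
          using elim s by (intro powr_mono2) auto
        ultimately show ?case
          unfolding abs_mult by (simp only:) (intro mult_right_mono, auto)
      qed
    qed auto
  qed
  have poly: "((\<lambda>x. (1 - x) powr s * (\<Sum>k. d k * x ^ k * (\<Sum>i\<le>m. a i * (x ^ k) ^ i))) \<longlongrightarrow> 0) (at_left 1)"
    for m :: nat and a :: "nat \<Rightarrow> real"
  proof -
    have "((\<lambda>x. \<Sum>i\<le>m. a i * ((1 - x) powr s * (\<Sum>k. d k * x ^ k * (x ^ k) ^ i))) \<longlongrightarrow> (\<Sum>i\<le>m. a i * 0)) (at_left 1)"
      by (intro tendsto_intros mono)
    then have "((\<lambda>x. \<Sum>i\<le>m. a i * ((1 - x) powr s * (\<Sum>k. d k * x ^ k * (x ^ k) ^ i))) \<longlongrightarrow> 0) (at_left 1)"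
      by simp
    then show ?thesis
    proof (rule Lim_transform_eventually)
      show "\<forall>\<^sub>F x in at_left 1. (\<Sum>i\<le>m. a i * ((1 - x) powr s * (\<Sum>k. d k * x ^ k * (x ^ k) ^ i))) =
        (1 - x) powr s * (\<Sum>k. d k * x ^ k * (\<Sum>i\<le>m. a i * (x ^ k) ^ i))"
        using in01
      proof eventually_elim
        case (elim x)
        have si: "summable (\<lambda>k. d k * x ^ k * (x ^ k) ^ i)" for i
          by (rule summ(1)[OF elim, of "\<lambda>y. y ^ i" 1]) (auto simp: power_le_one)
        have "(\<Sum>k. d k * x ^ k * (\<Sum>i\<le>m. a i * (x ^ k) ^ i)) = (\<Sum>k. \<Sum>i\<le>m. a i * (d k * x ^ k * (x ^ k) ^ i))"
          by (simp add: sum_distrib_left mult_ac)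
        also have "\<dots> = (\<Sum>i\<le>m. \<Sum>k. a i * (d k * x ^ k * (x ^ k) ^ i))"
          by (intro suminf_sum summable_mult si)
        also have "\<dots> = (\<Sum>i\<le>m. a i * (\<Sum>k. d k * x ^ k * (x ^ k) ^ i))"
          by (intro sum.cong refl suminf_mult si)
        finally show ?case by (simp add: sum_distrib_left mult_ac)
      qed
    qed
  qed
  show ?thesis
  proof (rule tendstoI)
    fix e :: real assume e: "0 < e"
    \<comment> \<open>\<open>C + 1\<close> in place of \<open>C\<close> covers \<open>C = 0\<close>;
      the approximation then costs at most \<open>e / 2\<close>.\<close>
    define \<delta> where "\<delta> = e / (2 * (C + 1))"
    have \<delta>: "\<delta> > 0" using e C by (simp add: \<delta>_def)
    obtain g where g: "real_polynomial_function g" and gd: "\<And>y. y \<in> {0..1} \<Longrightarrow> \<bar>\<phi> y - g y\<bar> < \<delta>"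
      using Stone_Weierstrass_real_polynomial_function[OF compact_Icc cont \<delta>] by metis
    obtain a m where ga: "g = (\<lambda>y. \<Sum>i\<le>m. a i * y ^ i)"
      using g unfolding real_polynomial_function_iff_sum by auto
    obtain G where G: "\<And>y. y \<in> {0..1} \<Longrightarrow> \<bar>g y\<bar> \<le> G"
    proof -
      have "continuous_on {0..1} g" unfolding ga by (intro continuous_intros)
      then have "bounded (g ` {0..1})" by (intro compact_imp_bounded compact_continuous_image compact_Icc)
      then obtain G where "\<forall>y\<in>{0..1}. \<bar>g y\<bar> \<le> G" by (auto simp: bounded_iff)
      then show ?thesis using that[of G] by blast
    qed
    have "\<forall>\<^sub>F x in at_left 1. dist ((1 - x) powr s * (\<Sum>k. d k * x ^ k * g (x ^ k))) 0 < e / 2"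
      using tendstoD[OF poly[where m = m and a = a], of "e/2"] e unfolding ga by simp
    then show "\<forall>\<^sub>F x in at_left 1. dist ((1 - x) powr s * (\<Sum>k. d k * x ^ k * \<phi> (x ^ k))) 0 < e"
      using in01
    proof eventually_elim
      case (elim x)
      have 1: "summable (\<lambda>k. d k * x ^ k * (\<phi> (x ^ k) - g (x ^ k)))"
        by (rule summ(1)[OF elim(2), of "\<lambda>y. \<phi> y - g y" \<delta>]) (use gd in \<open>auto intro: less_imp_le\<close>)
      have 2: "summable (\<lambda>k. d k * x ^ k * g (x ^ k))"
        by (rule summ(1)[OF elim(2) G])
      have "(1 - x) powr s * (\<Sum>k. d k * x ^ k * \<phi> (x ^ k)) =
        (1 - x) powr s * (\<Sum>k. d k * x ^ k * (\<phi> (x ^ k) - g (x ^ k))) + (1 - x) powr s * (\<Sum>k. d k * x ^ k * g (x ^ k))"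
      proof -
        have "(\<Sum>k. d k * x ^ k * \<phi> (x ^ k)) =
          (\<Sum>k. d k * x ^ k * (\<phi> (x ^ k) - g (x ^ k)) + d k * x ^ k * g (x ^ k))"
          by (simp add: right_diff_distrib)
        also have "\<dots> = (\<Sum>k. d k * x ^ k * (\<phi> (x ^ k) - g (x ^ k))) + (\<Sum>k. d k * x ^ k * g (x ^ k))"
          by (rule suminf_add[OF 1 2, symmetric])
        finally show ?thesis by (simp add: distrib_left)
      qed
      moreover have "\<bar>(1 - x) powr s * (\<Sum>k. d k * x ^ k * (\<phi> (x ^ k) - g (x ^ k)))\<bar> \<le> C * \<delta>"
        by (rule est[OF elim(2), of "\<lambda>y. \<phi> y - g y" \<delta>]) (use gd in \<open>auto intro: less_imp_le\<close>)
      moreover have "C * \<delta> \<le> e / 2" using e C by (simp add: \<delta>_def field_simps)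
      ultimately show ?case using elim(1) by (simp add: dist_real_def)
    qed
  qed
qed

text \<open>The hat is at least 1/2 on the middle half of \<open>[a, b]\<close>, which contains at
  least \<open>n (b - a) / 2 - 1\<close> of the points \<open>k / n\<close>. The premise that
  \<open>n (b - a)\<close> is at least 4 makes this number at least
  \<open>n (b - a) / 4\<close>.\<close>

lemma hat_sum_lower_bound:
  fixes a b :: real
  assumes ab: "0 < a" "a < b"
  defines "\<psi> \<equiv> (\<lambda>t. max 0 (1 - \<bar>t - (a + b) / 2\<bar> * (2 / (b - a))))"
  assumes n: "real n * (b - a) \<ge> 4" and m: "real m \<ge> b * real n"
  shows "(\<Sum>k\<le>m. \<psi> (real k / real n)) \<ge> real n * (b - a) / 8"
proof -
  define p where "p = nat \<lceil>(a + (b - a) / 4) * real n\<rceil>"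
  define q where "q = nat \<lfloor>(b - (b - a) / 4) * real n\<rfloor>"
  have n0: "real n > 0" using n ab by (cases "n = 0") auto
  have p: "real p < (a + (b - a) / 4) * real n + 1" "real p \<ge> (a + (b - a) / 4) * real n"
    using ab n0 unfolding p_def by (simp_all add: of_nat_nat) linarith+
  have q: "real q > (b - (b - a) / 4) * real n - 1" "real q \<le> (b - (b - a) / 4) * real n"
    using ab n0 unfolding q_def by (auto simp: of_nat_nat)
  have "real n * (b - a) / 8 \<le> (real n * (b - a) / 2 - 1) / 2" using n by simp
  also have "\<dots> \<le> (real q + 1 - real p) / 2"
  proof -
    have "(b - (b - a) / 4) * real n - (a + (b - a) / 4) * real n = real n * (b - a) / 2"
      by (simp add: field_simps)
    then have "real n * (b - a) / 2 - 1 \<le> real q + 1 - real p" using p(1) q(1) by linarith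
    then show ?thesis by (simp add: divide_right_mono)
  qed
  also have "\<dots> \<le> real (card {p..q}) * (1/2)" by simp
  also have "\<dots> = (\<Sum>k\<in>{p..q}. 1/2)" by simp
  also have "\<dots> \<le> (\<Sum>k\<in>{p..q}. \<psi> (real k / real n))"
  proof (rule sum_mono)
    fix k assume k: "k \<in> {p..q}"
    have "a + (b - a) / 4 \<le> real k / real n" "real k / real n \<le> b - (b - a) / 4"
      using k p(2) q(2) n0 by (auto simp: field_simps intro: order_trans)
    then have "\<bar>real k / real n - (a + b) / 2\<bar> \<le> (b - a) / 4" unfolding abs_le_iff by argo
    then have "\<bar>real k / real n - (a + b) / 2\<bar> * (2 / (b - a)) \<le> (b - a) / 4 * (2 / (b - a))"
      using ab by (intro mult_right_mono) auto
    also have "(b - a) / 4 * (2 / (b - a)) = 1 / 2" using ab by simp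
    finally show "1 / 2 \<le> \<psi> (real k / real n)" unfolding \<psi>_def by linarith
  qed
  also have "\<dots> \<le> (\<Sum>k\<le>m. \<psi> (real k / real n))"
  proof (rule sum_mono2)
    have "real q \<le> b * real n" using q(2) ab n0 by (smt (verit) mult_right_mono divide_pos_pos)
    then show "{p..q} \<subseteq> {..m}" using m by auto
  qed (auto simp: \<psi>_def)
  finally show ?thesis .
qed

text \<open>Testing against a hat function supported on \<open>[a n, b n]\<close> localises the comparison near the index \<open>n\<close>.\<close>

lemma Karamata_window:
  fixes d :: "nat \<Rightarrow> real" and s a b :: real
  assumes s: "0 < s" and bound: "\<And>k. \<bar>d k\<bar> \<le> C * binom_coeff s k" and C: "0 \<le> C"
    and lim: "((\<lambda>x. (1 - x) powr s * (\<Sum>k. d k * x ^ k)) \<longlongrightarrow> 0) (at_left 1)"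
    and ab: "0 < a" "a < b" "b \<le> 3"
  defines "\<psi> \<equiv> (\<lambda>t. max 0 (1 - \<bar>t - (a + b) / 2\<bar> * (2 / (b - a))))"
  shows "(\<lambda>n. real n powr (- s) * (\<Sum>k\<le>3 * n. d k * \<psi> (real k / real n))) \<longlonglongrightarrow> 0"
proof -
  have \<psi>_out: "\<psi> t = 0" if "t \<le> a \<or> t \<ge> b" for t
  proof -
    have "\<bar>t - (a + b) / 2\<bar> \<ge> (b - a) / 2" using that ab by (auto simp: abs_if field_simps)
    then have "\<bar>t - (a + b) / 2\<bar> * (2 / (b - a)) \<ge> (b - a) / 2 * (2 / (b - a))"
      using ab by (intro mult_right_mono) auto
    moreover have "(b - a) / 2 * (2 / (b - a)) = 1" using ab by simp
    ultimately have "\<bar>t - (a + b) / 2\<bar> * (2 / (b - a)) \<ge> 1" by linarith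
    then show ?thesis unfolding \<psi>_def by (intro max_absorb1) linarith
  qed
  \<comment> \<open>The exponent matches \<open>b \<le> 3\<close>: the hat at \<open>- ln y\<close>
    is 0 for \<open>y \<le> \<eta>\<close>, so clamping \<open>y\<close> at \<open>\<eta>\<close> is
    consistent there and keeps \<open>\<phi>\<close> continuous at 0.\<close>
  define \<eta> where "\<eta> = exp (- 3 :: real)"
  define \<phi> where "\<phi> y = \<psi> (- ln (max y \<eta>)) / max y \<eta>" for y
  have \<eta>: "\<eta> > 0" by (simp add: \<eta>_def)
  have mx: "max y \<eta> \<noteq> 0" "max y \<eta> > 0" for y using \<eta> by (auto simp: max_def)
  have cont: "continuous_on {0..1} \<phi>"
    unfolding \<phi>_def \<psi>_def using mx by (intro continuous_intros) auto
  have \<phi>: "y * \<phi> y = \<psi> (- ln y)" if y: "y > 0" for y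
  proof (cases "y \<ge> \<eta>")
    case True
    then show ?thesis using y by (simp add: \<phi>_def max_def)
  next
    case False
    then have "ln y \<le> ln \<eta>" using y by (subst ln_le_cancel_iff) (auto simp: \<eta>)
    then have "\<psi> (- ln y) = 0" using ab by (intro \<psi>_out) (simp add: \<eta>_def)
    moreover have "\<psi> (- ln \<eta>) = 0" using ab by (intro \<psi>_out) (simp add: \<eta>_def)
    ultimately show ?thesis using False by (simp add: \<phi>_def max_def)
  qed
  \<comment> \<open>At \<open>x = exp (- 1 / n)\<close> the power \<open>x ^ k\<close> is
    \<open>exp (- k / n)\<close>, so \<open>y * \<phi> y\<close> becomes the hat at
    \<open>k / n\<close>, while \<open>1 - x\<close> is asymptotic to \<open>1 / n\<close>.\<close>
  have "filterlim (\<lambda>n. exp (- 1 / real n)) (at_left 1) sequentially"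
    by real_asymp
  from filterlim_compose[OF Karamata_continuous[OF s bound C lim cont] this]
  have "(\<lambda>n. (1 - exp (- 1 / real n)) powr s * (\<Sum>k. d k * exp (- 1 / real n) ^ k * \<phi> (exp (- 1 / real n) ^ k))) \<longlonglongrightarrow> 0" .
  moreover have "(\<lambda>n. real n powr (- s) / (1 - exp (- 1 / real n)) powr s) \<longlonglongrightarrow> 1"
    using s by real_asymp
  ultimately have "(\<lambda>n. (real n powr (- s) / (1 - exp (- 1 / real n)) powr s) * ((1 - exp (- 1 / real n)) powr s *
    (\<Sum>k. d k * exp (- 1 / real n) ^ k * \<phi> (exp (- 1 / real n) ^ k)))) \<longlonglongrightarrow> 1 * 0"
    by (intro tendsto_mult)
  then have "(\<lambda>n. (real n powr (- s) / (1 - exp (- 1 / real n)) powr s) * ((1 - exp (- 1 / real n)) powr s *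
    (\<Sum>k. d k * exp (- 1 / real n) ^ k * \<phi> (exp (- 1 / real n) ^ k)))) \<longlonglongrightarrow> 0" by simp
  then show ?thesis
  proof (rule Lim_transform_eventually)
    show "\<forall>\<^sub>F n in sequentially. (real n powr (- s) / (1 - exp (- 1 / real n)) powr s) * ((1 - exp (- 1 / real n)) powr s *
    (\<Sum>k. d k * exp (- 1 / real n) ^ k * \<phi> (exp (- 1 / real n) ^ k))) =
      real n powr (- s) * (\<Sum>k\<le>3 * n. d k * \<psi> (real k / real n))"
      using eventually_gt_at_top[of 0]
    proof eventually_elim
      case (elim n)
      let ?x = "exp (- 1 / real n)"
      have xk: "?x ^ k = exp (- (real k / real n))" for k
        by (simp flip: exp_of_nat_mult)
      have "?x ^ k * \<phi> (?x ^ k) = \<psi> (real k / real n)" for k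
        using \<phi>[of "?x ^ k"] unfolding xk by simp
      then have "(\<Sum>k. d k * ?x ^ k * \<phi> (?x ^ k)) = (\<Sum>k. d k * \<psi> (real k / real n))"
        by (simp add: mult.assoc)
      also have "\<dots> = (\<Sum>k\<le>3 * n. d k * \<psi> (real k / real n))"
      proof (rule suminf_finite)
        fix k assume "k \<notin> {..3 * n}"
        then have "3 * real n \<le> real k" by simp
        moreover have "b * real n \<le> 3 * real n" using ab by (intro mult_right_mono) auto
        ultimately have "b * real n \<le> real k" by linarith
        then have "real k / real n \<ge> b" using elim by (simp add: pos_le_divide_eq)
        then show "d k * \<psi> (real k / real n) = 0" using \<psi>_out by simp
      qed simp
      finally have sum_eq: "(\<Sum>k. d k * ?x ^ k * \<phi> (?x ^ k)) = (\<Sum>k\<le>3 * n. d k * \<psi> (real k / real n))" .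
      have "(1 - ?x) powr s \<noteq> 0" using elim by simp
      then have cancel: "(p / (1 - ?x) powr s) * ((1 - ?x) powr s * q) = p * q" for p q by simp
      show ?case unfolding sum_eq by (rule cancel)
    qed
  qed
qed

text \<open>Let \<open>d\<close> be \<open>u\<close> minus \<open>c\<close> times the binomial
  coefficients. Its scaled transform tends to 0, hence so do its scaled window sums. On a window
  just right of \<open>n\<close> monotonicity gives \<open>u k \<le> u n\<close>, on one just left
  of \<open>n\<close> it gives \<open>u n \<le> u k\<close>, and the comparison sequence is monotone
  and explicit. Averages over the two windows thus bound \<open>u n\<close> from below and from
  above, with an error that disappears as the windows shrink.\<close>

theorem Karamata_monotone:
  fixes u :: "nat \<Rightarrow> real" and s c :: real
  assumes s: "0 < s" "s < 1" and dec: "decseq u" and c: "0 \<le> c" and u0: "\<And>n. 0 \<le> u n"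
    and lim: "((\<lambda>x. (1 - x) powr s * (\<Sum>k. u k * x ^ k)) \<longlongrightarrow> c) (at_left 1)"
  shows "(\<lambda>n. real n powr (1 - s) * u n) \<longlonglongrightarrow> c / Gamma s"
proof -
  let ?v = "binom_coeff s"
  define d where "d k = u k - c * ?v k" for k
  have in01: "\<forall>\<^sub>F x in at_left (1::real). x \<in> {0<..<1}"
    by (rule eventually_at_leftI[of 0]) auto
  \<comment> \<open>At \<open>x n = exp (- 1 / n)\<close> each of the first \<open>n\<close> powers
    is at least \<open>exp (- 1)\<close>, so by monotonicity \<open>n * u n * exp (- 1)\<close> is
    at most the power series. \<open>f\<close> collects the quotients that turn this into
    \<open>u n \<le> f n * ?v n\<close>, and it converges.\<close>
  obtain C where bound: "\<And>k. \<bar>u k\<bar> \<le> C * ?v k" and C0: "C \<ge> 0"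
  proof -
    define x where "x n = exp (- 1 / real n)" for n :: nat
    define U where "U n = (\<Sum>k. u k * x n ^ k)" for n
    define f where "f n = exp 1 * (real n powr (- s) / (1 - x n) powr s) * ((1 - x n) powr s * U n) / (real n powr (1 - s) * ?v n)" for n
    have xl: "filterlim x (at_left 1) sequentially" unfolding x_def by real_asymp
    have 1: "(\<lambda>n. real n powr (- s) / (1 - x n) powr s) \<longlonglongrightarrow> 1"
      unfolding x_def using s by real_asymp
    have G: "Gamma s > 0" using s by (intro Gamma_real_pos) auto
    have "f \<longlonglongrightarrow> exp 1 * 1 * c / (1 / Gamma s)"
      unfolding f_def U_def using G
      by (intro tendsto_intros 1 filterlim_compose[OF lim xl] binom_coeff_asymptotic s(1)) auto
    then obtain K where K: "\<And>n. \<bar>f n\<bar> \<le> K"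
      using convergent_imp_Bseq[of f] unfolding convergent_def Bseq_def by auto
    have le_f: "u n \<le> f n * ?v n" if n: "n > 0" for n
    proof -
      have xn: "0 < x n" "x n < 1" using n by (auto simp: x_def)
      have su: "summable (\<lambda>k. u k * x n ^ k)"
      proof (rule summable_comparison_test'[of "\<lambda>k. u 0 * x n ^ k" 0])
        show "summable (\<lambda>k. u 0 * x n ^ k)" using xn by (intro summable_mult summable_geometric) auto
        fix k show "norm (u k * x n ^ k) \<le> u 0 * x n ^ k"
          using decseqD[OF dec, of 0 k] u0[of k] xn by (auto intro!: mult_right_mono simp: abs_mult)
      qed
      have "u n * real n * exp (- 1) = (\<Sum>k<n. u n * exp (- 1))" by simp
      also have "\<dots> \<le> (\<Sum>k<n. u k * x n ^ k)"
      proof (intro sum_mono mult_mono)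
        fix k assume k: "k \<in> {..<n}"
        show "u n \<le> u k" using k by (intro decseqD[OF dec]) auto
        have "x n ^ k = exp (- (real k / real n))" unfolding x_def by (simp flip: exp_of_nat_mult)
        then show "exp (- 1) \<le> x n ^ k" using k n by simp
      qed (use u0 in auto)
      also have "\<dots> \<le> U n" unfolding U_def
        using u0 xn by (intro sum_le_suminf su) (auto intro!: mult_nonneg_nonneg less_imp_le)
      finally have "u n \<le> exp 1 * U n / real n" using n by (simp add: field_simps exp_minus)
      also have "\<dots> = f n * ?v n"
        using n xn binom_coeff_pos[OF s(1), of n]
        by (simp add: f_def powr_diff powr_minus field_simps)
      finally show ?thesis .
    qed
    \<comment> \<open>As \<open>?v 0 = 1\<close>, the maximum with \<open>u 0\<close> takes care of
      \<open>n = 0\<close>, which \<open>le_f\<close> excludes.\<close>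
    have "\<bar>u n\<bar> \<le> max K (u 0) * ?v n" for n
    proof (cases "n = 0")
      case True
      then show ?thesis using u0[of 0] by (simp add: binom_coeff_def)
    next
      case False
      have v: "?v n \<ge> 0" using binom_coeff_pos[OF s(1), of n] by simp
      have "u n \<le> f n * ?v n" using False by (intro le_f) simp
      also have "\<dots> \<le> max K (u 0) * ?v n" using K[of n] v by (intro mult_right_mono) auto
      finally show ?thesis using u0[of n] by simp
    qed
    moreover have "max K (u 0) \<ge> 0" using u0[of 0] by simp
    ultimately show ?thesis by (rule that)
  qed
  define C' where "C' = C + c"
  have d_bound: "\<bar>d k\<bar> \<le> C' * ?v k" for k
    using bound[of k] c binom_coeff_pos[OF s(1), of k] unfolding d_def C'_def
    by (simp add: distrib_right abs_le_iff) (smt (verit) mult_nonneg_nonneg)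
  have d_lim: "((\<lambda>x. (1 - x) powr s * (\<Sum>k. d k * x ^ k)) \<longlongrightarrow> 0) (at_left 1)"
  proof -
    have "((\<lambda>x. (1 - x) powr s * (\<Sum>k. u k * x ^ k) - c) \<longlongrightarrow> c - c) (at_left 1)"
      by (intro tendsto_intros lim)
    then have "((\<lambda>x. (1 - x) powr s * (\<Sum>k. u k * x ^ k) - c) \<longlongrightarrow> 0) (at_left 1)" by simp
    then show ?thesis
    proof (rule Lim_transform_eventually)
      show "\<forall>\<^sub>F x in at_left 1. (1 - x) powr s * (\<Sum>k. u k * x ^ k) - c = (1 - x) powr s * (\<Sum>k. d k * x ^ k)"
        using in01
      proof eventually_elim
        case (elim x)
        have sv: "(\<lambda>k. ?v k * x ^ k) sums (1 - x) powr (- s)"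
          using elim by (intro binom_coeff_sums) auto
        have su: "summable (\<lambda>k. u k * x ^ k)"
        proof (rule summable_comparison_test'[OF summable_mult[OF sums_summable[OF sv], of C], of 0])
          fix k show "norm (u k * x ^ k) \<le> C * (?v k * x ^ k)"
            using mult_right_mono[OF bound[of k], of "x ^ k"] elim by (simp add: abs_mult mult_ac)
        qed
        have "(\<lambda>k. u k * x ^ k - c * (?v k * x ^ k)) sums ((\<Sum>k. u k * x ^ k) - c * (1 - x) powr (- s))"
          by (intro sums_diff sums_mult sv summable_sums su)
        then have "(\<Sum>k. d k * x ^ k) = (\<Sum>k. u k * x ^ k) - c * (1 - x) powr (- s)"
          unfolding sums_iff d_def left_diff_distrib by (simp add: mult.assoc)
        then show ?case using elim by (simp add: powr_minus field_simps)
      qed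
    qed
  qed
  have window: "(\<lambda>n. real n powr (- s) * (\<Sum>k\<le>3 * n. d k *
      max 0 (1 - \<bar>real k / real n - (a + b) / 2\<bar> * (2 / (b - a))))) \<longlonglongrightarrow> 0"
    if "0 < a" "a < b" "b \<le> 3" for a b
    by (rule Karamata_window[OF s(1) d_bound _ d_lim that]) (use C0 c in \<open>simp add: C'_def\<close>)
  define w where "w a b n = (\<Sum>k\<le>3 * n. max 0 (1 - \<bar>real k / real n - (a + b) / 2\<bar> * (2 / (b - a))))" for a b :: real and n :: nat
  define T where "T a b n = real n powr (- s) * (\<Sum>k\<le>3 * n. d k *
      max 0 (1 - \<bar>real k / real n - (a + b) / 2\<bar> * (2 / (b - a))))" for a b :: real and n :: nat
  have supp: "a * real n < real k \<and> real k < b * real n"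
    if "max 0 (1 - \<bar>real k / real n - (a + b) / 2\<bar> * (2 / (b - a))) \<noteq> 0" "a < b" "n > 0" for a b :: real and k n :: nat
  proof -
    have "\<bar>real k / real n - (a + b) / 2\<bar> * (2 / (b - a)) < 1"
      using that(1) by (metis diff_le_0_iff_le linorder_not_le max_absorb1)
    then have "\<bar>real k / real n - (a + b) / 2\<bar> < (b - a) / 2" using that(2) by (simp add: field_simps)
    then have "a < real k / real n" "real k / real n < b"
      unfolding abs_less_iff by argo+
    then show ?thesis using that(3) by (simp add: pos_less_divide_eq pos_divide_less_eq)
  qed
  \<comment> \<open>A lower bound \<open>D\<close> for \<open>\<sigma> * d\<close> on the window is
    multiplied by the total mass of the hat, at least \<open>n (b - a) / 8\<close>. As
    \<open>T\<close> tends to 0, the scaled \<open>D\<close> has upper limit at most 0. The two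
    signs of \<open>\<sigma>\<close> serve the two sides.\<close>
  have key: "real n powr (1 - s) * D \<le> \<bar>T a b n\<bar> * (8 / (b - a))"
    if ab: "0 < a" "a < b" "b \<le> 3" and n: "n > 0" "real n * (b - a) \<ge> 4" and \<sigma>: "\<bar>\<sigma>\<bar> = 1" and
      D: "\<And>k. a * real n < real k \<Longrightarrow> real k < b * real n \<Longrightarrow> D \<le> \<sigma> * d k" for a b \<sigma> D :: real and n :: nat
  proof (cases "D \<le> 0")
    case True
    have "real n powr (1 - s) * D \<le> 0" using True by (simp add: mult_nonneg_nonpos)
    also have "0 \<le> \<bar>T a b n\<bar> * (8 / (b - a))" using ab by simp
    finally show ?thesis .
  next
    case False
    let ?h = "\<lambda>k. max 0 (1 - \<bar>real k / real n - (a + b) / 2\<bar> * (2 / (b - a)))"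
    have "D * (real n * (b - a) / 8) \<le> D * w a b n"
    proof (rule mult_left_mono)
      show "real n * (b - a) / 8 \<le> w a b n"
        unfolding w_def by (rule hat_sum_lower_bound) (use ab n in \<open>auto intro!: mult_right_mono\<close>)
    qed (use False in auto)
    also have "\<dots> \<le> (\<Sum>k\<le>3 * n. \<sigma> * (d k * ?h k))"
      unfolding w_def sum_distrib_left
    proof (rule sum_mono)
      fix k
      have "D * ?h k \<le> (\<sigma> * d k) * ?h k"
        using supp[of k n a b] D[of k] ab n by (cases "?h k = 0") (auto intro!: mult_right_mono)
      then show "D * ?h k \<le> \<sigma> * (d k * ?h k)" by (simp add: mult.assoc)
    qed
    also have "\<dots> \<le> \<bar>\<sigma> * (\<Sum>k\<le>3 * n. d k * ?h k)\<bar>" by (simp add: sum_distrib_left)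
    also have "\<dots> = real n powr s * \<bar>T a b n\<bar>"
      unfolding T_def abs_mult using \<sigma> n by (simp add: powr_minus field_simps)
    finally have "real n powr (- s) * (D * (real n * (b - a) / 8)) \<le> real n powr (- s) * (real n powr s * \<bar>T a b n\<bar>)"
      by (intro mult_left_mono) auto
    also have "\<dots> = \<bar>T a b n\<bar>" using n by (simp add: powr_minus field_simps)
    also have "real n powr (- s) * (D * (real n * (b - a) / 8)) = real n powr (1 - s) * D * ((b - a) / 8)"
      using n by (simp add: powr_diff powr_minus field_simps)
    finally show ?thesis using ab by (simp add: field_simps)
  qed
  \<comment> \<open>Regular variation of the comparison sequence: moving the index from
    \<open>n\<close> to about \<open>\<tau> n\<close> changes it by the factor
    \<open>\<tau> powr (s - 1)\<close>.\<close>
  have v_scaled: "(\<lambda>n. real n powr (1 - s) * ?v (N n)) \<longlonglongrightarrow> \<tau> powr (s - 1) / Gamma s"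
    if N: "(\<lambda>n. real (N n) / real n) \<longlonglongrightarrow> \<tau>" and \<tau>: "0 < \<tau>" for N :: "nat \<Rightarrow> nat" and \<tau> :: real
  proof -
    have Ntop: "filterlim N at_top sequentially"
    proof -
      have "filterlim (\<lambda>n. real (N n) / real n * real n) at_top sequentially"
        by (rule filterlim_tendsto_pos_mult_at_top[OF N \<tau> filterlim_real_sequentially])
      then have "filterlim (\<lambda>n. real (N n)) at_top sequentially"
      proof (rule filterlim_mono_eventually)
        show "\<forall>\<^sub>F n in sequentially. real (N n) / real n * real n = real (N n)"
          using eventually_gt_at_top[of 0] by eventually_elim simp
      qed simp_all
      then show ?thesis by (simp add: filterlim_sequentially_iff_filterlim_real)
    qed
    have "(\<lambda>n. (real (N n) / real n) powr (s - 1) * (real (N n) powr (1 - s) * ?v (N n))) \<longlonglongrightarrow> \<tau> powr (s - 1) * (1 / Gamma s)"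
      using \<tau> by (intro tendsto_mult tendsto_powr N tendsto_const filterlim_compose[OF binom_coeff_asymptotic[OF s(1)] Ntop]) auto
    then have "(\<lambda>n. (real (N n) / real n) powr (s - 1) * (real (N n) powr (1 - s) * ?v (N n))) \<longlonglongrightarrow> \<tau> powr (s - 1) / Gamma s"
      by simp
    then show ?thesis
    proof (rule Lim_transform_eventually)
      have "\<forall>\<^sub>F n in sequentially. N n > 0"
        by (rule eventually_compose_filterlim[OF eventually_gt_at_top Ntop])
      then show "\<forall>\<^sub>F n in sequentially. (real (N n) / real n) powr (s - 1) * (real (N n) powr (1 - s) * ?v (N n)) =
         real n powr (1 - s) * ?v (N n)"
        using eventually_gt_at_top[of 0]
      proof eventually_elim
        case (elim n)
        have "(real (N n) / real n) powr (s - 1) * real (N n) powr (1 - s) =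
          (real (N n) powr (s - 1) * real (N n) powr (1 - s)) * (1 / real n powr (s - 1))"
          by (simp add: powr_divide)
        also have "real (N n) powr (s - 1) * real (N n) powr (1 - s) = 1"
          using elim by (simp flip: powr_add)
        also have "1 / real n powr (s - 1) = real n powr (1 - s)"
          by (simp flip: powr_minus_divide)
        finally show ?case by (simp flip: mult.assoc)
      qed
    qed
  qed
  have big: "\<forall>\<^sub>F n in sequentially. real n * h \<ge> 4" if "h > 0" for h :: real
  proof -
    have "\<forall>\<^sub>F n in sequentially. real n \<ge> 4 / h"
      using filterlim_real_sequentially by (simp add: filterlim_at_top)
    then show ?thesis by eventually_elim (use that in \<open>simp add: field_simps\<close>)
  qed
  have ftn: "filterlim (\<lambda>n. \<bar>T a b n\<bar> * (8 / (b - a))) (nhds 0) sequentially" if "0 < a" "a < b" "b \<le> 3" for a b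
    using tendsto_mult_right[OF tendsto_rabs[OF window[OF that]], of "8 / (b - a)"] unfolding T_def by simp
  have G: "Gamma s \<noteq> 0" using Gamma_real_pos[OF s(1)] by simp
  have cont_\<tau>: "((\<lambda>\<tau>. c * (\<tau> powr (s - 1) / Gamma s)) \<longlongrightarrow> c * (1 powr (s - 1) / Gamma s)) (at 1)"
    by (intro tendsto_intros) (simp_all add: G)
  show ?thesis
  proof (rule order_tendstoI)
    fix e assume "e < c / Gamma s"
    then have "\<forall>\<^sub>F \<tau> in at_right 1. c * (\<tau> powr (s - 1) / Gamma s) > e"
      using order_tendstoD(1)[OF filterlim_mono[OF cont_\<tau> order_refl at_le[OF subset_UNIV]], of e "{1<..}"] by simp
    moreover have "\<forall>\<^sub>F \<tau> in at_right (1::real). \<tau> \<in> {1<..<2}" by (rule eventually_at_rightI[of 1 2]) auto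
    ultimately have "\<forall>\<^sub>F \<tau> in at_right 1. c * (\<tau> powr (s - 1) / Gamma s) > e \<and> \<tau> \<in> {1<..<2}"
      by (rule eventually_conj)
    \<comment> \<open>Continuity at \<tau> = 1 leaves room for the window \<open>(1, b)\<close>: the
      comparison value at its far end still exceeds \<open>e\<close>.\<close>
    then obtain b where b: "c * (b powr (s - 1) / Gamma s) > e" "1 < b" "b < 2"
      by (auto dest!: eventually_happens simp: trivial_limit_at_right_real)
    define N where "N n = nat \<lfloor>b * real n\<rfloor>" for n :: nat
    have N: "(\<lambda>n. real (N n) / real n) \<longlonglongrightarrow> b" unfolding N_def using b by real_asymp
    have "(\<lambda>n. c * (real n powr (1 - s) * ?v (N n)) - \<bar>T 1 b n\<bar> * (8 / (b - 1))) \<longlonglongrightarrow> c * (b powr (s - 1) / Gamma s) - 0"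
      by (intro tendsto_intros v_scaled[OF N] ftn) (use b in auto)
    from order_tendstoD(1)[OF this, of e] b
    have "\<forall>\<^sub>F n in sequentially. c * (real n powr (1 - s) * ?v (N n)) - \<bar>T 1 b n\<bar> * (8 / (b - 1)) > e" by simp
    then show "\<forall>\<^sub>F n in sequentially. e < real n powr (1 - s) * u n"
      using big[of "b - 1", simplified, OF b(2)] eventually_gt_at_top[of 0]
    proof eventually_elim
      case (elim n)
      have "real n powr (1 - s) * (c * ?v (N n) - u n) \<le> \<bar>T 1 b n\<bar> * (8 / (b - 1))"
      proof (rule key[where \<sigma> = "-1"])
        fix k assume k: "1 * real n < real k" "real k < b * real n"
        have "k \<le> N n" unfolding N_def using k by (simp add: le_nat_iff le_floor_iff)
        then have "?v (N n) \<le> ?v k" by (rule decseqD[OF binom_coeff_decreasing[OF s]])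
        then have "c * ?v (N n) \<le> c * ?v k" using c by (rule mult_left_mono)
        moreover have "u k \<le> u n" using k by (intro decseqD[OF dec]) simp
        ultimately show "c * ?v (N n) - u n \<le> -1 * d k" by (simp add: d_def)
      qed (use b elim in auto)
      then show ?case using elim(1) by (simp add: algebra_simps)
    qed
  next
    fix e assume "e > c / Gamma s"
    then have "\<forall>\<^sub>F \<tau> in at_left 1. c * (\<tau> powr (s - 1) / Gamma s) < e"
      using order_tendstoD(2)[OF filterlim_mono[OF cont_\<tau> order_refl at_le[OF subset_UNIV]], of e "{..<1}"] by simp
    moreover have "\<forall>\<^sub>F \<tau> in at_left (1::real). \<tau> \<in> {1/2<..<1}" by (rule eventually_at_leftI[of "1/2"]) auto
    ultimately have "\<forall>\<^sub>F \<tau> in at_left 1. c * (\<tau> powr (s - 1) / Gamma s) < e \<and> \<tau> \<in> {1/2<..<1}"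
      by (rule eventually_conj)
    then obtain a where a: "c * (a powr (s - 1) / Gamma s) < e" "1/2 < a" "a < 1"
      by (auto dest!: eventually_happens simp: trivial_limit_at_left_real)
    define N where "N n = nat \<lceil>a * real n\<rceil>" for n :: nat
    have N: "(\<lambda>n. real (N n) / real n) \<longlonglongrightarrow> a" unfolding N_def using a by real_asymp
    have "(\<lambda>n. c * (real n powr (1 - s) * ?v (N n)) + \<bar>T a 1 n\<bar> * (8 / (1 - a))) \<longlonglongrightarrow> c * (a powr (s - 1) / Gamma s) + 0"
      by (intro tendsto_intros v_scaled[OF N] ftn) (use a in auto)
    from order_tendstoD(2)[OF this, of e] a
    have "\<forall>\<^sub>F n in sequentially. c * (real n powr (1 - s) * ?v (N n)) + \<bar>T a 1 n\<bar> * (8 / (1 - a)) < e" by simp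
    then show "\<forall>\<^sub>F n in sequentially. e > real n powr (1 - s) * u n"
      using big[of "1 - a", simplified, OF a(3)] eventually_gt_at_top[of 0]
    proof eventually_elim
      case (elim n)
      have "real n powr (1 - s) * (u n - c * ?v (N n)) \<le> \<bar>T a 1 n\<bar> * (8 / (1 - a))"
      proof (rule key[where \<sigma> = "1"])
        fix k assume k: "a * real n < real k" "real k < 1 * real n"
        have "N n \<le> k" unfolding N_def using k by (simp add: nat_le_iff ceiling_le_iff)
        then have "?v k \<le> ?v (N n)" by (rule decseqD[OF binom_coeff_decreasing[OF s]])
        then have "c * ?v k \<le> c * ?v (N n)" using c by (rule mult_left_mono)
        moreover have "u n \<le> u k" using k by (intro decseqD[OF dec]) simp
        ultimately show "u n - c * ?v (N n) \<le> 1 * d k" by (simp add: d_def)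
      qed (use a elim in auto)
      then show ?case using elim(1) by (simp add: algebra_simps)
    qed
  qed
qed

text \<open>The renewal equation says that the generating functions of \<open>u\<close> and
  \<open>r\<close> have product \<open>1 / (1 - x)\<close>. Comparison with the coefficients of
  \<open>(1 - x) powr (s - 1)\<close> gives the behaviour of the series of \<open>r\<close> at 1,
  division that of \<open>u\<close>, and Karamata's theorem returns to coefficients. The two
  passages contribute \<open>Gamma (1 - s)\<close> and \<open>Gamma s\<close>.\<close>

theorem renewal_power_asymptotic:
  fixes r u :: "nat \<Rightarrow> real" and s \<rho> :: real
  assumes s: "0 < s" "s < 1" and dec: "decseq u" and u0: "\<And>n. 0 \<le> u n"
    and rn: "\<And>n. 0 \<le> r n" and r0: "r 0 = 1"
    and renewal: "\<And>n. (\<Sum>k\<le>n. u k * r (n - k)) = 1"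
    and lim: "(\<lambda>n. real n powr s * r n) \<longlonglongrightarrow> \<rho>" and \<rho>: "0 < \<rho>"
  shows "(\<lambda>n. real n powr (1 - s) * u n) \<longlonglongrightarrow> 1 / (\<rho> * Gamma (1 - s) * Gamma s)"
proof -
  have G: "Gamma s > 0" "Gamma (1 - s) > 0" using s by (auto intro: Gamma_real_pos)
  let ?w = "binom_coeff (1 - s)"
  define \<rho>' where "\<rho>' = \<rho> * Gamma (1 - s)"
  have \<rho>': "\<rho>' > 0" using \<rho> G by (simp add: \<rho>'_def)
  have wlim: "(\<lambda>n. real n powr s * ?w n) \<longlonglongrightarrow> 1 / Gamma (1 - s)"
    using binom_coeff_asymptotic[of "1 - s"] s by simp
  have rw: "(\<lambda>n. r n / ?w n) \<longlonglongrightarrow> \<rho>'"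
  proof -
    have "(\<lambda>n. (real n powr s * r n) / (real n powr s * ?w n)) \<longlonglongrightarrow> \<rho> / (1 / Gamma (1 - s))"
      using G by (intro tendsto_divide lim wlim) auto
    then have "(\<lambda>n. (real n powr s * r n) / (real n powr s * ?w n)) \<longlonglongrightarrow> \<rho>'" by (simp add: \<rho>'_def)
    then show ?thesis
    proof (rule Lim_transform_eventually)
      show "\<forall>\<^sub>F n in sequentially. (real n powr s * r n) / (real n powr s * ?w n) = r n / ?w n"
        using eventually_gt_at_top[of 0] by eventually_elim simp
    qed
  qed
  have wpos: "?w k > 0" for k using s by (intro binom_coeff_pos) auto
  have wsum: "(\<lambda>k. ?w k * x ^ k) sums (1 - x) powr (s - 1)" if "0 < x" "x < 1" for x
    using binom_coeff_sums[of x "1 - s"] that by simp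
  have in01: "\<forall>\<^sub>F x in at_left (1::real). x \<in> {0<..<1}"
    by (rule eventually_at_leftI[of 0]) auto
  have "((\<lambda>x. (\<Sum>k. r k * x ^ k) / (\<Sum>k. ?w k * x ^ k)) \<longlongrightarrow> \<rho>') (at_left 1)"
  proof (rule power_series_ratio_limit[OF wpos _ _ rw])
    show "summable (\<lambda>k. ?w k * x ^ k)" if "0 < x" "x < 1" for x
      using wsum[OF that] by (rule sums_summable)
    have "filterlim (\<lambda>x. (1 - x) powr (s - 1)) at_top (at_left (1::real))"
      using s by real_asymp
    moreover have "\<forall>\<^sub>F x in at_left 1. (1 - x) powr (s - 1) = (\<Sum>k. ?w k * x ^ k)"
      using in01 by eventually_elim (use wsum in \<open>auto simp: sums_iff\<close>)
    ultimately show "filterlim (\<lambda>x. \<Sum>k. ?w k * x ^ k) at_top (at_left 1)"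
      by (simp add: filterlim_cong)
  qed
  then have "((\<lambda>x. 1 / ((\<Sum>k. r k * x ^ k) / (\<Sum>k. ?w k * x ^ k))) \<longlongrightarrow> 1 / \<rho>') (at_left 1)"
    using \<rho>' by (intro tendsto_intros) auto
  then have ulim: "((\<lambda>x. (1 - x) powr s * (\<Sum>k. u k * x ^ k)) \<longlongrightarrow> 1 / \<rho>') (at_left 1)"
  proof (rule Lim_transform_eventually)
    show "\<forall>\<^sub>F x in at_left 1. 1 / ((\<Sum>k. r k * x ^ k) / (\<Sum>k. ?w k * x ^ k)) = (1 - x) powr s * (\<Sum>k. u k * x ^ k)"
      using in01
    proof eventually_elim
      case (elim x)
      then have x: "0 < x" "x < 1" by auto
      have geo: "summable (\<lambda>k. x ^ k)" using x by (intro summable_geometric) auto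
      have u1: "u n \<le> 1" for n using decseqD[OF dec, of 0 n] renewal[of 0] r0 by simp
      obtain C where C: "\<And>k. \<bar>r k\<bar> \<le> C * ?w k" using ratio_bounded_by_limit[OF wpos rw] by metis
      have su: "summable (\<lambda>k. norm (u k * x ^ k))"
        by (rule summable_comparison_test'[OF geo, of 0]) (use u1 u0 x in \<open>auto simp: abs_mult intro!: mult_left_le_one_le\<close>)
      have sr: "summable (\<lambda>k. norm (r k * x ^ k))"
      proof (rule summable_comparison_test'[OF summable_mult[OF sums_summable[OF wsum[OF x]], of C], of 0])
        fix k show "norm (norm (r k * x ^ k)) \<le> C * (?w k * x ^ k)"
          using mult_right_mono[OF C[of k], of "x ^ k"] x by (simp add: abs_mult mult_ac)
      qed
      have "(\<Sum>k. u k * x ^ k) * (\<Sum>k. r k * x ^ k) = (\<Sum>k. \<Sum>i\<le>k. u i * x ^ i * (r (k - i) * x ^ (k - i)))"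
        by (rule Cauchy_product[OF su sr])
      also have "\<dots> = (\<Sum>k. x ^ k)"
      proof (rule suminf_cong)
        fix k
        have "(\<Sum>i\<le>k. u i * x ^ i * (r (k - i) * x ^ (k - i))) = (\<Sum>i\<le>k. (u i * r (k - i)) * x ^ k)"
        proof (intro sum.cong refl)
          fix i assume "i \<in> {..k}"
          then have "x ^ k = x ^ i * x ^ (k - i)" by (simp flip: power_add)
          then show "u i * x ^ i * (r (k - i) * x ^ (k - i)) = (u i * r (k - i)) * x ^ k" by simp
        qed
        also have "\<dots> = x ^ k" using renewal[of k] by (simp flip: sum_distrib_right)
        finally show "(\<Sum>i\<le>k. u i * x ^ i * (r (k - i) * x ^ (k - i))) = x ^ k" .
      qed
      also have "\<dots> = 1 / (1 - x)" using x by (intro suminf_geometric) auto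
      finally have prod: "(\<Sum>k. u k * x ^ k) * (\<Sum>k. r k * x ^ k) = 1 / (1 - x)" .
      have "(\<Sum>k. ?w k * x ^ k) = (1 - x) powr s / (1 - x)"
        using wsum[OF x] x by (simp add: sums_iff powr_diff)
      moreover have "(\<Sum>k. u k * x ^ k) = (1 / (1 - x)) / (\<Sum>k. r k * x ^ k)"
      proof -
        have "(\<Sum>k. r k * x ^ k) \<noteq> 0" using prod x by auto
        then show ?thesis unfolding prod[symmetric] by simp
      qed
      ultimately show ?case by simp
    qed
  qed
  have "0 \<le> 1 / \<rho>'" using \<rho>' by simp
  from Karamata_monotone[OF s dec this u0 ulim] show ?thesis by (simp add: \<rho>'_def)
qed

section \<open>Backward orbits of the two left branches\<close>

lemma T_map_left: "0 \<le> x \<Longrightarrow> x \<le> 1/2 \<Longrightarrow> T_map \<gamma> x = x * (1 + (2 * x) powr \<gamma>)"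
  by (simp add: T_map_def powr_mult)

lemma T_map_strict_mono:
  assumes "0 < \<gamma>" "0 \<le> x" "x < y" "y \<le> 1/2"
  shows "T_map \<gamma> x < T_map \<gamma> y"
proof -
  have "x * (1 + (2 * x) powr \<gamma>) \<le> x * (1 + (2 * y) powr \<gamma>)"
    using assms by (intro mult_left_mono add_left_mono powr_mono2) auto
  also have "\<dots> < y * (1 + (2 * y) powr \<gamma>)"
    using assms by (intro mult_strict_right_mono) (auto simp: add_pos_nonneg)
  finally show ?thesis using assms by (simp add: T_map_left)
qed

lemma T_map_bij_betw:
  assumes "0 < \<gamma>"
  shows "bij_betw (T_map \<gamma>) {0..1/2} {0..1}"
proof (rule bij_betw_imageI)
  show "inj_on (T_map \<gamma>) {0..1/2}"
    by (rule linorder_inj_onI) (use T_map_strict_mono[OF assms] in fastforce)+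
  have "(1::real) powr \<gamma> = 1" by simp
  then have T: "T_map \<gamma> 0 = 0" "T_map \<gamma> (1/2) = 1" by (simp_all add: T_map_left)
  have cont: "continuous_on {0..1/2} (\<lambda>x. x * (1 + (2 * x) powr \<gamma>))"
    using assms by (intro continuous_intros continuous_on_powr') auto
  show "T_map \<gamma> ` {0..1/2} = {0..1}"
  proof (intro equalityI subsetI)
    fix y assume "y \<in> T_map \<gamma> ` {0..1/2}"
    then obtain x where x: "0 \<le> x" "x \<le> 1/2" "y = T_map \<gamma> x" by auto
    have "T_map \<gamma> 0 \<le> T_map \<gamma> x" "T_map \<gamma> x \<le> T_map \<gamma> (1/2)"
      using x T_map_strict_mono[OF assms, of 0 x] T_map_strict_mono[OF assms, of x "1/2"]
      by (cases "x = 0"; cases "x = 1/2"; force)+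
    then show "y \<in> {0..1}" using T x by auto
  next
    fix y :: real assume y: "y \<in> {0..1}"
    have "\<exists>x\<ge>0. x \<le> 1/2 \<and> x * (1 + (2 * x) powr \<gamma>) = y"
      by (rule IVT'[where f = "\<lambda>x. x * (1 + (2 * x) powr \<gamma>)"]) (use y cont in auto)
    then show "y \<in> T_map \<gamma> ` {0..1/2}" by (force simp: T_map_left image_iff)
  qed
qed

context
  fixes \<gamma> :: real
  assumes \<gamma>: "0 < \<gamma>"
begin

lemma left_inv_bij_betw: "bij_betw (left_inv \<gamma>) {0..1} {0..1/2}"
  unfolding left_inv_def by (rule bij_betw_the_inv_into[OF T_map_bij_betw[OF \<gamma>]])

lemma left_inv_in: "y \<in> {0..1} \<Longrightarrow> left_inv \<gamma> y \<in> {0..1/2}"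
  using left_inv_bij_betw by (auto simp: bij_betw_def)

lemma T_map_left_inv: "y \<in> {0..1} \<Longrightarrow> T_map \<gamma> (left_inv \<gamma> y) = y"
  unfolding left_inv_def by (rule f_the_inv_into_f_bij_betw[OF T_map_bij_betw[OF \<gamma>]])

lemma left_inv_T_map: "x \<in> {0..1/2} \<Longrightarrow> left_inv \<gamma> (T_map \<gamma> x) = x"
  unfolding left_inv_def using T_map_bij_betw[OF \<gamma>]
  by (intro the_inv_into_f_f) (auto simp: bij_betw_def)

lemma left_inv_eq: "y \<in> {0..1} \<Longrightarrow> left_inv \<gamma> y * (1 + (2 * left_inv \<gamma> y) powr \<gamma>) = y"
  using T_map_left_inv[of y] left_inv_in[of y] by (simp add: T_map_left)

lemma left_inv_0: "left_inv \<gamma> 0 = 0"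
  using left_inv_T_map[of 0] by (simp add: T_map_def)

lemma left_inv_1: "left_inv \<gamma> 1 = 1/2"
  using left_inv_T_map[of "1/2"] by (simp add: T_map_left)

lemma left_inv_strict_mono:
  assumes "0 \<le> x" "x < y" "y \<le> 1"
  shows "left_inv \<gamma> x < left_inv \<gamma> y"
proof (rule ccontr)
  assume n: "\<not> left_inv \<gamma> x < left_inv \<gamma> y"
  have "T_map \<gamma> (left_inv \<gamma> y) \<le> T_map \<gamma> (left_inv \<gamma> x)"
    using n T_map_strict_mono[OF \<gamma>, of "left_inv \<gamma> y" "left_inv \<gamma> x"] left_inv_in[of x] left_inv_in[of y] assms
    by (cases "left_inv \<gamma> x = left_inv \<gamma> y") auto
  then show False using T_map_left_inv[of x] T_map_left_inv[of y] assms by auto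
qed

lemma left_inv_mono: "0 \<le> x \<Longrightarrow> x \<le> y \<Longrightarrow> y \<le> 1 \<Longrightarrow> left_inv \<gamma> x \<le> left_inv \<gamma> y"
  using left_inv_strict_mono[of x y] by (cases "x = y") auto

lemma left_inv_pos: "0 < y \<Longrightarrow> y \<le> 1 \<Longrightarrow> 0 < left_inv \<gamma> y"
  using left_inv_strict_mono[of 0 y] by (simp add: left_inv_0)

lemma left_inv_le: "y \<in> {0..1} \<Longrightarrow> left_inv \<gamma> y \<le> y"
  using mult_left_mono[of 1 "1 + (2 * left_inv \<gamma> y) powr \<gamma>" "left_inv \<gamma> y"]
    left_inv_eq[of y] left_inv_in[of y] by auto

lemma left_inv_ratio: "0 < y \<Longrightarrow> y \<le> 1 \<Longrightarrow> left_inv \<gamma> y / y = 1 / (1 + (2 * left_inv \<gamma> y) powr \<gamma>)"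
  using left_inv_eq[of y] left_inv_pos[of y] by (simp add: divide_simps mult_ac add_pos_nonneg)
    (metis add_pos_nonneg less_irrefl powr_ge_zero zero_less_one)

text \<open>The ratio is \<open>1 / (1 + (2 * x) powr \<gamma>)\<close> at the preimage
  \<open>x\<close>, which increases with \<open>y\<close>. This monotonicity is the source of the
  log-convexity of \<open>r\<close>.\<close>

lemma left_inv_ratio_antimono:
  assumes "0 < x" "x \<le> y" "y \<le> 1"
  shows "left_inv \<gamma> y / y \<le> left_inv \<gamma> x / x"
proof -
  have "(2 * left_inv \<gamma> x) powr \<gamma> \<le> (2 * left_inv \<gamma> y) powr \<gamma>"
    using left_inv_mono[of x y] left_inv_pos[of x] assms \<gamma> by (intro powr_mono2) auto
  then show ?thesis using assms by (simp add: left_inv_ratio frac_le add_pos_nonneg)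
qed

end

text \<open>On \<open>[0, 1/2]\<close> the base \<open>2 * x\<close> is at most 1, so a larger
  exponent gives a smaller map and a larger inverse: the branch with \<beta> is the slow
  one.\<close>

lemma left_inv_mono_exponent:
  assumes "0 < \<gamma>" "\<gamma> \<le> \<gamma>'" "y \<in> {0..1}"
  shows "left_inv \<gamma> y \<le> left_inv \<gamma>' y"
proof (rule ccontr)
  assume n: "\<not> left_inv \<gamma> y \<le> left_inv \<gamma>' y"
  let ?x = "left_inv \<gamma> y" and ?x' = "left_inv \<gamma>' y"
  have in': "?x \<in> {0..1/2}" "?x' \<in> {0..1/2}" using left_inv_in assms by auto
  have "T_map \<gamma>' ?x' < T_map \<gamma>' ?x"
    using T_map_strict_mono[of \<gamma>' ?x' ?x] n in' assms by auto
  also have "\<dots> \<le> T_map \<gamma> ?x"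
  proof -
    have "(2 * ?x) powr \<gamma>' \<le> (2 * ?x) powr \<gamma>" using in' assms by (intro powr_mono') auto
    then show ?thesis using in' by (simp add: T_map_left mult_left_mono)
  qed
  finally show False using T_map_left_inv[of \<gamma> y] T_map_left_inv[of \<gamma>' y] assms by auto
qed

section \<open>Random compositions of the two inverse branches\<close>

locale two_maps =
  fixes \<alpha> \<beta> p1 p2 :: real
  assumes \<alpha>: "1 \<le> \<alpha>" and \<alpha>\<beta>: "\<alpha> < \<beta>" and p1: "0 < p1" and p2: "0 < p2" and p12: "p1 + p2 = 1"
begin

definition g :: "bool \<Rightarrow> real \<Rightarrow> real" where "g i = left_inv (if i then \<alpha> else \<beta>)"

definition pr :: "bool \<Rightarrow> real" where "pr i = (if i then p1 else p2)"

text \<open>The first letter is applied last, as in the recursion for the random points. Both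
  branches send 1 to 1/2, so \<open>W w 1\<close> and \<open>W w (1/2)\<close> are consecutive
  points of one backward orbit.\<close>

fun W :: "bool list \<Rightarrow> real \<Rightarrow> real" where
  "W [] y = y"
| "W (i # a) y = g i (W a y)"

definition pw :: "bool list \<Rightarrow> real" where "pw a = prod_list (map pr a)"

definition words :: "nat \<Rightarrow> bool list set" where "words n = {a. length a = n}"

text \<open>\<open>mean n h\<close> is the integral of \<open>h (x\<^sub>n(\<omega>))\<close> over \<open>\<omega> \<in> [0, 1]\<close>, as \<open>x\<^sub>n(\<omega>) = W w 1\<close> for the first \<open>n\<close> symbols \<open>w\<close> of \<open>\<omega>\<close>.\<close>

definition mean :: "nat \<Rightarrow> (real \<Rightarrow> real) \<Rightarrow> real" where
  "mean n h = (\<Sum>a\<in>words n. pw a * h (W a 1))"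

definition r :: "nat \<Rightarrow> real" where "r n = mean n (\<lambda>y. y)"

lemma exps: "0 < \<alpha>" "0 < \<beta>" using \<alpha> \<alpha>\<beta> by auto

lemma g_pos: "0 < y \<Longrightarrow> y \<le> 1 \<Longrightarrow> 0 < g i y"
  using exps left_inv_pos by (auto simp: g_def)

lemma g_le: "0 < y \<Longrightarrow> y \<le> 1 \<Longrightarrow> g i y \<le> y"
  using exps left_inv_le by (auto simp: g_def)

lemma g_strict_mono: "0 \<le> x \<Longrightarrow> x < y \<Longrightarrow> y \<le> 1 \<Longrightarrow> g i x < g i y"
  using exps left_inv_strict_mono by (auto simp: g_def)

lemma g_mono: "0 \<le> x \<Longrightarrow> x \<le> y \<Longrightarrow> y \<le> 1 \<Longrightarrow> g i x \<le> g i y"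
  using exps left_inv_mono by (auto simp: g_def)

lemma g_1: "g i 1 = 1/2"
  using exps left_inv_1 by (auto simp: g_def)

lemma g_le_False: "y \<in> {0..1} \<Longrightarrow> g i y \<le> g False y"
  using exps \<alpha>\<beta> left_inv_mono_exponent[of \<alpha> \<beta> y] by (auto simp: g_def)

lemma g_ratio_antimono: "0 < x \<Longrightarrow> x \<le> y \<Longrightarrow> y \<le> 1 \<Longrightarrow> g i y / y \<le> g i x / x"
  using exps left_inv_ratio_antimono by (auto simp: g_def)

lemma pr_pos: "0 < pr i" using p1 p2 by (simp add: pr_def)

lemma W_range: "0 < y \<Longrightarrow> y \<le> 1 \<Longrightarrow> 0 < W a y \<and> W a y \<le> 1"
  by (induction a) (auto intro: g_pos order_trans[OF g_le])

lemma W_strict_mono: "0 < x \<Longrightarrow> x < y \<Longrightarrow> y \<le> 1 \<Longrightarrow> W a x < W a y"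
proof (induction a)
  case (Cons i a)
  then show ?case using W_range[of x a] W_range[of y a] by (auto intro!: g_strict_mono)
qed simp

lemma pw_Nil: "pw [] = 1" and pw_Cons: "pw (i # a) = pr i * pw a" by (simp_all add: pw_def)

lemma pw_pos: "0 < pw a"
  by (induction a) (auto simp: pw_Nil pw_Cons pr_pos)

lemma words_0: "words 0 = {[]}" by (auto simp: words_def)

lemma finite_words: "finite (words n)"
  using finite_lists_length_eq[of "UNIV :: bool set" n] by (simp add: words_def)

lemma sum_words_Suc: "(\<Sum>a\<in>words (Suc n). f a) = (\<Sum>a\<in>words n. f (True # a) + f (False # a))"
proof -
  have "words (Suc n) = (#) True ` words n \<union> (#) False ` words n"
    by (auto simp: words_def length_Suc_conv image_iff)
  moreover have "(#) True ` words n \<inter> (#) False ` words n = {}" by auto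
  ultimately show ?thesis
    by (simp add: sum.union_disjoint finite_words sum.reindex sum.distrib)
qed

lemma sum_pw: "(\<Sum>a\<in>words n. pw a) = 1"
  by (induction n) (simp_all add: words_0 pw_Nil sum_words_Suc pw_Cons pr_def p12 flip: distrib_right)

lemma mean_0: "mean 0 h = h 1" by (simp add: mean_def words_0 pw_Nil)

text \<open>The added letter is the outermost map, so averaging over it acts on \<open>h\<close>
  alone, as a Markov operator.\<close>

lemma mean_Suc: "mean (Suc n) h = mean n (\<lambda>y. p1 * h (g True y) + p2 * h (g False y))"
  unfolding mean_def sum_words_Suc by (simp add: pw_Cons pr_def algebra_simps)

lemma mean_add: "mean n (\<lambda>y. h y + k y) = mean n h + mean n k"
  by (simp add: mean_def distrib_left sum.distrib)

lemma mean_cmult: "mean n (\<lambda>y. c * h y) = c * mean n h"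
  by (simp add: mean_def sum_distrib_left mult_ac)

lemma mean_const: "mean n (\<lambda>y. c) = c"
  using sum_pw[of n] by (simp add: mean_def flip: sum_distrib_right)

text \<open>The deterministic orbit with the exponent \<open>\<beta>\<close> at every step is the slowest one.\<close>

definition b :: "nat \<Rightarrow> real" where "b n = W (replicate n False) 1"

lemma W_le_b: "W a 1 \<le> b (length a)"
proof (induction a)
  case (Cons i a)
  have "g i (W a 1) \<le> g False (W a 1)" using W_range[of 1 a] by (intro g_le_False) auto
  also have "\<dots> \<le> g False (b (length a))"
    using Cons W_range[of 1 a] W_range[of 1 "replicate (length a) False"]
    by (intro g_mono) (auto simp: b_def)
  finally show ?case by (simp add: b_def)
qed (simp add: b_def)

text \<open>The bound \<open>y \<le> b n\<close> is available because no word is slower than the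
  constant word of \<beta>; it lets expansions near 0 be used uniformly under the mean.\<close>

lemma mean_mono:
  assumes "\<And>y. 0 < y \<Longrightarrow> y \<le> 1 \<Longrightarrow> y \<le> b n \<Longrightarrow> h y \<le> k y"
  shows "mean n h \<le> mean n k"
  unfolding mean_def
proof (intro sum_mono mult_left_mono)
  fix a assume "a \<in> words n"
  then show "h (W a 1) \<le> k (W a 1)"
    using W_range[of 1 a] W_le_b[of a] by (intro assms) (auto simp: words_def)
qed (use pw_pos in \<open>auto intro: less_imp_le\<close>)

lemma mean_pos:
  assumes "\<And>y. 0 < y \<Longrightarrow> y \<le> 1 \<Longrightarrow> 0 < h y"
  shows "0 < mean n h"
  unfolding mean_def
proof (rule sum_pos)
  show "words n \<noteq> {}" using mean_const[of n 1] by (auto simp: mean_def)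
  show "0 < pw a * h (W a 1)" for a using W_range[of 1 a] pw_pos[of a] by (intro mult_pos_pos assms) auto
qed (rule finite_words)

lemma r_0: "r 0 = 1" by (simp add: r_def mean_0)

lemma r_pos: "0 < r n" unfolding r_def by (rule mean_pos)

text \<open>Starting from 1/2 instead of 1 amounts to one more innermost letter, whose two choices
  give the same value and whose probabilities add up to 1.\<close>

lemma sum_words_half: "(\<Sum>a\<in>words n. pw a * h (W a (1/2))) = mean (Suc n) h"
proof (induction n arbitrary: h)
  case 0
  show ?case by (simp add: mean_Suc mean_0 words_0 pw_Nil g_1 p12 flip: distrib_right)
next
  case (Suc n)
  have "(\<Sum>a\<in>words (Suc n). pw a * h (W a (1/2))) =
    (\<Sum>a\<in>words n. pw a * (\<lambda>y. p1 * h (g True y) + p2 * h (g False y)) (W a (1/2)))"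
    unfolding sum_words_Suc by (simp add: pw_Cons pr_def algebra_simps)
  also have "\<dots> = mean (Suc n) (\<lambda>y. p1 * h (g True y) + p2 * h (g False y))" by (rule Suc)
  also have "\<dots> = mean (Suc (Suc n)) h" by (rule mean_Suc[symmetric])
  finally show ?case .
qed

text \<open>With \<open>G y = p\<^sub>1 g\<^sub>\<alpha> y + p\<^sub>2 g\<^sub>\<beta> y\<close> the ratio \<open>H y = G y / y\<close> is decreasing, so \<open>r\<^sub>n\<^sub>+\<^sub>2 \<ge> E (y H(y)\<^sup>2)\<close>, and the Cauchy-Schwarz inequality applies.\<close>

lemma r_logconvex: "(r (Suc n))\<^sup>2 \<le> r n * r (Suc (Suc n))"
proof -
  define H where "H y = (p1 * g True y + p2 * g False y) / y" for y
  have H_anti: "H y \<le> H x" if "0 < x" "x \<le> y" "y \<le> 1" for x y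
    using g_ratio_antimono[OF that, of True] g_ratio_antimono[OF that, of False] p1 p2
    by (simp add: H_def add_divide_distrib) (intro add_mono mult_left_mono, auto simp flip: times_divide_eq_right)
  have rH: "r (Suc m) = mean m (\<lambda>y. y * H y)" for m
    unfolding r_def mean_Suc unfolding mean_def
  proof (rule sum.cong[OF refl])
    fix a show "pw a * (p1 * g True (W a 1) + p2 * g False (W a 1)) = pw a * (W a 1 * H (W a 1))"
      using W_range[of 1 a] by (simp add: H_def)
  qed
  note r1 = rH[of n] and r1' = rH[of "Suc n"]
  \<comment> \<open>The minimising constant: with it, nonnegativity of the mean of
    \<open>y * (H y - l)^2\<close> is the Cauchy-Schwarz inequality for the weight
    \<open>y\<close>.\<close>
  define l where "l = r (Suc n) / r n"
  have "0 \<le> mean n (\<lambda>y. y * (H y - l)\<^sup>2)"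
    using mean_mono[of n "\<lambda>y. 0" "\<lambda>y. y * (H y - l)\<^sup>2"] by (simp add: mean_const)
  also have "mean n (\<lambda>y. y * (H y - l)\<^sup>2) = mean n (\<lambda>y. (y * (H y)\<^sup>2 + (- 2 * l) * (y * H y)) + l\<^sup>2 * y)"
    by (intro arg_cong[where f = "mean n"] ext) (simp add: power2_eq_square algebra_simps)
  also have "\<dots> = mean n (\<lambda>y. y * (H y)\<^sup>2) - 2 * l * r (Suc n) + l\<^sup>2 * r n"
    unfolding mean_add mean_cmult r1 by (simp add: r_def)
  also have "\<dots> = mean n (\<lambda>y. y * (H y)\<^sup>2) - (r (Suc n))\<^sup>2 / r n"
    using r_pos[of n] by (simp add: l_def power2_eq_square field_simps)
  also have "mean n (\<lambda>y. y * (H y)\<^sup>2) \<le> r (Suc (Suc n))"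
    unfolding r1' mean_Suc
  proof (rule mean_mono)
    fix y :: real assume y: "0 < y" "y \<le> 1"
    \<comment> \<open>\<open>g i y \<le> y\<close> and \<open>H\<close> is decreasing, so one more
      step can only raise the ratio.\<close>
    have "g i y * H y \<le> g i y * H (g i y)" for i
      using y g_pos[OF y, of i] g_le[OF y, of i] by (intro mult_left_mono H_anti) auto
    then have "p1 * (g True y * H y) + p2 * (g False y * H y) \<le>
      p1 * (g True y * H (g True y)) + p2 * (g False y * H (g False y))"
      using p1 p2 by (intro add_mono[OF mult_left_mono mult_left_mono]) auto
    moreover have "p1 * (g True y * H y) + p2 * (g False y * H y) = y * (H y)\<^sup>2"
      using y by (simp add: H_def power2_eq_square field_simps)
    ultimately show "y * (H y)\<^sup>2 \<le> p1 * (g True y * H (g True y)) + p2 * (g False y * H (g False y))" by simp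
  qed
  finally show ?thesis using r_pos[of n] by (simp add: field_simps)
qed

section \<open>Power-law decay of the mean orbit\<close>

lemma b_pos: "0 < b n" and b_le_1: "b n \<le> 1"
  using W_range[of 1 "replicate n False"] by (auto simp: b_def)

lemma b_Suc: "b (Suc n) = left_inv \<beta> (b n)" by (simp add: b_def g_def)

text \<open>The limit of the decreasing orbit solves
  \<open>l * (1 + (2 * l) powr \<beta>) = l\<close>, which forces \<open>l = 0\<close>.\<close>

lemma b_tendsto_0: "b \<longlonglongrightarrow> 0"
proof -
  have dec: "decseq b"
    by (rule decseq_SucI) (use b_pos b_le_1 g_le[of _ False] in \<open>simp add: b_Suc g_def\<close>)
  then obtain l where l: "b \<longlonglongrightarrow> l" "\<And>n. l \<le> b n"
    using decseq_convergent[of b 0] b_pos by (metis less_imp_le)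
  have l0: "l \<ge> 0" by (rule LIMSEQ_le_const[OF l(1)]) (use b_pos in \<open>auto intro: less_imp_le\<close>)
  have eq: "b (Suc n) * (1 + (2 * b (Suc n)) powr \<beta>) = b n" for n
    unfolding b_Suc using b_pos[of n] b_le_1[of n] by (intro left_inv_eq exps) auto
  have l': "(\<lambda>n. b (Suc n)) \<longlonglongrightarrow> l" by (rule LIMSEQ_Suc[OF l(1)])
  have "(\<lambda>n. b (Suc n) * (1 + (2 * b (Suc n)) powr \<beta>)) \<longlonglongrightarrow> l * (1 + (2 * l) powr \<beta>)"
    by (intro tendsto_mult tendsto_add tendsto_const tendsto_powr' l') (use exps b_pos in \<open>auto intro!: always_eventually less_imp_le\<close>)
  then have "l * (1 + (2 * l) powr \<beta>) = l" unfolding eq using l(1) LIMSEQ_unique by blast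
  then have "l * (2 * l) powr \<beta> = 0" by (simp add: algebra_simps)
  then have "l = 0" by simp
  with l(1) show ?thesis by simp
qed

lemma Cesaro_tendsto: "(\<lambda>n. (\<Sum>j<n. c j) / real n) \<longlonglongrightarrow> L" if "c \<longlonglongrightarrow> L" for c :: "nat \<Rightarrow> real"
  using weighted_mean_tendsto[of "\<lambda>_. 1" c L] that filterlim_real_sequentially by simp

text \<open>For the preimage \<open>x\<close> of \<open>y\<close> the decrement is exactly
  \<open>2 powr \<alpha> * x powr (\<alpha> + 1)\<close>, and \<open>y\<close> exceeds
  \<open>x\<close> at most by the factor \<open>1 + (2 * \<eta>) powr \<alpha>\<close>. With
  \<open>b n\<close> for \<open>\<eta>\<close> this factor tends to 1.\<close>

lemma left_inv_decrement:
  assumes "0 < y" "y \<le> 1" "y \<le> \<eta>"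
  shows "2 powr \<alpha> * (1 + (2 * \<eta>) powr \<alpha>) powr (- (\<alpha> + 1)) * y powr (\<alpha> + 1) \<le> y - g True y"
proof -
  let ?x = "left_inv \<alpha> y"
  have x: "0 < ?x" "?x \<le> y" using left_inv_pos left_inv_le assms exps by auto
  have eq: "?x * (1 + (2 * ?x) powr \<alpha>) = y" using left_inv_eq exps assms by auto
  have "y \<le> ?x * (1 + (2 * \<eta>) powr \<alpha>)"
    by (subst (1) eq[symmetric]) (use x assms exps in \<open>intro mult_left_mono add_left_mono powr_mono2; simp\<close>)
  then have "y powr (\<alpha> + 1) \<le> (?x * (1 + (2 * \<eta>) powr \<alpha>)) powr (\<alpha> + 1)"
    using assms exps by (intro powr_mono2) auto
  also have "\<dots> = ?x powr (\<alpha> + 1) * (1 + (2 * \<eta>) powr \<alpha>) powr (\<alpha> + 1)"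
    using x by (subst powr_mult) auto
  finally have "(1 + (2 * \<eta>) powr \<alpha>) powr (- (\<alpha> + 1)) * y powr (\<alpha> + 1) \<le>
     (1 + (2 * \<eta>) powr \<alpha>) powr (- (\<alpha> + 1)) * (?x powr (\<alpha> + 1) * (1 + (2 * \<eta>) powr \<alpha>) powr (\<alpha> + 1))"
    by (intro mult_left_mono) auto
  also have "\<dots> = ?x powr (\<alpha> + 1)"
  proof -
    have "(1 + (2 * \<eta>) powr \<alpha>) powr (- (\<alpha> + 1)) * (1 + (2 * \<eta>) powr \<alpha>) powr (\<alpha> + 1) = 1"
      by (simp flip: powr_add) (metis add_pos_nonneg less_irrefl powr_ge_zero zero_less_one)
    then show ?thesis by (simp add: mult.left_commute)
  qed
  finally have "2 powr \<alpha> * ((1 + (2 * \<eta>) powr \<alpha>) powr (- (\<alpha> + 1)) * y powr (\<alpha> + 1)) \<le> 2 powr \<alpha> * ?x powr (\<alpha> + 1)"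
    by (intro mult_left_mono) auto
  also have "\<dots> = y - ?x"
  proof -
    have "y - ?x = ?x * (2 * ?x) powr \<alpha>" using eq by (simp add: algebra_simps)
    then show ?thesis using x by (simp add: powr_mult powr_add)
  qed
  finally show ?thesis by (simp add: g_def mult.assoc)
qed

text \<open>Convexity in the form of an affine minorant, which can be averaged by the linearity of
  \<open>mean\<close>: a tangent at \<open>r n\<close> yields Jensen's inequality for the random
  orbit.\<close>

lemma powr_tangent:
  fixes x y p :: real
  assumes "0 < x" "0 < y" "p \<le> 0 \<or> 1 \<le> p"
  shows "x powr p + p * x powr (p - 1) * (y - x) \<le> y powr p"
proof -
  have "0 \<le> p * (p - 1)" using assms(3) by (auto simp: zero_le_mult_iff)
  then have convex: "convex_on {0<..} (\<lambda>x. x powr p)"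
  proof (intro f''_ge0_imp_convex[where f' = "\<lambda>x. p * x powr (p - 1)" and f'' = "\<lambda>x. p * (p - 1) * x powr (p - 2)"])
    fix x :: real assume "x \<in> {0<..}"
    then show "((\<lambda>x. x powr p) has_real_derivative p * x powr (p - 1)) (at x)"
      "((\<lambda>x. p * x powr (p - 1)) has_real_derivative p * (p - 1) * x powr (p - 2)) (at x)"
      by (auto intro!: derivative_eq_intros simp: mult_ac)
  qed (use \<open>0 \<le> p * (p - 1)\<close> in \<open>auto intro!: mult_nonneg_nonneg\<close>)
  have "((\<lambda>x. x powr p) has_real_derivative p * x powr (p - 1)) (at x within {0<..})"
    using assms(1) by (auto intro!: derivative_eq_intros)
  then have "p * x powr (p - 1) * (y - x) \<le> y powr p - x powr p"
    using assms by (intro convex_on_imp_above_tangent[OF convex]) (auto simp: interior_open)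
  then show ?thesis by simp
qed

text \<open>Only the \<alpha>-branch is credited with a decrease; the \<beta>-branch is bounded by
  the identity. The tangent at \<open>r n\<close> then replaces the mean of
  \<open>y powr (\<alpha> + 1)\<close> by the power of the mean.\<close>

lemma r_Suc_le:
  "r (Suc n) \<le> r n - p1 * 2 powr \<alpha> * (1 + (2 * b n) powr \<alpha>) powr (- (\<alpha> + 1)) * r n powr (\<alpha> + 1)"
proof -
  define K where "K = p1 * 2 powr \<alpha> * (1 + (2 * b n) powr \<alpha>) powr (- (\<alpha> + 1))"
  have K: "K \<ge> 0" using p1 by (simp add: K_def)
  let ?c = "r n powr (\<alpha> + 1)" and ?d = "(\<alpha> + 1) * r n powr \<alpha>"
  have "r (Suc n) \<le> mean n (\<lambda>y. ((1 - K * ?d) * y) + (K * (?d * r n - ?c)))"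
    unfolding r_def[of "Suc n"] mean_Suc
  proof (rule mean_mono)
    fix y assume y: "0 < y" "y \<le> 1" "y \<le> b n"
    have "p1 * (2 powr \<alpha> * (1 + (2 * b n) powr \<alpha>) powr (- (\<alpha> + 1)) * y powr (\<alpha> + 1)) \<le> p1 * (y - g True y)"
      using p1 by (intro mult_left_mono left_inv_decrement y) auto
    then have 1: "K * y powr (\<alpha> + 1) \<le> p1 * (y - g True y)" by (simp add: K_def mult_ac)
    have 2: "p2 * g False y \<le> p2 * y" using p2 y by (intro mult_left_mono g_le) auto
    have 3: "K * (?c + ?d * (y - r n)) \<le> K * y powr (\<alpha> + 1)"
      using powr_tangent[of "r n" y "\<alpha> + 1"] r_pos[of n] y \<alpha> K by (intro mult_left_mono) auto
    have "p1 * g True y + p2 * g False y \<le> (p1 + p2) * y - K * (?c + ?d * (y - r n))"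
      using 1 2 3 by (simp add: algebra_simps)
    also have "\<dots> = ((1 - K * ?d) * y) + (K * (?d * r n - ?c))" unfolding p12 by (simp add: algebra_simps)
    finally show "p1 * g True y + p2 * g False y \<le> ((1 - K * ?d) * y) + (K * (?d * r n - ?c))" .
  qed
  also have "\<dots> = r n - K * ?c"
    unfolding mean_add mean_cmult mean_const by (simp add: algebra_simps flip: r_def)
  finally show ?thesis by (simp add: K_def)
qed

text \<open>In the variable \<open>r n powr (- \<alpha>)\<close> the recursion of
  \<open>r_Suc_le\<close> has increments bounded below by a convergent sequence.\<close>

lemma r_inverse_power_lower:
  "r (Suc n) powr (- \<alpha>) \<ge> r n powr (- \<alpha>) + \<alpha> * (p1 * 2 powr \<alpha> * (1 + (2 * b n) powr \<alpha>) powr (- (\<alpha> + 1)))"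
proof -
  define K where "K = p1 * 2 powr \<alpha> * (1 + (2 * b n) powr \<alpha>) powr (- (\<alpha> + 1))"
  have K: "K \<ge> 0" using p1 by (simp add: K_def)
  have rn: "r n > 0" by (rule r_pos)
  have "r (Suc n) \<le> r n - K * r n powr (\<alpha> + 1)" using r_Suc_le[of n] by (simp add: K_def)
  also have "\<dots> = r n * (1 - K * r n powr \<alpha>)" using rn by (simp add: powr_add algebra_simps)
  \<comment> \<open>Replacing \<open>1 - t\<close> by \<open>exp (- t)\<close> keeps the base
    positive and makes its negative power explicit; \<open>1 + t \<le> exp t\<close> then yields the
    additive increment.\<close>
  also have "\<dots> \<le> r n * exp (- (K * r n powr \<alpha>))"
    using rn exp_ge_add_one_self[of "- (K * r n powr \<alpha>)"] by (intro mult_left_mono) auto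
  finally have "(r n * exp (- (K * r n powr \<alpha>))) powr (- \<alpha>) \<le> r (Suc n) powr (- \<alpha>)"
    using r_pos[of "Suc n"] exps by (intro powr_mono2') auto
  moreover have "(r n * exp (- (K * r n powr \<alpha>))) powr (- \<alpha>) = r n powr (- \<alpha>) * exp (\<alpha> * (K * r n powr \<alpha>))"
    using rn by (simp add: powr_mult exp_powr_real mult_ac)
  moreover have "r n powr (- \<alpha>) * (1 + \<alpha> * (K * r n powr \<alpha>)) \<le> r n powr (- \<alpha>) * exp (\<alpha> * (K * r n powr \<alpha>))"
    by (intro mult_left_mono) auto
  moreover have "r n powr (- \<alpha>) * (1 + \<alpha> * (K * r n powr \<alpha>)) = r n powr (- \<alpha>) + \<alpha> * K"
    using rn by (simp add: algebra_simps powr_minus field_simps)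
  ultimately show ?thesis by (simp add: K_def)
qed

text \<open>If \<open>x * (1 + t) = y\<close>, then \<open>x powr (- \<alpha>) = y powr (- \<alpha>)
  * (1 + t) powr \<alpha>\<close>, and \<open>t\<close> is of order \<open>y powr \<gamma>\<close>.
  The increment thus has size \<open>y powr (\<gamma> - \<alpha>)\<close>: of constant order for
  \<gamma> = \<alpha>, and negligible for \<gamma> = \<beta> since \<alpha> < \<beta>.\<close>

lemma mean_inverse_power_Suc:
  "mean (Suc n) (\<lambda>y. y powr (- \<alpha>)) \<le> mean n (\<lambda>y. y powr (- \<alpha>)) +
     \<alpha> * (p1 * 2 powr \<alpha> * (1 + (2 * b n) powr \<alpha>) powr (\<alpha> - 1) +
          p2 * 2 powr \<beta> * b n powr (\<beta> - \<alpha>) * (1 + (2 * b n) powr \<beta>) powr (\<alpha> - 1))"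
proof -
  have step: "left_inv \<gamma> y powr (- \<alpha>) \<le> y powr (- \<alpha>) + \<alpha> * (2 powr \<gamma> * b n powr (\<gamma> - \<alpha>) * (1 + (2 * b n) powr \<gamma>) powr (\<alpha> - 1))"
    if y: "0 < y" "y \<le> 1" "y \<le> b n" and \<gamma>: "\<alpha> \<le> \<gamma>" for \<gamma> y
  proof -
    let ?x = "left_inv \<gamma> y"
    have \<gamma>0: "\<gamma> > 0" using \<gamma> \<alpha> by simp
    have x: "0 < ?x" "?x \<le> y" using left_inv_pos left_inv_le y \<gamma>0 by auto
    define t where "t = (2 * ?x) powr \<gamma>"
    have t0: "t \<ge> 0" by (simp add: t_def)
    have t1: "t \<le> (2 * y) powr \<gamma>" unfolding t_def using x \<gamma>0 by (intro powr_mono2) auto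
    have t2: "t \<le> (2 * b n) powr \<gamma>" unfolding t_def using x y \<gamma>0 by (intro powr_mono2) auto
    have eq: "?x * (1 + t) = y" unfolding t_def using left_inv_eq[OF \<gamma>0, of y] y by auto
    have "y powr (- \<alpha>) = (?x * (1 + t)) powr (- \<alpha>)" by (simp add: eq)
    also have "\<dots> = ?x powr (- \<alpha>) * (1 + t) powr (- \<alpha>)" using x t0 by (subst powr_mult) auto
    finally have xy: "?x powr (- \<alpha>) = y powr (- \<alpha>) * (1 + t) powr \<alpha>"
      using t0 by (simp add: powr_minus field_simps add_pos_nonneg)
    have "(1 + t) powr \<alpha> + \<alpha> * (1 + t) powr (\<alpha> - 1) * (1 - (1 + t)) \<le> 1 powr \<alpha>"
      using t0 \<alpha> by (intro powr_tangent) auto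
    then have "(1 + t) powr \<alpha> \<le> 1 + \<alpha> * (1 + t) powr (\<alpha> - 1) * t" by (simp add: algebra_simps)
    then have "?x powr (- \<alpha>) \<le> y powr (- \<alpha>) * (1 + \<alpha> * (1 + t) powr (\<alpha> - 1) * t)"
      unfolding xy by (intro mult_left_mono) auto
    also have "\<dots> = y powr (- \<alpha>) + \<alpha> * ((y powr (- \<alpha>) * t) * (1 + t) powr (\<alpha> - 1))"
      by (simp add: algebra_simps)
    also have "\<dots> \<le> y powr (- \<alpha>) + \<alpha> * ((2 powr \<gamma> * b n powr (\<gamma> - \<alpha>)) * (1 + (2 * b n) powr \<gamma>) powr (\<alpha> - 1))"
    proof (intro add_left_mono mult_left_mono[OF mult_mono])
      have "y powr (- \<alpha>) * t \<le> y powr (- \<alpha>) * (2 * y) powr \<gamma>" using t1 by (intro mult_left_mono) auto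
      also have "\<dots> = 2 powr \<gamma> * y powr (\<gamma> - \<alpha>)"
        using y by (simp add: powr_mult powr_diff powr_minus field_simps)
      also have "\<dots> \<le> 2 powr \<gamma> * b n powr (\<gamma> - \<alpha>)" using y \<gamma> by (intro mult_left_mono powr_mono2) auto
      finally show "y powr (- \<alpha>) * t \<le> 2 powr \<gamma> * b n powr (\<gamma> - \<alpha>)" .
      show "(1 + t) powr (\<alpha> - 1) \<le> (1 + (2 * b n) powr \<gamma>) powr (\<alpha> - 1)"
        using t0 t2 \<alpha> by (intro powr_mono2) auto
    qed (use exps in auto)
    finally show ?thesis .
  qed
  let ?A = "2 powr \<alpha> * (1 + (2 * b n) powr \<alpha>) powr (\<alpha> - 1)"
  let ?B = "2 powr \<beta> * b n powr (\<beta> - \<alpha>) * (1 + (2 * b n) powr \<beta>) powr (\<alpha> - 1)"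
  have "mean (Suc n) (\<lambda>y. y powr (- \<alpha>)) \<le> mean n (\<lambda>y. y powr (- \<alpha>) + \<alpha> * (p1 * ?A + p2 * ?B))"
    unfolding mean_Suc
  proof (rule mean_mono)
    fix y assume y: "0 < y" "y \<le> 1" "y \<le> b n"
    have "p1 * g True y powr (- \<alpha>) \<le> p1 * (y powr (- \<alpha>) + \<alpha> * ?A)"
      using step[OF y, of \<alpha>] p1 b_pos[of n] by (intro mult_left_mono) (auto simp: g_def)
    moreover have "p2 * g False y powr (- \<alpha>) \<le> p2 * (y powr (- \<alpha>) + \<alpha> * ?B)"
      using step[OF y, of \<beta>] p2 \<alpha>\<beta> by (intro mult_left_mono) (auto simp: g_def)
    ultimately have "p1 * g True y powr (- \<alpha>) + p2 * g False y powr (- \<alpha>) \<le>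
       (p1 + p2) * y powr (- \<alpha>) + \<alpha> * (p1 * ?A + p2 * ?B)"
      by (simp add: algebra_simps)
    then show "p1 * g True y powr (- \<alpha>) + p2 * g False y powr (- \<alpha>) \<le> y powr (- \<alpha>) + \<alpha> * (p1 * ?A + p2 * ?B)"
      by (simp add: p12)
  qed
  then show ?thesis unfolding mean_add mean_const by (simp add: mult_ac)
qed

lemma r_inverse_power_le: "r n powr (- \<alpha>) \<le> mean n (\<lambda>y. y powr (- \<alpha>))"
proof -
  let ?d = "- \<alpha> * r n powr (- \<alpha> - 1)"
  have "mean n (\<lambda>y. ?d * y + (r n powr (- \<alpha>) - ?d * r n)) \<le> mean n (\<lambda>y. y powr (- \<alpha>))"
  proof (rule mean_mono)
    fix y :: real assume y: "0 < y"
    show "?d * y + (r n powr (- \<alpha>) - ?d * r n) \<le> y powr (- \<alpha>)"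
      using powr_tangent[of "r n" y "- \<alpha>"] r_pos[of n] y \<alpha> by (simp add: algebra_simps)
  qed
  then show ?thesis unfolding mean_add mean_cmult mean_const by (simp flip: r_def)
qed

text \<open>The two estimates trap \<open>r n powr (- \<alpha>)\<close> between sums whose
  increments tend to the same \<open>?L\<close>, so its quotient by \<open>n\<close> tends to
  \<open>?L\<close> by Cesaro means. The upper sum starts at 1 because every orbit starts at
  1.\<close>

lemma r_asymptotic:
  "(\<lambda>n. real n powr (1 / \<alpha>) * r n) \<longlonglongrightarrow> (\<alpha> * (p1 * 2 powr \<alpha>)) powr (- 1 / \<alpha>)"
proof -
  let ?L = "\<alpha> * (p1 * 2 powr \<alpha>)"
  have L: "?L > 0" using exps p1 by simp
  define c where "c n = \<alpha> * (p1 * 2 powr \<alpha> * (1 + (2 * b n) powr \<alpha>) powr (- (\<alpha> + 1)))" for n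
  define c' where "c' n = \<alpha> * (p1 * 2 powr \<alpha> * (1 + (2 * b n) powr \<alpha>) powr (\<alpha> - 1) +
          p2 * 2 powr \<beta> * b n powr (\<beta> - \<alpha>) * (1 + (2 * b n) powr \<beta>) powr (\<alpha> - 1))" for n
  have b0: "(\<lambda>n. (2 * b n) powr e) \<longlonglongrightarrow> 0" "(\<lambda>n. b n powr e) \<longlonglongrightarrow> 0" if "e > 0" for e
  proof -
    have nn: "\<forall>\<^sub>F n in sequentially. 0 \<le> b n" "\<forall>\<^sub>F n in sequentially. 0 \<le> 2 * b n"
      using b_pos by (auto intro!: always_eventually less_imp_le)
    show "(\<lambda>n. (2 * b n) powr e) \<longlonglongrightarrow> 0" "(\<lambda>n. b n powr e) \<longlonglongrightarrow> 0"
      using tendsto_powr'[OF tendsto_mult_left[OF b_tendsto_0, of 2] tendsto_const, of e]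
        tendsto_powr'[OF b_tendsto_0 tendsto_const, of e] that nn by auto
  qed
  have "c \<longlonglongrightarrow> \<alpha> * (p1 * 2 powr \<alpha> * (1 + 0) powr (- (\<alpha> + 1)))"
    unfolding c_def by (intro tendsto_intros b0 exps) auto
  then have c: "c \<longlonglongrightarrow> ?L" by simp
  have "c' \<longlonglongrightarrow> \<alpha> * (p1 * 2 powr \<alpha> * (1 + 0) powr (\<alpha> - 1) + p2 * 2 powr \<beta> * 0 * (1 + 0) powr (\<alpha> - 1))"
    unfolding c'_def by (intro tendsto_intros b0 exps) (use \<alpha>\<beta> in auto)
  then have c': "c' \<longlonglongrightarrow> ?L" by simp
  have lower: "(\<Sum>j<n. c j) \<le> r n powr (- \<alpha>)" for n
  proof (induction n)
    case (Suc n)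
    then show ?case using r_inverse_power_lower[of n] by (simp add: c_def)
  qed simp
  have "mean n (\<lambda>y. y powr (- \<alpha>)) \<le> 1 + (\<Sum>j<n. c' j)" for n
  proof (induction n)
    case (Suc n)
    then show ?case using mean_inverse_power_Suc[of n] by (simp add: c'_def)
  qed (simp add: mean_0)
  then have upper: "r n powr (- \<alpha>) \<le> 1 + (\<Sum>j<n. c' j)" for n
    using r_inverse_power_le[of n] order_trans by blast
  have "(\<lambda>n. r n powr (- \<alpha>) / real n) \<longlonglongrightarrow> ?L"
  proof (rule tendsto_sandwich[OF _ _ Cesaro_tendsto[OF c]])
    have "(\<lambda>n. 1 / real n + (\<Sum>j<n. c' j) / real n) \<longlonglongrightarrow> 0 + ?L"
      by (intro tendsto_add Cesaro_tendsto[OF c']) real_asymp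
    then show "(\<lambda>n. (1 + (\<Sum>j<n. c' j)) / real n) \<longlonglongrightarrow> ?L" by (simp add: add_divide_distrib)
  qed (use lower upper in \<open>auto intro!: always_eventually divide_right_mono\<close>)
  then have "(\<lambda>n. (r n powr (- \<alpha>) / real n) powr (- 1 / \<alpha>)) \<longlonglongrightarrow> ?L powr (- 1 / \<alpha>)"
    using L by (intro tendsto_powr tendsto_const) auto
  then show ?thesis
  proof (rule Lim_transform_eventually)
    show "\<forall>\<^sub>F n in sequentially. (r n powr (- \<alpha>) / real n) powr (- 1 / \<alpha>) = real n powr (1 / \<alpha>) * r n"
      using eventually_gt_at_top[of 0]
    proof eventually_elim
      case (elim n)
      have "(r n powr (- \<alpha>) / real n) powr (- 1 / \<alpha>) = r n powr (- \<alpha> * (- 1 / \<alpha>)) / real n powr (- 1 / \<alpha>)"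
        by (simp add: powr_divide powr_powr)
      also have "- \<alpha> * (- 1 / \<alpha>) = 1" using exps by simp
      finally show ?case using r_pos[of n] by (simp add: powr_minus divide_inverse mult.commute)
    qed
  qed
qed

end

section \<open>Systems with a full-branch first-return map\<close>

text \<open>The index type enumerates the branches of the first-return map to \<open>D\<close>.
  \<open>full_branch\<close> says that each branch spreads its share of the normalised measure over
  \<open>D\<close> proportionally to that measure, which gives the renewal structure.
  \<open>contraction\<close> and \<open>inner_closed\<close> connect this with the metric: Lipschitz
  functions and measurable sets become approximable by cylinders.\<close>

locale affine_return_system =
  fixes M :: "'a::metric_space measure" and S :: "'a \<Rightarrow> 'a" and D :: "'a set"
    and B :: "'i::countable \<Rightarrow> 'a set" and \<tau> :: "'i \<Rightarrow> nat" and \<theta> :: real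
  assumes S_measurable [measurable]: "S \<in> M \<rightarrow>\<^sub>M M"
    and D_sets [measurable]: "D \<in> sets M"
    and D_pos: "emeasure M D \<noteq> 0" and D_finite: "emeasure M D \<noteq> \<infinity>"
    and nonsingular: "\<And>N. N \<in> null_sets M \<Longrightarrow> S -` N \<inter> space M \<in> null_sets M"
    and enters: "AE z in M. \<exists>k. (S ^^ k) z \<in> D"
    and B_sets [measurable]: "\<And>i. B i \<in> sets M" and B_subset: "\<And>i. B i \<subseteq> D"
    and B_disjoint: "disjoint_family B"
    and B_cover: "AE z in uniform_measure M D. z \<in> (\<Union>i. B i)"
    and \<tau>_pos: "\<And>i. 0 < \<tau> i" and \<tau>_finite: "\<And>n. finite {i. \<tau> i \<le> n}"
    and return: "\<And>i z. z \<in> B i \<Longrightarrow> (S ^^ \<tau> i) z \<in> D"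
    and no_return: "\<And>i z j. z \<in> B i \<Longrightarrow> 0 < j \<Longrightarrow> j < \<tau> i \<Longrightarrow> (S ^^ j) z \<notin> D"
    and full_branch: "\<And>i A. A \<in> sets M \<Longrightarrow> A \<subseteq> D \<Longrightarrow>
      measure (uniform_measure M D) (B i \<inter> (S ^^ \<tau> i) -` A) =
      measure (uniform_measure M D) (B i) * measure (uniform_measure M D) A"
    and \<theta>: "0 \<le> \<theta>" "\<theta> < 1"
    and contraction: "\<And>i z z'. z \<in> B i \<Longrightarrow> z' \<in> B i \<Longrightarrow>
      dist z z' \<le> \<theta> * dist ((S ^^ \<tau> i) z) ((S ^^ \<tau> i) z')"
    and D_bounded: "bounded D"
    and inner_closed: "\<And>X e. X \<in> sets M \<Longrightarrow> X \<subseteq> D \<Longrightarrow> 0 < e \<Longrightarrow>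
      \<exists>K\<in>sets M. K \<subseteq> X \<and> closed K \<and> measure (uniform_measure M D) X < measure (uniform_measure M D) K + e"
begin

definition \<mu> :: "'a measure" where "\<mu> = uniform_measure M D"

abbreviation P :: "'a set \<Rightarrow> real" where "P \<equiv> measure \<mu>"

definition pre :: "nat \<Rightarrow> 'a set \<Rightarrow> 'a set" where "pre n A = (S ^^ n) -` A \<inter> space M"

definition u :: "nat \<Rightarrow> real" where "u n = P (pre n D)"

sublocale \<mu>: prob_space \<mu>
  unfolding \<mu>_def using D_pos D_finite by (intro prob_space_uniform_measure)

lemma sets_\<mu> [simp, measurable_cong]: "sets \<mu> = sets M" and space_\<mu> [simp]: "space \<mu> = space M"
  by (simp_all add: \<mu>_def)

lemma S_funpow_measurable [measurable]: "S ^^ n \<in> M \<rightarrow>\<^sub>M M"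
  by (rule measurable_compose_n) measurable

lemma pre_sets [measurable]: "A \<in> sets M \<Longrightarrow> pre n A \<in> sets M"
  unfolding pre_def by measurable

lemma pre_0: "A \<in> sets M \<Longrightarrow> pre 0 A = A"
  using sets.sets_into_space by (auto simp: pre_def)

lemma S_space: "z \<in> space M \<Longrightarrow> (S ^^ n) z \<in> space M"
  using measurable_space[OF S_funpow_measurable] .

lemma pre_pre: "pre m (pre n A) = pre (m + n) A"
proof -
  have "(S ^^ (m + n)) z = (S ^^ n) ((S ^^ m) z)" for z
    by (simp add: add.commute[of m] funpow_add)
  then show ?thesis by (auto simp: pre_def S_space)
qed

lemma D_space: "z \<in> D \<Longrightarrow> z \<in> space M"
  using sets.sets_into_space[OF D_sets] by auto

lemma B_D: "z \<in> B i \<Longrightarrow> z \<in> D"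
  using B_subset by auto

lemma P_Int_D: "X \<in> sets M \<Longrightarrow> P (D \<inter> X) = P X"
proof -
  have "emeasure M D \<noteq> \<top>" using D_finite by simp
  then show "X \<in> sets M \<Longrightarrow> P (D \<inter> X) = P X"
    unfolding \<mu>_def by (subst (1 2) measure_uniform_measure) (auto simp: D_pos)
qed

lemma AE_\<mu>_D: "AE z in \<mu>. z \<in> D"
  unfolding \<mu>_def using D_pos D_finite by (intro AE_uniform_measureI) auto

lemma AE_\<mu>_B: "AE z in \<mu>. z \<in> (\<Union>i. B i)"
  unfolding \<mu>_def by (rule B_cover)

lemma P_full_branch: "A \<in> sets M \<Longrightarrow> A \<subseteq> D \<Longrightarrow> P (B i \<inter> pre (\<tau> i) A) = P (B i) * P A"
proof -
  assume A: "A \<in> sets M" "A \<subseteq> D"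
  have "B i \<inter> pre (\<tau> i) A = B i \<inter> (S ^^ \<tau> i) -` A"
    using B_D D_space by (auto simp: pre_def)
  then show ?thesis using full_branch[OF A] by (simp add: \<mu>_def)
qed

lemma P_D: "P D = 1"
  using P_Int_D[of "space M"] \<mu>.prob_space D_space by (simp add: Int_absorb2 subset_eq)

lemma u_0: "u 0 = 1" by (simp add: u_def pre_0 P_D)

text \<open>Conditioning on the first return: a point whose return time exceeds \<open>n\<close> is
  outside \<open>D\<close> at time \<open>n\<close>, and a point that has returned is distributed
  according to \<open>\<mu>\<close> anew.\<close>

lemma P_pre_step:
  assumes A: "A \<in> sets M" "A \<subseteq> D" and n: "0 < n"
  shows "P (pre n A) = (\<Sum>i | \<tau> i \<le> n. P (B i) * P (pre (n - \<tau> i) A))"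
proof -
  have "P (pre n A) = P (\<Union>i\<in>{i. \<tau> i \<le> n}. B i \<inter> pre n A)"
  proof (rule \<mu>.finite_measure_eq_AE)
    show "AE z in \<mu>. z \<in> pre n A \<longleftrightarrow> z \<in> (\<Union>i\<in>{i. \<tau> i \<le> n}. B i \<inter> pre n A)"
      using AE_\<mu>_B
    proof eventually_elim
      case (elim z)
      then obtain i where i: "z \<in> B i" by auto
      have "\<tau> i \<le> n" if "z \<in> pre n A"
        using no_return[OF i n] that A by (force simp: pre_def)
      then show ?case using i by auto
    qed
  qed (use A \<tau>_finite in \<open>auto intro!: sets.finite_UN\<close>)
  also have "\<dots> = (\<Sum>i | \<tau> i \<le> n. P (B i \<inter> pre n A))"
    using A B_disjoint by (intro \<mu>.finite_measure_finite_Union \<tau>_finite)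
      (auto simp: disjoint_family_on_def)
  also have "\<dots> = (\<Sum>i | \<tau> i \<le> n. P (B i) * P (pre (n - \<tau> i) A))"
  proof (rule sum.cong[OF refl])
    fix i assume i: "i \<in> {i. \<tau> i \<le> n}"
    have "B i \<inter> pre n A = B i \<inter> pre (\<tau> i) (D \<inter> pre (n - \<tau> i) A)"
    proof -
      have "pre n A = pre (\<tau> i) (pre (n - \<tau> i) A)" using i by (simp add: pre_pre)
      moreover have "B i \<subseteq> pre (\<tau> i) D" using return B_D D_space by (auto simp: pre_def)
      ultimately show ?thesis by (auto simp: pre_def)
    qed
    then show "P (B i \<inter> pre n A) = P (B i) * P (pre (n - \<tau> i) A)"
      using A by (simp add: P_full_branch P_Int_D)
  qed
  finally show ?thesis .
qed

text \<open>By strong induction every \<open>A\<close> obeys the recursion of \<open>D\<close>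
  multiplied by \<open>P A\<close>. The dynamics seen from \<open>D\<close> is thereby reduced to
  the scalar sequence \<open>u\<close>.\<close>

lemma P_pre: "A \<in> sets M \<Longrightarrow> A \<subseteq> D \<Longrightarrow> P (pre n A) = u n * P A"
proof (induction n rule: less_induct)
  case (less n)
  show ?case
  proof (cases "n = 0")
    case True
    then show ?thesis using less.prems by (simp add: pre_0 u_0)
  next
    case False
    have "P (pre n A) = (\<Sum>i | \<tau> i \<le> n. P (B i) * P (pre (n - \<tau> i) A))"
      using False less.prems by (intro P_pre_step) auto
    also have "\<dots> = (\<Sum>i | \<tau> i \<le> n. P (B i) * (u (n - \<tau> i) * P A))"
      using False less \<tau>_pos by (intro sum.cong refl) auto
    also have "\<dots> = (\<Sum>i | \<tau> i \<le> n. P (B i) * P (pre (n - \<tau> i) D)) * P A"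
      by (simp add: u_def sum_distrib_right mult.assoc)
    also have "(\<Sum>i | \<tau> i \<le> n. P (B i) * P (pre (n - \<tau> i) D)) = u n"
      unfolding u_def using False by (intro P_pre_step[symmetric]) auto
    finally show ?thesis .
  qed
qed

definition q :: "nat \<Rightarrow> real" where "q k = (\<Sum>i | \<tau> i = k. P (B i))"

lemma u_renewal: "0 < n \<Longrightarrow> u n = (\<Sum>k=1..n. q k * u (n - k))"
proof -
  assume n: "0 < n"
  have "u n = (\<Sum>i | \<tau> i \<le> n. P (B i) * u (n - \<tau> i))"
    unfolding u_def by (rule P_pre_step[OF D_sets order_refl n])
  also have "\<dots> = (\<Sum>k\<in>{1..n}. \<Sum>i\<in>{i \<in> {i. \<tau> i \<le> n}. \<tau> i = k}. P (B i) * u (n - \<tau> i))"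
    using \<tau>_pos by (intro sum.group[symmetric] \<tau>_finite) (auto simp: Suc_le_eq)
  also have "\<dots> = (\<Sum>k=1..n. q k * u (n - k))"
    unfolding q_def sum_distrib_right by (intro sum.cong) auto
  finally show ?thesis .
qed

text \<open>Abel summation: passing from \<open>n\<close> to \<open>Suc n\<close> lowers each tail
  by one value of \<open>q\<close>. By the renewal equation the total loss is
  \<open>u (Suc n)\<close>, which the new last term restores.\<close>

lemma renewal_tail:
  assumes r0: "r 0 = 1" and q: "\<And>k. q (Suc k) = r k - r (Suc k)"
  shows "(\<Sum>k\<le>n. u k * r (n - k)) = 1"
proof (induction n)
  case 0
  then show ?case by (simp add: u_0 r0)
next
  case (Suc n)
  have "(\<Sum>k\<le>n. u k * r (Suc n - k)) = (\<Sum>k\<le>n. u k * (r (n - k) - q (Suc n - k)))"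
    by (intro sum.cong refl) (simp add: q Suc_diff_le)
  also have "\<dots> = 1 - (\<Sum>k\<le>n. u k * q (Suc n - k))"
    using Suc by (simp add: right_diff_distrib sum_subtractf)
  also have "(\<Sum>k\<le>n. u k * q (Suc n - k)) = (\<Sum>k=1..Suc n. q k * u (Suc n - k))"
    by (rule sum.reindex_bij_witness[of _ "\<lambda>k. Suc n - k" "\<lambda>k. Suc n - k"]) auto
  also have "\<dots> = u (Suc n)" by (rule u_renewal[symmetric]) simp
  finally show ?case by (simp add: r0)
qed

section \<open>Cylinders of the iterated first-return map\<close>

fun cyl :: "'i list \<Rightarrow> 'a set" where
  "cyl [] = D"
| "cyl (i # w) = B i \<inter> pre (\<tau> i) (cyl w)"

definition time :: "'i list \<Rightarrow> nat" where "time w = sum_list (map \<tau> w)"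

lemma cyl_sets [measurable]: "cyl w \<in> sets M"
  by (induction w) auto

lemma cyl_subset: "cyl w \<subseteq> D"
  using B_subset by (cases w) auto

lemma time_simps [simp]: "time [] = 0" "time (i # w) = \<tau> i + time w"
  by (simp_all add: time_def)

lemma S_time: "z \<in> cyl w \<Longrightarrow> (S ^^ time w) z \<in> D"
proof (induction w arbitrary: z)
  case (Cons i w)
  then have "(S ^^ time w) ((S ^^ \<tau> i) z) \<in> D" by (auto simp: pre_def)
  then show ?case by (simp add: add.commute[of "\<tau> i"] funpow_add)
qed simp

lemma P_cyl_pre:
  assumes A: "A \<in> sets M" "A \<subseteq> D"
  shows "P (cyl w \<inter> pre (time w) A) = P (cyl w) * P A"
proof (induction w)
  case Nil
  then show ?case using A by (simp add: pre_0 P_D Int_absorb1)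
next
  case (Cons i w)
  have "cyl (i # w) \<inter> pre (time (i # w)) A = B i \<inter> pre (\<tau> i) (cyl w \<inter> pre (time w) A)"
    by (simp flip: pre_pre) (auto simp: pre_def)
  then have "P (cyl (i # w) \<inter> pre (time (i # w)) A) = P (B i) * P (cyl w \<inter> pre (time w) A)"
    using A cyl_subset[of w] by (simp add: P_full_branch le_infI1)
  also have "\<dots> = P (cyl (i # w)) * P A"
    using Cons cyl_subset[of w] by (simp add: P_full_branch)
  finally show ?case .
qed

text \<open>At the return time \<open>time w\<close> the cylinder has been spread over
  \<open>D\<close> like \<open>\<mu>\<close>; the remaining \<open>n - time w\<close> steps follow
  \<open>P_pre\<close>.\<close>

lemma P_cyl_pre_ge:
  assumes A: "A \<in> sets M" "A \<subseteq> D" and n: "time w \<le> n"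
  shows "P (cyl w \<inter> pre n A) = P (cyl w) * u (n - time w) * P A"
proof -
  have "cyl w \<inter> pre n A = cyl w \<inter> pre (time w) (D \<inter> pre (n - time w) A)"
  proof -
    have "pre n A = pre (time w) (pre (n - time w) A)" using n by (simp add: pre_pre)
    moreover have "cyl w \<subseteq> pre (time w) D" using S_time D_space[OF subsetD[OF cyl_subset]] by (auto simp: pre_def)
    ultimately show ?thesis by (auto simp: pre_def)
  qed
  then show ?thesis using A by (simp add: P_cyl_pre P_Int_D P_pre)
qed

lemma cyl_unique: "z \<in> cyl v \<Longrightarrow> z \<in> cyl w \<Longrightarrow> length v = length w \<Longrightarrow> v = w"
proof (induction v arbitrary: w z)
  case (Cons i v)
  then obtain j w' where w: "w = j # w'" by (cases w) auto
  have "i = j" using Cons.prems B_disjoint unfolding w by (auto simp: disjoint_family_on_def)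
  moreover have "v = w'" using Cons.prems Cons.IH[of "(S ^^ \<tau> i) z" w'] \<open>i = j\<close> unfolding w by (auto simp: pre_def)
  ultimately show ?case by (simp add: w)
qed simp

text \<open>The points of \<open>D\<close> without a code of length \<open>m\<close> form a null
  set; \<open>full_branch\<close> makes its pullback under each branch null, and there are countably
  many branches.\<close>

lemma AE_cyl: "AE z in \<mu>. \<exists>w. length w = m \<and> z \<in> cyl w"
proof (induction m)
  case 0
  show ?case using AE_\<mu>_D by eventually_elim (auto intro: exI[of _ "[]"])
next
  case (Suc m)
  define X where "X = {z \<in> D. \<not> (\<exists>w. length w = m \<and> z \<in> cyl w)}"
  have X: "X \<in> sets M" "X \<subseteq> D"
  proof -
    have "X = D - (\<Union>w\<in>{w. length w = m}. cyl w)" by (auto simp: X_def)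
    then show "X \<in> sets M" by (auto intro!: sets.Diff sets.countable_UN' D_sets)
  qed (auto simp: X_def)
  have "P X = 0"
  proof -
    have "AE z in \<mu>. z \<notin> X" using Suc by eventually_elim (auto simp: X_def)
    then show ?thesis using X by (simp add: \<mu>.prob_eq_0)
  qed
  then have "P (B i \<inter> pre (\<tau> i) X) = 0" for i using X by (simp add: P_full_branch)
  then have "AE z in \<mu>. z \<notin> B i \<inter> pre (\<tau> i) X" for i
    using X by (subst (asm) \<mu>.prob_eq_0) auto
  then have "AE z in \<mu>. \<forall>i. z \<notin> B i \<inter> pre (\<tau> i) X" by (simp add: AE_all_countable)
  then show ?case using AE_\<mu>_B
  proof eventually_elim
    case (elim z)
    then obtain i where i: "z \<in> B i" by auto
    have "(S ^^ \<tau> i) z \<in> D - X" using elim(1) i return[OF i] D_space B_D[OF i] by (auto simp: pre_def)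
    then obtain w where "length w = m" "(S ^^ \<tau> i) z \<in> cyl w" by (auto simp: X_def)
    then show ?case using i D_space B_D[OF i] by (intro exI[of _ "i # w"]) (auto simp: pre_def)
  qed
qed

definition short_cyls :: "nat \<Rightarrow> nat \<Rightarrow> 'i list set" where
  "short_cyls m K = {w. length w = m \<and> time w \<le> K}"

lemma finite_short_cyls: "finite (short_cyls m K)"
proof (rule finite_subset)
  show "finite {w. set w \<subseteq> {i. \<tau> i \<le> K} \<and> length w = m}" by (intro finite_lists_length_eq \<tau>_finite)
  have "\<tau> i \<le> time w" if "i \<in> set w" for i w
    unfolding time_def using that by (intro member_le_sum_list) auto
  then show "short_cyls m K \<subseteq> {w. set w \<subseteq> {i. \<tau> i \<le> K} \<and> length w = m}"
    by (fastforce simp: short_cyls_def)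
qed

lemma P_UN_short_cyls: "(\<lambda>K. P (\<Union>w\<in>short_cyls m K. cyl w)) \<longlonglongrightarrow> 1"
proof -
  have "(\<lambda>K. P (\<Union>w\<in>short_cyls m K. cyl w)) \<longlonglongrightarrow> P (\<Union>K. \<Union>w\<in>short_cyls m K. cyl w)"
    using finite_short_cyls by (intro \<mu>.finite_Lim_measure_incseq)
      (auto simp: incseq_def short_cyls_def intro!: sets.finite_UN)
  moreover have "P (\<Union>K. \<Union>w\<in>short_cyls m K. cyl w) = 1"
  proof (subst \<mu>.prob_eq_1)
    show "AE z in \<mu>. z \<in> (\<Union>K. \<Union>w\<in>short_cyls m K. cyl w)"
      using AE_cyl[of m] by eventually_elim (auto simp: short_cyls_def)
    show "(\<Union>K. \<Union>w\<in>short_cyls m K. cyl w) \<in> \<mu>.events"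
      using finite_short_cyls by (auto intro!: sets.countable_UN sets.finite_UN)
  qed
  ultimately show ?thesis by simp
qed

lemma P_UN_cyl: "F \<subseteq> {w. length w = m} \<Longrightarrow> finite F \<Longrightarrow> X \<in> sets M \<Longrightarrow>
  P ((\<Union>w\<in>F. cyl w) \<inter> X) = (\<Sum>w\<in>F. P (cyl w \<inter> X))"
  unfolding UN_extend_simps
  by (intro \<mu>.finite_measure_finite_Union) (auto simp: disjoint_family_on_def dest: cyl_unique)

lemma integrable_indicator_\<mu> [simp]: "Y \<in> sets M \<Longrightarrow> integrable \<mu> (indicat_real Y)"
  by (intro integrable_real_indicator) (auto simp: less_top[symmetric])

text \<open>\<open>f\<close> is replaced by a combination of indicators of finitely many cylinders.
  For each of them the correlation is exact, with \<open>u (n - time w)\<close> in place of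
  \<open>u n\<close>, and \<open>ratio\<close> makes the two comparable. Every error carries the
  factor \<open>u n * P A\<close>, uniformly in \<open>A\<close>, as an essential supremum will
  require.\<close>

lemma correlation_asymptotic:
  fixes f :: "'a \<Rightarrow> real"
  assumes f [measurable]: "f \<in> borel_measurable M" and bound: "\<And>z. z \<in> D \<Longrightarrow> \<bar>f z\<bar> \<le> C" and C: "0 < C"
    and osc: "\<And>\<delta>. 0 < \<delta> \<Longrightarrow> \<exists>m. \<forall>w. length w = m \<longrightarrow> (\<forall>z\<in>cyl w. \<forall>z'\<in>cyl w. \<bar>f z - f z'\<bar> \<le> \<delta>)"
    and u_pos: "\<And>n. 0 < u n" and ratio: "(\<lambda>n. u (Suc n) / u n) \<longlonglongrightarrow> 1"
    and e: "0 < e"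
  shows "\<forall>\<^sub>F n in sequentially. \<forall>A\<in>sets M. A \<subseteq> D \<longrightarrow>
    \<bar>(\<integral>z. f z * indicator (pre n A) z \<partial>\<mu>) - u n * (\<integral>z. f z \<partial>\<mu>) * P A\<bar> \<le> e * u n * P A"
proof -
  \<comment> \<open>The errors will add up to \<open>2 * \<delta> + 4 * (C * \<eta>)\<close>, which
    is \<open>e\<close>.\<close>
  define \<delta> where "\<delta> = e / 4"
  define \<eta> where "\<eta> = e / (8 * C)"
  have \<delta>: "0 < \<delta>" and \<eta>: "0 < \<eta>" using e C by (auto simp: \<delta>_def \<eta>_def)
  obtain m where m: "\<And>w z z'. length w = m \<Longrightarrow> z \<in> cyl w \<Longrightarrow> z' \<in> cyl w \<Longrightarrow> \<bar>f z - f z'\<bar> \<le> \<delta>"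
    using osc[OF \<delta>] by blast
  obtain K where K: "P (\<Union>w\<in>short_cyls m K. cyl w) > 1 - \<eta>"
    using order_tendstoD(1)[OF P_UN_short_cyls[of m], of "1 - \<eta>"] \<eta> by (auto simp: eventually_sequentially)
  define F where "F = short_cyls m K"
  have F: "finite F" "F \<subseteq> {w. length w = m}" "\<And>w. w \<in> F \<Longrightarrow> time w \<le> K"
    using finite_short_cyls[of m K] by (auto simp: F_def short_cyls_def)
  define E where "E = (\<Union>w\<in>F. cyl w)"
  have E [measurable]: "E \<in> sets M" and E_D: "E \<subseteq> D"
    using F cyl_subset by (auto simp: E_def intro!: sets.finite_UN)
  have PE: "P E = (\<Sum>w\<in>F. P (cyl w))"
    unfolding E_def using P_UN_cyl[OF F(2,1) sets.top] cyl_sets sets.sets_into_space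
    by (simp add: Int_absorb2 sets.sets_into_space[OF cyl_sets] UN_least)
  have PE': "1 - \<eta> < (\<Sum>w\<in>F. P (cyl w))" using K PE by (simp add: E_def F_def)
  have PE1: "(\<Sum>w\<in>F. P (cyl w)) \<le> 1" using PE \<mu>.prob_le_1[of E] by simp
  define c where "c w = (if cyl w = {} then 0 else f (SOME z. z \<in> cyl w))" for w
  have c: "\<bar>f z - c w\<bar> \<le> \<delta>" if "w \<in> F" "z \<in> cyl w" for z w
  proof -
    have "(SOME z. z \<in> cyl w) \<in> cyl w" using that by (auto intro: someI)
    then show ?thesis using that m[of w z "SOME z. z \<in> cyl w"] F(2) by (auto simp: c_def)
  qed
  have c_bound: "\<bar>c w\<bar> \<le> C" for w
  proof (cases "cyl w = {}")
    case False
    then have "(SOME z. z \<in> cyl w) \<in> cyl w" by (auto intro: someI)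
    then show ?thesis using bound cyl_subset False by (auto simp: c_def)
  qed (use C in \<open>simp add: c_def\<close>)
  define g where "g z = (\<Sum>w\<in>F. c w * indicator (cyl w) z)" for z
  have g [measurable]: "g \<in> borel_measurable M" unfolding g_def using F by measurable
  have the_cyl: "(THE w. w \<in> F \<and> z \<in> cyl w) = w" if "w \<in> F" "z \<in> cyl w" for z w
  proof (rule the_equality)
    show "w \<in> F \<and> z \<in> cyl w" using that by simp
    fix v assume "v \<in> F \<and> z \<in> cyl v"
    then show "v = w" using that F(2) by (intro cyl_unique[of z]) auto
  qed
  have g_eq: "g z = (if \<exists>w\<in>F. z \<in> cyl w then c (THE w. w \<in> F \<and> z \<in> cyl w) else 0)" for z
  proof (cases "\<exists>w\<in>F. z \<in> cyl w")
    case True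
    then obtain w where w: "w \<in> F" "z \<in> cyl w" by auto
    have uniq: "v = w" if "v \<in> F" "z \<in> cyl v" for v
      using cyl_unique[of z v w] w that F(2) by auto
    have "(THE w. w \<in> F \<and> z \<in> cyl w) = w" by (rule the_cyl[OF w])
    moreover have "g z = (\<Sum>v\<in>F. if v = w then c w else 0)"
      unfolding g_def
    proof (rule sum.cong[OF refl])
      fix v assume v: "v \<in> F"
      show "c v * indicator (cyl v) z = (if v = w then c w else 0)"
      proof (cases "v = w")
        case True
        then show ?thesis using w(2) by (simp only: indicator_simps if_True mult_1_right) simp
      next
        case False
        then have "z \<notin> cyl v" using uniq[OF v] by blast
        then show ?thesis using False by (simp only: indicator_simps mult_zero_right if_False) simp
      qed
    qed
    moreover have "(\<Sum>v\<in>F. if v = w then c w else 0) = c w"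
      using w(1) F(1) by simp
    moreover have "\<exists>w\<in>F. z \<in> cyl w" using w by blast
    ultimately show ?thesis by simp
  qed (auto simp: g_def indicator_def intro!: sum.neutral)
  have diff: "\<bar>f z - g z\<bar> \<le> \<delta> + C * indicator (D - E) z" if "z \<in> D" for z
  proof (cases "z \<in> E")
    case True
    then obtain w where w: "w \<in> F" "z \<in> cyl w" by (auto simp: E_def)
    have "g z = c w" unfolding g_eq the_cyl[OF w] using w by auto
    moreover have "indicat_real (D - E) z = 0" using True by simp
    ultimately show ?thesis using c[OF w] by simp
  next
    case False
    then have "g z = 0" unfolding g_eq by (auto simp: E_def)
    then show ?thesis using bound[OF that] False that \<delta> by simp
  qed
  have f_int: "integrable \<mu> f"
    by (rule \<mu>.integrable_const_bound[of _ C]) (use AE_\<mu>_D bound in \<open>auto elim!: eventually_mono\<close>)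
  have g_bound: "\<bar>g z\<bar> \<le> C" for z unfolding g_eq using c_bound C by auto
  have g_int: "integrable \<mu> g"
    by (rule \<mu>.integrable_const_bound[of _ C]) (use g_bound in auto)
  have approx: "\<bar>(\<integral>z. f z * indicator X z \<partial>\<mu>) - (\<integral>z. g z * indicator X z \<partial>\<mu>)\<bar> \<le> \<delta> * P X + C * P ((D - E) \<inter> X)"
    if X [measurable]: "X \<in> sets M" for X
  proof -
    have i: "integrable \<mu> (\<lambda>z. f z * indicator X z)" "integrable \<mu> (\<lambda>z. g z * indicator X z)"
      by (rule integrable_mult_indicator[where 'b = real, simplified mult.commute real_scaleR_def, of X \<mu>]; use f_int g_int in simp)+
    have "\<bar>(\<integral>z. f z * indicator X z \<partial>\<mu>) - (\<integral>z. g z * indicator X z \<partial>\<mu>)\<bar> =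
      \<bar>\<integral>z. (f z - g z) * indicator X z \<partial>\<mu>\<bar>"
      using i by (simp add: left_diff_distrib)
    also have "\<dots> \<le> (\<integral>z. \<bar>(f z - g z) * indicator X z\<bar> \<partial>\<mu>)"
      by (rule integral_abs_bound)
    also have "\<dots> \<le> (\<integral>z. \<delta> * indicator X z + C * indicator ((D - E) \<inter> X) z \<partial>\<mu>)"
    proof (rule integral_mono_AE)
      show "integrable \<mu> (\<lambda>z. \<bar>(f z - g z) * indicator X z\<bar>)"
        using i by (simp add: left_diff_distrib)
      show "integrable \<mu> (\<lambda>z. \<delta> * indicator X z + C * indicator ((D - E) \<inter> X) z)"
        by (intro Bochner_Integration.integrable_add integrable_mult_right integrable_real_indicator)
          (auto simp: less_top[symmetric])
      show "AE z in \<mu>. \<bar>(f z - g z) * indicator X z\<bar> \<le> \<delta> * indicator X z + C * indicator ((D - E) \<inter> X) z"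
        using AE_\<mu>_D by eventually_elim (use diff in \<open>auto simp: indicator_def abs_mult\<close>)
    qed
    also have "\<dots> = \<delta> * P X + C * P ((D - E) \<inter> X)"
    proof (subst Bochner_Integration.integral_add)
      show "integrable \<mu> (\<lambda>z. \<delta> * indicat_real X z)" "integrable \<mu> (\<lambda>z. C * indicat_real ((D - E) \<inter> X) z)"
        by (intro integrable_mult_right integrable_real_indicator; auto simp: less_top[symmetric])+
      have "X \<subseteq> space M" "(D - E) \<inter> X \<subseteq> space M" using sets.sets_into_space[OF X] by auto
      then show "(\<integral>z. \<delta> * indicat_real X z \<partial>\<mu>) + (\<integral>z. C * indicat_real ((D - E) \<inter> X) z \<partial>\<mu>) = \<delta> * P X + C * P ((D - E) \<inter> X)"
        by (simp add: Int_absorb2)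
    qed
    finally show ?thesis .
  qed
  have int_g: "(\<integral>z. g z * indicator X z \<partial>\<mu>) = (\<Sum>w\<in>F. c w * P (cyl w \<inter> X))" if X: "X \<in> sets M" for X
  proof -
    have "(\<integral>z. g z * indicator X z \<partial>\<mu>) = (\<integral>z. (\<Sum>w\<in>F. c w * indicator (cyl w \<inter> X) z) \<partial>\<mu>)"
      unfolding g_def by (intro Bochner_Integration.integral_cong refl) (simp add: sum_distrib_right indicator_inter_arith mult.assoc)
    also have "\<dots> = (\<Sum>w\<in>F. \<integral>z. c w * indicator (cyl w \<inter> X) z \<partial>\<mu>)"
      using X by (intro Bochner_Integration.integral_sum integrable_mult_right integrable_indicator_\<mu>) auto
    also have "\<dots> = (\<Sum>w\<in>F. c w * P (cyl w \<inter> X))"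
      using sets.sets_into_space[OF X] by (simp add: Int_absorb2 le_infI2)
    finally show ?thesis .
  qed
  \<comment> \<open>The discarded part is found by subtraction. For \<open>X = pre n A\<close> both
    terms on the right are known exactly, so the factor \<open>u n * P A\<close> survives.\<close>
  have P_out: "P ((D - E) \<inter> X) = P X - (\<Sum>w\<in>F. P (cyl w \<inter> X))" if X: "X \<in> sets M" for X
  proof -
    have "P ((D - E) \<inter> X) = P (D \<inter> X - E \<inter> X)" by (rule arg_cong[where f = P]) auto
    also have "\<dots> = P (D \<inter> X) - P (E \<inter> X)" using X E_D by (intro \<mu>.finite_measure_Diff) auto
    also have "P (E \<inter> X) = (\<Sum>w\<in>F. P (cyl w \<inter> X))" unfolding E_def by (rule P_UN_cyl[OF F(2,1) X])
    finally show ?thesis using X by (simp add: P_Int_D)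
  qed
  \<comment> \<open>A shift by a fixed \<open>N\<close> is a product of \<open>N\<close> consecutive
    ratios.\<close>
  have ratio_N: "(\<lambda>n. u (n - N) / u n) \<longlonglongrightarrow> 1" for N
  proof (induction N)
    case 0
    then show ?case using u_pos by (simp add: less_imp_neq[symmetric])
  next
    case (Suc N)
    have 1: "(\<lambda>n. u n / u (Suc n)) \<longlonglongrightarrow> 1" using tendsto_inverse[OF ratio] by simp
    have "(\<lambda>n. u (Suc n - Suc N) / u (Suc n)) \<longlonglongrightarrow> 1"
    proof -
      have "(\<lambda>n. u (n - N) / u n * (u n / u (Suc n))) \<longlonglongrightarrow> 1 * 1" by (intro tendsto_mult Suc 1)
      then show ?thesis using less_imp_neq[OF u_pos, symmetric] by simp
    qed
    then show ?case by (rule LIMSEQ_imp_Suc)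
  qed
  have "\<forall>\<^sub>F n in sequentially. \<forall>w\<in>F. \<bar>u (n - time w) / u n - 1\<bar> < \<eta>"
  proof (rule eventually_ball_finite[OF F(1)], rule ballI)
    fix w show "\<forall>\<^sub>F n in sequentially. \<bar>u (n - time w) / u n - 1\<bar> < \<eta>"
      using tendstoD[OF ratio_N[of "time w"] \<eta>] by (simp add: dist_real_def)
  qed
  then show ?thesis using eventually_ge_at_top[of K]
  proof eventually_elim
    case (elim n)
    show ?case
    proof (intro ballI impI)
      fix A assume A: "A \<in> sets M" "A \<subseteq> D"
      have PA: "P A \<ge> 0" by simp
      let ?v = "\<lambda>w. u (n - time w)"
      have v: "\<bar>?v w - u n\<bar> \<le> \<eta> * u n" if "w \<in> F" for w
      proof -
        have "\<bar>?v w / u n - 1\<bar> * u n \<le> \<eta> * u n"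
          using elim(1) that u_pos[of n] by (intro mult_right_mono) (auto intro: less_imp_le)
        moreover have "\<bar>?v w / u n - 1\<bar> * u n = \<bar>(?v w / u n - 1) * u n\<bar>"
          using u_pos[of n] by (simp add: abs_mult)
        moreover have "(?v w / u n - 1) * u n = ?v w - u n"
          using u_pos[of n] by (simp add: left_diff_distrib)
        ultimately show ?thesis by simp
      qed
      have cylA: "P (cyl w \<inter> pre n A) = P (cyl w) * ?v w * P A" if "w \<in> F" for w
        using F(3)[OF that] elim(2) by (intro P_cyl_pre_ge A) simp
      have pA: "P (pre n A) = u n * P A" by (rule P_pre[OF A])
      \<comment> \<open>The missing mass of the cylinders and the change of index each cost at most
        a fraction \<open>\<eta>\<close>.\<close>
      have lowv: "(\<Sum>w\<in>F. P (cyl w) * ?v w) \<ge> (1 - 2 * \<eta>) * u n"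
      proof -
        have "(\<Sum>w\<in>F. P (cyl w) * ?v w) \<ge> (\<Sum>w\<in>F. P (cyl w) * (u n - \<eta> * u n))"
        proof (intro sum_mono mult_left_mono)
          fix w assume "w \<in> F"
          from v[OF this] show "u n - \<eta> * u n \<le> ?v w" unfolding abs_le_iff by linarith
        qed simp
        also have "(\<Sum>w\<in>F. P (cyl w) * (u n - \<eta> * u n)) = (\<Sum>w\<in>F. P (cyl w)) * u n - \<eta> * ((\<Sum>w\<in>F. P (cyl w)) * u n)"
          by (simp add: sum_distrib_right right_diff_distrib sum_subtractf sum_distrib_left mult_ac)
        finally have 1: "(\<Sum>w\<in>F. P (cyl w)) * u n - \<eta> * ((\<Sum>w\<in>F. P (cyl w)) * u n) \<le> (\<Sum>w\<in>F. P (cyl w) * ?v w)" .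
        have 2: "(\<Sum>w\<in>F. P (cyl w)) * u n \<ge> (1 - \<eta>) * u n" using PE' u_pos[of n] by (intro mult_right_mono) auto
        have 3: "\<eta> * ((\<Sum>w\<in>F. P (cyl w)) * u n) \<le> \<eta> * (1 * u n)"
          using PE1 u_pos[of n] \<eta> by (intro mult_left_mono mult_right_mono) auto
        show ?thesis using 1 2 3 by (simp add: algebra_simps)
      qed
      let ?f = "\<integral>z. f z * indicator (pre n A) z \<partial>\<mu>" and ?g = "\<integral>z. g z * indicator (pre n A) z \<partial>\<mu>"
      have "\<bar>?f - ?g\<bar> \<le> \<delta> * P (pre n A) + C * P ((D - E) \<inter> pre n A)"
        using A by (intro approx) auto
      also have "P ((D - E) \<inter> pre n A) = (u n - (\<Sum>w\<in>F. P (cyl w) * ?v w)) * P A"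
        using A by (simp add: P_out pA cylA left_diff_distrib sum_distrib_right)
      also have "\<delta> * P (pre n A) + C * ((u n - (\<Sum>w\<in>F. P (cyl w) * ?v w)) * P A) \<le> \<delta> * (u n * P A) + C * (2 * \<eta> * u n * P A)"
        using lowv C PA unfolding pA
        by (intro add_left_mono mult_left_mono[of _ _ C] mult_right_mono[of _ _ "P A"]) (simp_all add: algebra_simps)
      finally have 1: "\<bar>?f - ?g\<bar> \<le> \<delta> * (u n * P A) + C * (2 * \<eta> * u n * P A)" .
      have g_n: "?g = (\<Sum>w\<in>F. c w * P (cyl w) * ?v w) * P A"
        using A by (simp add: int_g cylA sum_distrib_right mult.assoc)
      have int_g1: "(\<integral>z. g z \<partial>\<mu>) = (\<Sum>w\<in>F. c w * P (cyl w))"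
      proof -
        have "(\<integral>z. g z \<partial>\<mu>) = (\<integral>z. g z * indicator (space M) z \<partial>\<mu>)"
          by (intro Bochner_Integration.integral_cong refl) simp
        also have "\<dots> = (\<Sum>w\<in>F. c w * P (cyl w))"
          by (simp add: int_g Int_absorb2 sets.sets_into_space[OF cyl_sets])
        finally show ?thesis .
      qed
      have "\<bar>(\<Sum>w\<in>F. c w * P (cyl w) * ?v w) - u n * (\<integral>z. g z \<partial>\<mu>)\<bar> = \<bar>\<Sum>w\<in>F. c w * P (cyl w) * (?v w - u n)\<bar>"
        by (simp add: int_g1 sum_distrib_left right_diff_distrib sum_subtractf mult_ac)
      also have "\<dots> \<le> (\<Sum>w\<in>F. \<bar>c w * P (cyl w) * (?v w - u n)\<bar>)" by (rule sum_abs)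
      also have "\<dots> \<le> (\<Sum>w\<in>F. C * P (cyl w) * (\<eta> * u n))"
      proof (rule sum_mono)
        fix w assume w: "w \<in> F"
        show "\<bar>c w * P (cyl w) * (?v w - u n)\<bar> \<le> C * P (cyl w) * (\<eta> * u n)"
          unfolding abs_mult using v[OF w] c_bound[of w] C by (intro mult_mono) auto
      qed
      also have "\<dots> = (\<Sum>w\<in>F. P (cyl w)) * (C * \<eta> * u n)"
        unfolding sum_distrib_right by (intro sum.cong refl) simp
      also have "\<dots> \<le> 1 * (C * \<eta> * u n)"
        using PE1 C \<eta> u_pos[of n] by (intro mult_right_mono) auto
      finally have "\<bar>(\<Sum>w\<in>F. c w * P (cyl w) * ?v w) - u n * (\<integral>z. g z \<partial>\<mu>)\<bar> * P A \<le> C * \<eta> * u n * P A"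
        using PA by (intro mult_right_mono) auto
      then have 2: "\<bar>?g - u n * (\<integral>z. g z \<partial>\<mu>) * P A\<bar> \<le> C * \<eta> * u n * P A"
      proof -
        have "?g - u n * (\<integral>z. g z \<partial>\<mu>) * P A = ((\<Sum>w\<in>F. c w * P (cyl w) * ?v w) - u n * (\<integral>z. g z \<partial>\<mu>)) * P A"
          unfolding g_n by (simp add: left_diff_distrib)
        moreover have "\<bar>((\<Sum>w\<in>F. c w * P (cyl w) * ?v w) - u n * (\<integral>z. g z \<partial>\<mu>)) * P A\<bar> =
          \<bar>(\<Sum>w\<in>F. c w * P (cyl w) * ?v w) - u n * (\<integral>z. g z \<partial>\<mu>)\<bar> * P A"
          using PA by (simp add: abs_mult)
        ultimately show ?thesis
          using \<open>\<bar>(\<Sum>w\<in>F. c w * P (cyl w) * ?v w) - u n * (\<integral>z. g z \<partial>\<mu>)\<bar> * P A \<le> C * \<eta> * u n * P A\<close> by simp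
      qed
      have "\<bar>(\<integral>z. f z \<partial>\<mu>) - (\<integral>z. g z \<partial>\<mu>)\<bar> \<le> \<delta> + C * \<eta>"
      proof -
        have "(\<integral>z. h z \<partial>\<mu>) = (\<integral>z. h z * indicator (space M) z \<partial>\<mu>)" for h :: "'a \<Rightarrow> real"
          by (intro Bochner_Integration.integral_cong refl) simp
        then have "\<bar>(\<integral>z. f z \<partial>\<mu>) - (\<integral>z. g z \<partial>\<mu>)\<bar> \<le> \<delta> * P (space M) + C * P ((D - E) \<inter> space M)"
          using approx[OF sets.top] by metis
        also have "P ((D - E) \<inter> space M) = 1 - (\<Sum>w\<in>F. P (cyl w))"
          using P_out[OF sets.top] \<mu>.prob_space by (simp add: Int_absorb2 sets.sets_into_space[OF cyl_sets])
        also have "\<delta> * P (space M) + C * (1 - (\<Sum>w\<in>F. P (cyl w))) \<le> \<delta> + C * \<eta>"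
          using \<mu>.prob_space PE' C by (intro add_mono mult_left_mono) auto
        finally show ?thesis .
      qed
      then have "\<bar>(\<integral>z. g z \<partial>\<mu>) - (\<integral>z. f z \<partial>\<mu>)\<bar> * (u n * P A) \<le> (\<delta> + C * \<eta>) * (u n * P A)"
        using u_pos[of n] by (intro mult_right_mono) auto
      then have 3: "\<bar>u n * (\<integral>z. g z \<partial>\<mu>) * P A - u n * (\<integral>z. f z \<partial>\<mu>) * P A\<bar> \<le> (\<delta> + C * \<eta>) * (u n * P A)"

      proof -
        have "u n * (\<integral>z. g z \<partial>\<mu>) * P A - u n * (\<integral>z. f z \<partial>\<mu>) * P A = ((\<integral>z. g z \<partial>\<mu>) - (\<integral>z. f z \<partial>\<mu>)) * (u n * P A)"
          by (simp add: algebra_simps)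
        moreover have "\<bar>((\<integral>z. g z \<partial>\<mu>) - (\<integral>z. f z \<partial>\<mu>)) * (u n * P A)\<bar> = \<bar>(\<integral>z. g z \<partial>\<mu>) - (\<integral>z. f z \<partial>\<mu>)\<bar> * (u n * P A)"
          using u_pos[of n] by (simp add: abs_mult)
        ultimately show ?thesis using \<open>\<bar>(\<integral>z. g z \<partial>\<mu>) - (\<integral>z. f z \<partial>\<mu>)\<bar> * (u n * P A) \<le> (\<delta> + C * \<eta>) * (u n * P A)\<close> by simp
      qed
      have "\<bar>?f - u n * (\<integral>z. f z \<partial>\<mu>) * P A\<bar> \<le>
        (\<delta> * (u n * P A) + C * (2 * \<eta> * u n * P A)) + C * \<eta> * u n * P A + (\<delta> + C * \<eta>) * (u n * P A)"
        using 1 2 3 by linarith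
      also have "\<dots> = (2 * \<delta> + 4 * (C * \<eta>)) * (u n * P A)" by (simp add: algebra_simps)
      also have "2 * \<delta> + 4 * (C * \<eta>) = e" using C by (simp add: \<delta>_def \<eta>_def)
      finally show "\<bar>?f - u n * (\<integral>z. f z \<partial>\<mu>) * P A\<bar> \<le> e * u n * P A" by (simp add: mult.assoc)
    qed
  qed
qed

lemma cyl_dist: "z \<in> cyl w \<Longrightarrow> z' \<in> cyl w \<Longrightarrow> dist z z' \<le> \<theta> ^ length w * diameter D"
proof (induction w arbitrary: z z')
  case Nil
  then show ?case using diameter_bounded_bound[OF D_bounded] by simp
next
  case (Cons i w)
  have "dist z z' \<le> \<theta> * dist ((S ^^ \<tau> i) z) ((S ^^ \<tau> i) z')"
    using Cons.prems by (intro contraction) auto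
  also have "\<dots> \<le> \<theta> * (\<theta> ^ length w * diameter D)"
    using Cons \<theta> by (intro mult_left_mono Cons.IH) (auto simp: pre_def)
  finally show ?case by simp
qed

lemma cyl_dist_small:
  assumes "0 < \<delta>"
  obtains m where "\<And>w z z'. length w = m \<Longrightarrow> z \<in> cyl w \<Longrightarrow> z' \<in> cyl w \<Longrightarrow> dist z z' \<le> \<delta>"
proof -
  have "(\<lambda>m. \<theta> ^ m * diameter D) \<longlonglongrightarrow> 0 * diameter D"
    using \<theta> by (intro tendsto_intros LIMSEQ_realpow_zero) auto
  then have "\<forall>\<^sub>F m in sequentially. \<theta> ^ m * diameter D < \<delta>"
    using assms by (intro order_tendstoD(2)) auto
  then obtain m where "\<theta> ^ m * diameter D < \<delta>" by (auto simp: eventually_sequentially)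
  then show ?thesis using cyl_dist by (intro that[of m]) (meson less_imp_le order_trans)
qed

end

section \<open>The invariant measure, built from excursions outside \<open>D\<close>, and its
  uniqueness\<close>

context affine_return_system
begin

declare One_nat_def [simp del]

lemma funpow_1 [simp]: "(f :: 'b \<Rightarrow> 'b) ^^ 1 = f"
  unfolding One_nat_def by simp

definition entry :: "nat \<Rightarrow> 'a set \<Rightarrow> 'a set" where
  "entry j A = {w \<in> space M. (\<forall>l<j. (S ^^ l) w \<notin> D) \<and> (S ^^ j) w \<in> A}"

lemma entry_sets [measurable]: "A \<in> sets M \<Longrightarrow> entry j A \<in> sets M"
proof -
  assume A: "A \<in> sets M"
  have "entry j A = (space M - (\<Union>l\<in>{..<j}. pre l D)) \<inter> pre j A"
    by (auto simp: entry_def pre_def)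
  then show ?thesis using A by (auto intro!: sets.finite_UN)
qed

lemma entry_0: "A \<in> sets M \<Longrightarrow> entry 0 A = A"
  using sets.sets_into_space by (auto simp: entry_def)

lemma entry_Suc: "entry (Suc j) A = (space M - D) \<inter> pre 1 (entry j A)"
proof -
  have "(\<forall>l<Suc j. (S ^^ l) w \<notin> D) \<longleftrightarrow> w \<notin> D \<and> (\<forall>l<j. (S ^^ l) (S w) \<notin> D)" for w
    unfolding All_less_Suc2 by (simp add: funpow_swap1)
  then show ?thesis using S_space[of _ 1] by (auto simp: entry_def pre_def funpow_swap1)
qed

lemma entry_entry_D: "entry n (entry k D) = entry (n + k) D"
  by (induction n) (simp_all add: entry_0 entry_Suc)

lemma entry_mono: "A \<subseteq> C \<Longrightarrow> entry j A \<subseteq> entry j C"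
  by (auto simp: entry_def)

lemma entry_null: "N \<in> null_sets M \<Longrightarrow> entry j N \<in> null_sets M"
proof (induction j)
  case 0
  then show ?case by (simp add: entry_0 null_setsD2)
next
  case (Suc j)
  then have "pre 1 (entry j N) \<in> null_sets M" using nonsingular by (simp add: pre_def)
  then show ?case unfolding entry_Suc by (rule null_sets_subset) (use Suc.prems in \<open>auto dest: null_setsD2\<close>)
qed

lemma AE_entrance: "AE z in M. \<exists>k. z \<in> entry k D"
  using enters AE_space
proof eventually_elim
  case (elim z)
  define k where "k = (LEAST k. (S ^^ k) z \<in> D)"
  have "(S ^^ k) z \<in> D" unfolding k_def using elim(1) by (rule LeastI_ex)
  moreover have "(S ^^ l) z \<notin> D" if "l < k" for l using not_less_Least that unfolding k_def by blast
  ultimately show ?case using elim(2) by (auto simp: entry_def)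
qed

lemma entry_disjoint: "disjoint_family (\<lambda>k. entry k D)"
  unfolding disjoint_family_on_def by (auto simp: entry_def) (metis linorder_neqE_nat)

lemma null_sets_\<mu>: "N \<in> null_sets M \<Longrightarrow> N \<in> null_sets \<mu>"
  unfolding \<mu>_def by (auto simp: null_sets_def emeasure_uniform_measure)
    (metis D_sets emeasure_mono inf_le2 le_zero_eq sets.Int)

text \<open>Up to null sets, \<open>G A\<close> is the preimage of \<open>A\<close> under the first-return map.\<close>

definition G :: "'a set \<Rightarrow> 'a set" where "G A = (\<Union>i. B i \<inter> pre (\<tau> i) A)"

lemma G_sets [measurable]: "A \<in> sets M \<Longrightarrow> G A \<in> sets M"
  unfolding G_def by (intro sets.countable_UN'') auto

lemma G_subset: "G A \<subseteq> D"
  using B_subset by (auto simp: G_def)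

text \<open>The orbit of \<open>S z\<close> meets \<open>D\<close> for the first time after
  \<open>\<tau> i - 1\<close> steps. As \<open>A\<close> lies in \<open>D\<close>, membership in
  \<open>entry j A\<close> fixes \<open>j\<close> to be that time.\<close>

lemma S_in_entry_iff:
  assumes z: "z \<in> B i" and A: "A \<subseteq> D"
  shows "S z \<in> entry j A \<longleftrightarrow> \<tau> i = Suc j \<and> (S ^^ \<tau> i) z \<in> A"
proof -
  have shift: "(S ^^ l) (S z) = (S ^^ Suc l) z" for l by (simp add: funpow_swap1)
  have sp: "S z \<in> space M" using S_space[of z 1] z B_D D_space by simp
  show ?thesis
  proof
    assume *: "S z \<in> entry j A"
    then have 1: "\<And>l. l < j \<Longrightarrow> (S ^^ Suc l) z \<notin> D" and 2: "(S ^^ Suc j) z \<in> A"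
      by (auto simp: entry_def shift)
    have "\<not> \<tau> i < Suc j"
    proof
      assume "\<tau> i < Suc j"
      then obtain l where "\<tau> i = Suc l" "l < j" using \<tau>_pos[of i] by (cases "\<tau> i") auto
      then show False using 1[of l] return[OF z] by simp
    qed
    moreover have "\<not> Suc j < \<tau> i" using no_return[OF z, of "Suc j"] 2 A by blast
    ultimately have "\<tau> i = Suc j" by simp
    then show "\<tau> i = Suc j \<and> (S ^^ \<tau> i) z \<in> A" using 2 by simp
  next
    assume *: "\<tau> i = Suc j \<and> (S ^^ \<tau> i) z \<in> A"
    then show "S z \<in> entry j A"
      using no_return[OF z] sp by (auto simp: entry_def shift simp del: funpow.simps)
  qed
qed

lemma pre_entry_AE_eq:
  assumes "z \<in> B i" "A \<subseteq> D"
  shows "z \<in> pre 1 (entry j A) \<longleftrightarrow> \<tau> i = Suc j \<and> z \<in> B i \<inter> pre (\<tau> i) A"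
  using S_in_entry_iff[OF assms, of j] assms(1) B_D D_space by (auto simp: pre_def)

text \<open>The point reached at the end of an excursion is distributed as \<open>\<mu>\<close>,
  independently of the length of the excursion; hence the product of the probability of that length
  and \<open>P A\<close>.\<close>

lemma P_pre_entry:
  assumes "A \<in> sets M" "A \<subseteq> D"
  shows "P (pre 1 (entry j A)) = q (Suc j) * P A"
proof -
  have fin: "finite {i. \<tau> i = Suc j}" by (rule finite_subset[OF _ \<tau>_finite[of "Suc j"]]) auto
  have "P (pre 1 (entry j A)) = P (\<Union>i\<in>{i. \<tau> i = Suc j}. B i \<inter> pre (\<tau> i) A)"
  proof (rule \<mu>.finite_measure_eq_AE)
    show "AE z in \<mu>. z \<in> pre 1 (entry j A) \<longleftrightarrow> z \<in> (\<Union>i\<in>{i. \<tau> i = Suc j}. B i \<inter> pre (\<tau> i) A)"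
      using AE_\<mu>_B
    proof eventually_elim
      case (elim z)
      then obtain i where i: "z \<in> B i" by auto
      have "k = i" if "z \<in> B k" for k using B_disjoint that i by (auto simp: disjoint_family_on_def)
      then have "z \<in> (\<Union>i\<in>{i. \<tau> i = Suc j}. B i \<inter> pre (\<tau> i) A) \<longleftrightarrow> \<tau> i = Suc j \<and> z \<in> B i \<inter> pre (\<tau> i) A"
        using i by blast
      then show ?case unfolding pre_entry_AE_eq[OF i assms(2), of j] by (rule sym)
    qed
  qed (use assms fin in \<open>auto intro!: sets.finite_UN\<close>)
  also have "\<dots> = (\<Sum>i | \<tau> i = Suc j. P (B i \<inter> pre (\<tau> i) A))"
    using assms B_disjoint by (intro \<mu>.finite_measure_finite_Union fin) (auto simp: disjoint_family_on_def)
  also have "\<dots> = q (Suc j) * P A"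
    unfolding q_def sum_distrib_right by (intro sum.cong refl P_full_branch assms)
  finally show ?thesis .
qed

lemma q_sums: "(\<lambda>j. q (Suc j)) sums 1"
proof -
  have "(\<lambda>j. P (pre 1 (entry j D))) sums P (\<Union>j. pre 1 (entry j D))"
    by (intro \<mu>.finite_measure_UNION) (use entry_disjoint in \<open>auto simp: disjoint_family_on_def pre_def\<close>)
  moreover have "P (\<Union>j. pre 1 (entry j D)) = 1"
  proof (subst \<mu>.prob_eq_1)
    show "AE z in \<mu>. z \<in> (\<Union>j. pre 1 (entry j D))"
      using AE_\<mu>_B
    proof eventually_elim
      case (elim z)
      then obtain i where i: "z \<in> B i" by auto
      obtain j where j: "\<tau> i = Suc j" using \<tau>_pos[of i] by (cases "\<tau> i") auto
      have "z \<in> pre 1 (entry j D)"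
        unfolding pre_entry_AE_eq[OF i order_refl] using i j return[OF i] B_D D_space by (auto simp: pre_def)
      then show ?case by blast
    qed
  qed auto
  ultimately show ?thesis by (simp add: P_pre_entry P_D)
qed

text \<open>Kac's formula: the mean number of visits to \<open>A\<close> at the times from 1 to the
  return time. The term of index \<open>j\<close> belongs to the time \<open>j + 1\<close>.\<close>

definition \<nu>_fun :: "'a set \<Rightarrow> ennreal" where
  "\<nu>_fun A = (\<Sum>j. emeasure \<mu> (pre 1 (entry j A)))"

definition \<nu> :: "'a measure" where "\<nu> = measure_of (space M) (sets M) \<nu>_fun"

lemma sets_\<nu> [simp, measurable_cong]: "sets \<nu> = sets M" and space_\<nu> [simp]: "space \<nu> = space M"
  by (simp_all add: \<nu>_def)

lemma emeasure_\<nu>: "A \<in> sets M \<Longrightarrow> emeasure \<nu> A = \<nu>_fun A"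
  unfolding \<nu>_def
proof (rule emeasure_measure_of_sigma)
  show "sigma_algebra (space M) (sets M)" by (rule sets.sigma_algebra_axioms)
  show "positive (sets M) \<nu>_fun" by (simp add: positive_def \<nu>_fun_def entry_def pre_def)
  show "countably_additive (sets M) \<nu>_fun"
  proof (rule countably_additiveI)
    fix X :: "nat \<Rightarrow> 'a set" assume X: "range X \<subseteq> sets M" "disjoint_family X"
    have "(\<Sum>i. \<nu>_fun (X i)) = (\<Sum>i. \<integral>\<^sup>+j. emeasure \<mu> (pre 1 (entry j (X i))) \<partial>count_space UNIV)"
      by (simp add: \<nu>_fun_def nn_integral_count_space_nat)
    also have "\<dots> = (\<integral>\<^sup>+j. (\<Sum>i. emeasure \<mu> (pre 1 (entry j (X i)))) \<partial>count_space UNIV)"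
      by (intro nn_integral_suminf[symmetric]) simp
    also have "\<dots> = (\<integral>\<^sup>+j. emeasure \<mu> (pre 1 (entry j (\<Union>i. X i))) \<partial>count_space UNIV)"
    proof (rule nn_integral_cong)
      fix j
      have "(\<Sum>i. emeasure \<mu> (pre 1 (entry j (X i)))) = emeasure \<mu> (\<Union>i. pre 1 (entry j (X i)))"
        using X by (intro suminf_emeasure) (auto simp: disjoint_family_on_def pre_def entry_def)
      also have "(\<Union>i. pre 1 (entry j (X i))) = pre 1 (entry j (\<Union>i. X i))" by (auto simp: pre_def entry_def)
      finally show "(\<Sum>i. emeasure \<mu> (pre 1 (entry j (X i)))) = emeasure \<mu> (pre 1 (entry j (\<Union>i. X i)))" .
    qed
    also have "\<dots> = \<nu>_fun (\<Union>i. X i)" by (simp add: \<nu>_fun_def nn_integral_count_space_nat)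
    finally show "(\<Sum>i. \<nu>_fun (X i)) = \<nu>_fun (\<Union>i. X i)" .
  qed
qed

lemma \<nu>_D: "A \<in> sets M \<Longrightarrow> A \<subseteq> D \<Longrightarrow> emeasure \<nu> A = ennreal (P A)"
proof -
  assume A: "A \<in> sets M" "A \<subseteq> D"
  have "emeasure \<nu> A = (\<Sum>j. ennreal (q (Suc j) * P A))"
    using A by (simp add: emeasure_\<nu> \<nu>_fun_def \<mu>.emeasure_eq_measure P_pre_entry del: One_nat_def)
  also have "\<dots> = ennreal (1 * P A)"
    using q_sums by (intro suminf_ennreal_eq sums_mult2) (auto simp: q_def intro!: mult_nonneg_nonneg sum_nonneg)
  finally show ?thesis by simp
qed

text \<open>A point of \<open>entry j (pre 1 A)\<close> is at time \<open>j\<close> either outside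
  \<open>D\<close>, and then lies in \<open>entry (Suc j) A\<close>, or in \<open>D\<close>. The
  second kind adds up to \<open>P (pre 1 A)\<close>, which is the missing term of index 0.\<close>

lemma \<nu>_invariant: "A \<in> sets M \<Longrightarrow> emeasure \<nu> (pre 1 A) = emeasure \<nu> A"
proof -
  assume A: "A \<in> sets M"
  have entry_pre: "entry j (pre 1 A) = entry (Suc j) A \<union> entry j (D \<inter> pre 1 A)" for j
    by (auto simp: entry_def pre_def S_space less_Suc_eq funpow_swap1)
  have disj: "entry (Suc j) A \<inter> entry j (D \<inter> pre 1 A) = {}" for j
    by (auto simp: entry_def)
  have "emeasure \<nu> (pre 1 A) = (\<Sum>j. emeasure \<mu> (pre 1 (entry (Suc j) A)) + emeasure \<mu> (pre 1 (entry j (D \<inter> pre 1 A))))"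
  proof -
    have "emeasure \<mu> (pre 1 (entry j (pre 1 A))) = emeasure \<mu> (pre 1 (entry (Suc j) A)) + emeasure \<mu> (pre 1 (entry j (D \<inter> pre 1 A)))" for j
    proof -
      have "pre 1 (entry j (pre 1 A)) = pre 1 (entry (Suc j) A) \<union> pre 1 (entry j (D \<inter> pre 1 A))"
        unfolding entry_pre by (auto simp: pre_def)
      moreover have "pre 1 (entry (Suc j) A) \<inter> pre 1 (entry j (D \<inter> pre 1 A)) = {}" using disj[of j] by (auto simp: pre_def)
      ultimately show ?thesis using A by (simp add: plus_emeasure del: One_nat_def)
    qed
    then show ?thesis using A by (simp add: emeasure_\<nu> \<nu>_fun_def del: One_nat_def)
  qed
  also have "\<dots> = (\<Sum>j. emeasure \<mu> (pre 1 (entry (Suc j) A))) + emeasure \<nu> (D \<inter> pre 1 A)"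
    using A by (simp add: suminf_add[symmetric] emeasure_\<nu> \<nu>_fun_def del: One_nat_def)
  also have "emeasure \<nu> (D \<inter> pre 1 A) = emeasure \<mu> (pre 1 (entry 0 A))"
    using A by (simp add: \<nu>_D entry_0 P_Int_D \<mu>.emeasure_eq_measure del: One_nat_def)
  also have "(\<Sum>j. emeasure \<mu> (pre 1 (entry (Suc j) A))) + emeasure \<mu> (pre 1 (entry 0 A)) = emeasure \<nu> A"
    using A suminf_offset[of "\<lambda>j. emeasure \<mu> (pre 1 (entry j A))" 1]
    by (simp add: emeasure_\<nu> \<nu>_fun_def add.commute lessThan_Suc One_nat_def)
  finally show ?thesis .
qed

lemma \<nu>_absolutely_continuous: "N \<in> null_sets M \<Longrightarrow> emeasure \<nu> N = 0"
proof -
  assume N: "N \<in> null_sets M"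
  have "emeasure \<mu> (pre 1 (entry j N)) = 0" for j
    using nonsingular[OF entry_null[OF N, of j]] null_sets_\<mu> by (auto simp: pre_def)
  then show ?thesis using N by (simp add: emeasure_\<nu> \<nu>_fun_def null_setsD2 del: One_nat_def)
qed

text \<open>Invariance is applied repeatedly to the part still outside \<open>D\<close>: its
  preimage splits into points of \<open>D\<close> and points that stay outside one step longer. The
  last term is the remainder, to be shown to vanish later.\<close>

lemma decomposition:
  assumes sets: "sets N = sets M" and inv: "\<And>A. A \<in> sets M \<Longrightarrow> emeasure N (pre 1 A) = emeasure N A"
    and A: "A \<in> sets M"
  shows "emeasure N A = (\<Sum>j<n. emeasure N (D \<inter> pre 1 (entry j A))) + emeasure N (entry n A)"
proof (induction n)
  case 0
  then show ?case using A by (simp add: entry_0)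
next
  case (Suc n)
  have "emeasure N (entry n A) = emeasure N (pre 1 (entry n A))" using A by (simp add: inv)
  also have "pre 1 (entry n A) = (D \<inter> pre 1 (entry n A)) \<union> entry (Suc n) A"
    by (auto simp: entry_Suc pre_def)
  also have "emeasure N \<dots> = emeasure N (D \<inter> pre 1 (entry n A)) + emeasure N (entry (Suc n) A)"
    using A by (intro plus_emeasure[symmetric]) (auto simp: sets entry_Suc)
  finally show ?case using Suc by (simp add: add.assoc)
qed

definition tail :: "nat \<Rightarrow> real" where "tail n = 1 - (\<Sum>j<n. q (Suc j))"

lemma q_nonneg: "0 \<le> q k"
  unfolding q_def by (intro sum_nonneg) simp

lemma tail_nonneg: "0 \<le> tail n"
  using sum_le_suminf[OF sums_summable[OF q_sums], of "{..<n}"] sums_unique[OF q_sums] q_nonneg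
  by (simp add: tail_def)

lemma \<nu>_D_1: "emeasure \<nu> D = 1" by (simp add: \<nu>_D P_D)

text \<open>By \<open>decomposition\<close> for \<open>D\<close> itself, level \<open>n\<close>
  carries the probability of a return taking more than \<open>n\<close> steps. A divergent sum of
  these tails is what makes \<open>\<nu>\<close> infinite.\<close>

lemma \<nu>_level: "emeasure \<nu> (entry n D) = ennreal (tail n)"
proof -
  have "1 = (\<Sum>j<n. emeasure \<nu> (D \<inter> pre 1 (entry j D))) + emeasure \<nu> (entry n D)"
    using decomposition[OF sets_\<nu> \<nu>_invariant D_sets, of n] by (simp add: \<nu>_D_1)
  also have "(\<Sum>j<n. emeasure \<nu> (D \<inter> pre 1 (entry j D))) = (\<Sum>j<n. ennreal (q (Suc j)))"
    by (intro sum.cong refl) (simp add: \<nu>_D P_Int_D P_pre_entry P_D)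
  also have "\<dots> = ennreal (\<Sum>j<n. q (Suc j))" by (intro sum_ennreal) (rule q_nonneg)
  finally have 1: "1 = ennreal (\<Sum>j<n. q (Suc j)) + emeasure \<nu> (entry n D)" .
  have "emeasure \<nu> (entry n D) = 1 - ennreal (\<Sum>j<n. q (Suc j))"
    unfolding 1 by (simp add: ennreal_add_diff_cancel_left)
  also have "\<dots> = ennreal (tail n)"
    using q_nonneg unfolding tail_def ennreal_1[symmetric] by (intro ennreal_minus sum_nonneg)
  finally show ?thesis .
qed

lemma AE_\<nu>: "AE z in M. Q z \<Longrightarrow> AE z in \<nu>. Q z"
  by (rule absolutely_continuous_AE[of \<nu> M])
    (auto simp: absolutely_continuous_def null_sets_def \<nu>_absolutely_continuous)

lemma \<nu>_sigma_finite: "sigma_finite_measure \<nu>"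
proof
  let ?Z = "space M - (\<Union>k. entry k D)"
  let ?A = "insert ?Z (range (\<lambda>k. entry k D))"
  have "AE z in \<nu>. z \<notin> ?Z" using AE_\<nu>[OF AE_entrance] by eventually_elim auto
  then have "?Z \<in> null_sets \<nu>"
    by (subst AE_iff_null_sets) auto
  then have "emeasure \<nu> ?Z = 0" by (rule null_setsD1)
  then have "emeasure \<nu> a \<noteq> \<infinity>" if "a \<in> ?A" for a
    using that by (elim insertE rangeE) (simp_all add: \<nu>_level)
  moreover have "\<Union>?A = space \<nu>" by (auto simp: entry_def)
  ultimately show "\<exists>A. countable A \<and> A \<subseteq> sets \<nu> \<and> \<Union>A = space \<nu> \<and> (\<forall>a\<in>A. emeasure \<nu> a \<noteq> \<infinity>)"
    by (intro exI[of _ ?A]) auto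
qed

lemma \<nu>_infinite: "\<not> summable tail \<Longrightarrow> emeasure \<nu> (space \<nu>) = \<infinity>"
proof -
  assume ns: "\<not> summable tail"
  have "(\<Sum>k. ennreal (tail k)) = emeasure \<nu> (\<Union>k. entry k D)"
    unfolding \<nu>_level[symmetric] by (intro suminf_emeasure entry_disjoint) auto
  moreover have "(\<Sum>k. ennreal (tail k)) = \<infinity>"
  proof (rule ccontr)
    assume "(\<Sum>k. ennreal (tail k)) \<noteq> \<infinity>"
    then have "(\<Sum>k. ennreal (tail k)) \<noteq> top" by simp
    then show False using ns summable_suminf_not_top[of tail] tail_nonneg by simp
  qed
  moreover have "emeasure \<nu> (\<Union>k. entry k D) \<le> emeasure \<nu> (space \<nu>)"
    by (intro emeasure_mono) (auto simp: entry_def)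
  ultimately show ?thesis by (simp add: top_unique)
qed

text \<open>Mixing of the first-return map: exact on cylinders, hence asymptotic on closed sets,
  on measurable sets and on integrable functions.\<close>

lemma G_funpow_sets: "A \<in> sets M \<Longrightarrow> (G ^^ m) A \<in> sets M"
  by (induction m) auto

lemma G_funpow_subset: "A \<subseteq> D \<Longrightarrow> (G ^^ m) A \<subseteq> D"
  using G_subset by (cases m) auto

lemma B_unique: "z \<in> B i \<Longrightarrow> z \<in> B j \<Longrightarrow> i = j"
  using disjoint_family_onD[OF B_disjoint UNIV_I UNIV_I, of i j] by blast

lemma G_iff: "z \<in> B i \<Longrightarrow> z \<in> G A \<longleftrightarrow> z \<in> pre (\<tau> i) A"
  unfolding G_def using B_unique by blast

text \<open>On a cylinder the return number \<open>length w\<close> takes place at the fixed time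
  \<open>time w\<close>.\<close>

lemma cyl_Int_G: "A \<in> sets M \<Longrightarrow> cyl w \<inter> (G ^^ length w) A = cyl w \<inter> pre (time w) A"
proof (induction w)
  case Nil
  then show ?case by (simp add: pre_0)
next
  case (Cons i w)
  have "cyl (i # w) \<inter> (G ^^ length (i # w)) A = B i \<inter> pre (\<tau> i) (cyl w) \<inter> pre (\<tau> i) ((G ^^ length w) A)"
    using G_iff[of _ i "(G ^^ length w) A"] by auto
  also have "\<dots> = B i \<inter> pre (\<tau> i) (cyl w \<inter> (G ^^ length w) A)" by (auto simp: pre_def)
  also have "\<dots> = cyl (i # w) \<inter> pre (time (i # w)) A"
    unfolding Cons.IH[OF Cons.prems] by (simp flip: pre_pre) (auto simp: pre_def)
  finally show ?case .
qed

text \<open>Independence is exact on each cylinder. Finite subfamilies, cut off by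
  \<open>time\<close>, exhaust the family \<open>V\<close>, and monotone limits carry the identity
  over.\<close>

lemma P_cyls_G:
  assumes A: "A \<in> sets M" "A \<subseteq> D" and V: "V \<subseteq> {w. length w = m}"
  shows "P ((\<Union>w\<in>V. cyl w) \<inter> (G ^^ m) A) = P (\<Union>w\<in>V. cyl w) * P A"
proof -
  define F where "F K = V \<inter> short_cyls m K" for K
  have F: "finite (F K)" "F K \<subseteq> {w. length w = m}" for K
    using finite_short_cyls[of m K] V by (auto simp: F_def)
  have UF: "(\<Union>K. (\<Union>w\<in>F K. cyl w)) = (\<Union>w\<in>V. cyl w)"
    using V by (auto simp: F_def short_cyls_def)
  have l1: "(\<lambda>K. P (\<Union>w\<in>F K. cyl w)) \<longlonglongrightarrow> P (\<Union>w\<in>V. cyl w)"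
    unfolding UF[symmetric] using F(1)
    by (intro \<mu>.finite_Lim_measure_incseq) (auto simp: incseq_def F_def short_cyls_def intro!: sets.finite_UN)
  have l2: "(\<lambda>K. P ((\<Union>w\<in>F K. cyl w) \<inter> (G ^^ m) A)) \<longlonglongrightarrow> P (\<Union>K. (\<Union>w\<in>F K. cyl w) \<inter> (G ^^ m) A)"
    using F(1) G_funpow_sets[OF A(1)]
    by (intro \<mu>.finite_Lim_measure_incseq) (auto simp: incseq_def F_def short_cyls_def intro!: sets.finite_UN sets.Int)
  have "(\<Union>K. (\<Union>w\<in>F K. cyl w) \<inter> (G ^^ m) A) = (\<Union>w\<in>V. cyl w) \<inter> (G ^^ m) A"
    unfolding UF[symmetric] by blast
  moreover have "P ((\<Union>w\<in>F K. cyl w) \<inter> (G ^^ m) A) = P (\<Union>w\<in>F K. cyl w) * P A" for K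
  proof -
    have "P ((\<Union>w\<in>F K. cyl w) \<inter> (G ^^ m) A) = (\<Sum>w\<in>F K. P (cyl w \<inter> (G ^^ m) A))"
      by (rule P_UN_cyl[OF F(2,1) G_funpow_sets[OF A(1)]])
    also have "\<dots> = (\<Sum>w\<in>F K. P (cyl w) * P A)"
    proof (rule sum.cong[OF refl])
      fix w assume "w \<in> F K"
      then have "length w = m" using F(2) by auto
      then show "P (cyl w \<inter> (G ^^ m) A) = P (cyl w) * P A"
        using cyl_Int_G[OF A(1), of w] P_cyl_pre[OF A, of w] by simp
    qed
    also have "\<dots> = P ((\<Union>w\<in>F K. cyl w) \<inter> space M) * P A"
    proof -
      have "cyl w \<inter> space M = cyl w" for w by (simp add: Int_absorb2 sets.sets_into_space[OF cyl_sets])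
      then have "P ((\<Union>w\<in>F K. cyl w) \<inter> space M) = (\<Sum>w\<in>F K. P (cyl w))"
        using P_UN_cyl[OF F(2,1) sets.top] by simp
      then show ?thesis by (simp add: sum_distrib_right)
    qed
    also have "(\<Union>w\<in>F K. cyl w) \<inter> space M = (\<Union>w\<in>F K. cyl w)"
      using sets.sets_into_space[OF cyl_sets] by blast
    finally show ?thesis .
  qed
  ultimately have "(\<lambda>K. P (\<Union>w\<in>F K. cyl w) * P A) \<longlonglongrightarrow> P ((\<Union>w\<in>V. cyl w) \<inter> (G ^^ m) A)"
    using l2 by simp
  moreover have "(\<lambda>K. P (\<Union>w\<in>F K. cyl w) * P A) \<longlonglongrightarrow> P (\<Union>w\<in>V. cyl w) * P A"
    by (intro tendsto_intros l1)
  ultimately show ?thesis by (rule LIMSEQ_unique)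
qed

lemma AE_all_cyl: "AE z in \<mu>. \<forall>m. \<exists>w. length w = m \<and> z \<in> cyl w"
  using AE_cyl by (simp add: AE_all_countable)

text \<open>The union \<open>Y m\<close> of the cylinders of length \<open>m\<close> that meet
  \<open>K\<close> converges to \<open>K\<close> almost everywhere: a point off the closed set has
  positive distance from it, and the diameters shrink. For \<open>Y m\<close> independence is exact,
  and replacing it by \<open>K\<close> costs at most \<open>P (Y m) - P K\<close>.\<close>

lemma mixing_closed:
  assumes A: "A \<in> sets M" "A \<subseteq> D" and K: "K \<in> sets M" "K \<subseteq> D" "closed K"
  shows "(\<lambda>m. P (K \<inter> (G ^^ m) A)) \<longlonglongrightarrow> P K * P A"
proof -
  define V where "V m = {w. length w = m \<and> cyl w \<inter> K \<noteq> {}}" for m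
  define Y where "Y m = (\<Union>w\<in>V m. cyl w)" for m
  have Ysets [measurable]: "Y m \<in> sets M" for m unfolding Y_def by (intro sets.countable_UN') auto
  have KY: "AE z in \<mu>. z \<in> K \<longrightarrow> z \<in> Y m" for m
    using AE_all_cyl
  proof eventually_elim
    case (elim z)
    then obtain w where "length w = m" "z \<in> cyl w" by blast
    then show ?case by (auto simp: Y_def V_def)
  qed
  have lim: "(\<lambda>m. P (Y m)) \<longlonglongrightarrow> P K"
  proof -
    have "(\<lambda>m. \<integral>z. indicat_real (Y m) z \<partial>\<mu>) \<longlonglongrightarrow> (\<integral>z. indicat_real K z \<partial>\<mu>)"
    proof (rule integral_dominated_convergence[where w = "\<lambda>_. 1"])
      show "AE z in \<mu>. (\<lambda>m. indicat_real (Y m) z) \<longlonglongrightarrow> indicat_real K z"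
        using AE_all_cyl
      proof eventually_elim
        case (elim z)
        show ?case
        proof (cases "z \<in> K")
          case True
          have "z \<in> Y m" for m
          proof -
            obtain w where "length w = m" "z \<in> cyl w" using elim by blast
            then show ?thesis using True by (auto simp: Y_def V_def)
          qed
          then show ?thesis using True by simp
        next
          case False
          then have K': "z \<in> - K" "open (- K)" using K(3) by auto
          obtain e where e0: "e > 0" "ball z e \<subseteq> - K" by (rule openE[OF K'(2,1)])
          have e: "e \<le> dist z y" if "y \<in> K" for y
          proof -
            have "y \<notin> ball z e" using that e0(2) by blast
            then show "e \<le> dist z y" by (simp add: not_less)
          qed
          have "(\<lambda>m. \<theta> ^ m * diameter D) \<longlonglongrightarrow> 0 * diameter D"
            using \<theta> by (intro tendsto_intros LIMSEQ_realpow_zero) auto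
          then have "\<forall>\<^sub>F m in sequentially. \<theta> ^ m * diameter D < e"
            using e0(1) by (intro order_tendstoD(2)) auto
          then have "\<forall>\<^sub>F m in sequentially. indicat_real (Y m) z = indicat_real K z"
          proof eventually_elim
            case (elim m)
            have "z \<notin> Y m"
            proof
              assume "z \<in> Y m"
              then obtain w y where w: "length w = m" "z \<in> cyl w" "y \<in> cyl w" "y \<in> K" by (auto simp: Y_def V_def)
              then show False using cyl_dist[OF w(2,3)] e[OF w(4)] elim by simp
            qed
            then show ?case using False by simp
          qed
          then show ?thesis by (rule tendsto_eventually)
        qed
      qed
      show "AE z in \<mu>. norm (indicat_real (Y m) z) \<le> 1" for m
        by (intro AE_I2) (simp split: split_indicator)
      show "indicat_real K \<in> borel_measurable \<mu>" using K(1) by simp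
      show "indicat_real (Y m) \<in> borel_measurable \<mu>" for m using Ysets[of m] by simp
    qed simp
    then show ?thesis using K sets.sets_into_space[OF Ysets] sets.sets_into_space[OF K(1)] by (simp add: Int_absorb2)
  qed
  have bound: "P (Y m) * P A - (P (Y m) - P K) \<le> P (K \<inter> (G ^^ m) A)" "P (K \<inter> (G ^^ m) A) \<le> P (Y m) * P A" for m
  proof -
    let ?X = "(G ^^ m) A"
    have X [measurable]: "?X \<in> sets M" by (rule G_funpow_sets[OF A(1)])
    have eq: "P (Y m \<inter> ?X) = P (Y m) * P A"
      unfolding Y_def by (rule P_cyls_G[OF A]) (auto simp: V_def)
    show "P (K \<inter> ?X) \<le> P (Y m) * P A"
      unfolding eq[symmetric] using K(1) KY[of m] by (intro \<mu>.finite_measure_mono_AE) (auto elim!: eventually_mono)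
    have "P (Y m \<inter> ?X) \<le> P ((K \<inter> ?X) \<union> (Y m - K))"
      using K(1) by (intro \<mu>.finite_measure_mono) auto
    also have "\<dots> \<le> P (K \<inter> ?X) + P (Y m - K)"
      using K(1) by (intro measure_Un_le) auto
    also have "P (Y m - K) = P (Y m) - P (Y m \<inter> K)"
      using K(1) by (intro \<mu>.finite_measure_Diff') auto
    also have "P (Y m \<inter> K) = P K"
      using K(1) KY[of m] by (intro \<mu>.finite_measure_eq_AE) (auto elim!: eventually_mono)
    finally show "P (Y m) * P A - (P (Y m) - P K) \<le> P (K \<inter> ?X)" using eq by simp
  qed
  show ?thesis
  proof (rule tendsto_sandwich[of "\<lambda>m. P (Y m) * P A - (P (Y m) - P K)" _ _ "\<lambda>m. P (Y m) * P A"])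
    have "(\<lambda>m. P (Y m) * P A - (P (Y m) - P K)) \<longlonglongrightarrow> P K * P A - (P K - P K)"
      by (intro tendsto_intros lim)
    then show "(\<lambda>m. P (Y m) * P A - (P (Y m) - P K)) \<longlonglongrightarrow> P K * P A" by simp
    show "(\<lambda>m. P (Y m) * P A) \<longlonglongrightarrow> P K * P A" by (intro tendsto_intros lim)
  qed (use bound in auto)
qed

lemma mixing_set:
  assumes A: "A \<in> sets M" "A \<subseteq> D" and X: "X \<in> sets M"
  shows "(\<lambda>m. P (X \<inter> (G ^^ m) A)) \<longlonglongrightarrow> P X * P A"
proof (rule LIMSEQ_I)
  fix e :: real assume e: "0 < e"
  obtain K where K: "K \<in> sets M" "K \<subseteq> D \<inter> X" "closed K" "P (D \<inter> X) < P K + e / 3"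
    using inner_closed[of "D \<inter> X" "e / 3"] e X unfolding \<mu>_def[symmetric] by auto
  have PX: "P X < P K + e / 3" using K(4) X by (simp add: P_Int_D)
  have KX: "K \<subseteq> X" using K(2) by auto
  have PKX: "P K \<le> P X" using X KX by (intro \<mu>.finite_measure_mono) auto
  obtain no where no: "\<And>m. m \<ge> no \<Longrightarrow> \<bar>P (K \<inter> (G ^^ m) A) - P K * P A\<bar> < e / 3"
    using LIMSEQ_D[OF mixing_closed[OF A K(1) _ K(3)], of "e / 3"] e K(2) by auto
  show "\<exists>no. \<forall>m\<ge>no. norm (P (X \<inter> (G ^^ m) A) - P X * P A) < e"
  proof (intro exI[of _ no] allI impI)
    fix m assume m: "no \<le> m"
    let ?G = "(G ^^ m) A"
    have G: "?G \<in> sets M" by (rule G_funpow_sets[OF A(1)])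
    have 1: "P (K \<inter> ?G) \<le> P (X \<inter> ?G)" using X G KX by (intro \<mu>.finite_measure_mono) auto
    have "P (X \<inter> ?G) \<le> P ((K \<inter> ?G) \<union> (X - K))" using X K(1) G by (intro \<mu>.finite_measure_mono) auto
    also have "\<dots> \<le> P (K \<inter> ?G) + P (X - K)" using X K(1) G by (intro measure_Un_le) auto
    also have "P (X - K) = P X - P K" using X K(1) KX by (intro \<mu>.finite_measure_Diff) auto
    finally have 2: "P (X \<inter> ?G) \<le> P (K \<inter> ?G) + (P X - P K)" .
    have "0 \<le> (P X - P K) * P A" "(P X - P K) * P A \<le> P X - P K"
      using PKX by (auto intro!: mult_left_le mult_nonneg_nonneg simp: \<mu>.prob_le_1)
    then have "\<bar>P X * P A - P K * P A\<bar> < e / 3" using PX by (simp add: left_diff_distrib)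
    then show "norm (P (X \<inter> ?G) - P X * P A) < e"
      using 1 2 PX no[OF m] unfolding real_norm_def by linarith
  qed
qed

lemma mixing_integrable:
  fixes h :: "'a \<Rightarrow> real"
  assumes A: "A \<in> sets M" "A \<subseteq> D" and h: "integrable \<mu> h"
  shows "(\<lambda>m. \<integral>z. h z * indicator ((G ^^ m) A) z \<partial>\<mu>) \<longlonglongrightarrow> (\<integral>z. h z \<partial>\<mu>) * P A"
  using h
proof (induction rule: integrable_induct)
  case (base X c)
  have X: "X \<in> sets M" using base by simp
  have e1: "(\<integral>z. (indicat_real X z *\<^sub>R c) * indicator ((G ^^ m) A) z \<partial>\<mu>) = c * P (X \<inter> (G ^^ m) A)" for m
  proof -
    have "(\<integral>z. (indicat_real X z *\<^sub>R c) * indicator ((G ^^ m) A) z \<partial>\<mu>) = (\<integral>z. c * indicat_real (X \<inter> (G ^^ m) A) z \<partial>\<mu>)"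
      by (intro Bochner_Integration.integral_cong refl) (simp add: indicator_inter_arith)
    also have "\<dots> = c * P (X \<inter> (G ^^ m) A)"
      using sets.sets_into_space[OF X] by (simp add: Int_absorb2 le_infI1)
    finally show ?thesis .
  qed
  have l: "(\<lambda>m. c * P (X \<inter> (G ^^ m) A)) \<longlonglongrightarrow> c * (P X * P A)"
    by (intro tendsto_intros mixing_set A X)
  have e2: "(\<integral>z. indicat_real X z *\<^sub>R c \<partial>\<mu>) = c * P X"
    using sets.sets_into_space[OF X] by (simp add: Int_absorb2)
  show ?case unfolding e1 e2 using l by (simp only: mult.assoc)
next
  case (add f g)
  have i: "integrable \<mu> (\<lambda>z. k z * indicator ((G ^^ m) A) z)" if "integrable \<mu> k" for k :: "'a \<Rightarrow> real" and m
    using integrable_mult_indicator[OF _ that, of "(G ^^ m) A"] G_funpow_sets[OF A(1)] by (simp add: mult.commute)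
  show ?case
    using tendsto_add[OF add.IH] i add.hyps by (simp add: distrib_right)
next
  case (lim f s)
  have [measurable]: "f \<in> borel_measurable \<mu>" "\<And>i. s i \<in> borel_measurable \<mu>" using lim by auto
  have [measurable]: "(G ^^ m) A \<in> sets M" for m by (rule G_funpow_sets[OF A(1)])
  have i: "integrable \<mu> (\<lambda>z. k z * indicator ((G ^^ m) A) z)" if "integrable \<mu> k" for k :: "'a \<Rightarrow> real" and m
    using integrable_mult_indicator[OF _ that, of "(G ^^ m) A"] by (simp add: mult.commute)
  have L1: "(\<lambda>i. \<integral>z. \<bar>s i z - f z\<bar> \<partial>\<mu>) \<longlonglongrightarrow> 0"
  proof -
    have "(\<lambda>i. \<integral>z. \<bar>s i z - f z\<bar> \<partial>\<mu>) \<longlonglongrightarrow> (\<integral>z. 0 \<partial>\<mu>)"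
    proof (rule integral_dominated_convergence[where w = "\<lambda>z. 3 * \<bar>f z\<bar>"])
      show "AE z in \<mu>. (\<lambda>i. \<bar>s i z - f z\<bar>) \<longlonglongrightarrow> 0"
      proof (rule AE_I2)
        fix z assume "z \<in> space \<mu>"
        then have "(\<lambda>i. s i z) \<longlonglongrightarrow> f z" using lim by auto
        then have "(\<lambda>i. \<bar>s i z - f z\<bar>) \<longlonglongrightarrow> \<bar>f z - f z\<bar>" by (intro tendsto_intros)
        then show "(\<lambda>i. \<bar>s i z - f z\<bar>) \<longlonglongrightarrow> 0" by simp
      qed
      show "AE z in \<mu>. norm \<bar>s i z - f z\<bar> \<le> 3 * \<bar>f z\<bar>" for i
      proof (rule AE_I2)
        fix z assume "z \<in> space \<mu>"
        then have "\<bar>s i z\<bar> \<le> 2 * \<bar>f z\<bar>" using lim by auto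
        then show "norm \<bar>s i z - f z\<bar> \<le> 3 * \<bar>f z\<bar>" by simp
      qed
    qed (use lim in auto)
    then show ?thesis by simp
  qed
  have close: "\<bar>(\<integral>z. f z * indicator Y z \<partial>\<mu>) - (\<integral>z. s i z * indicator Y z \<partial>\<mu>)\<bar> \<le> (\<integral>z. \<bar>s i z - f z\<bar> \<partial>\<mu>)"
    if [measurable]: "Y \<in> sets M" for Y i
  proof -
    have ii: "integrable \<mu> (\<lambda>z. k z * indicator Y z)" if "integrable \<mu> k" for k :: "'a \<Rightarrow> real"
      using integrable_mult_indicator[OF _ that, of Y] by (simp add: mult.commute)
    have "\<bar>(\<integral>z. f z * indicator Y z \<partial>\<mu>) - (\<integral>z. s i z * indicator Y z \<partial>\<mu>)\<bar> = \<bar>\<integral>z. f z * indicator Y z - s i z * indicator Y z \<partial>\<mu>\<bar>"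
      using ii lim by simp
    also have "\<dots> \<le> (\<integral>z. \<bar>f z * indicator Y z - s i z * indicator Y z\<bar> \<partial>\<mu>)" by (rule integral_abs_bound)
    also have "\<dots> \<le> (\<integral>z. \<bar>s i z - f z\<bar> \<partial>\<mu>)"
      using ii lim by (intro integral_mono) (auto simp: indicator_def)
    finally show ?thesis .
  qed
  show ?case
  proof (rule LIMSEQ_I)
    fix e :: real assume e: "0 < e"
    obtain i where i1: "(\<integral>z. \<bar>s i z - f z\<bar> \<partial>\<mu>) < e / 3"
      using order_tendstoD(2)[OF L1, of "e / 3"] e by (auto simp: eventually_sequentially)
    obtain no where no: "\<And>m. m \<ge> no \<Longrightarrow> \<bar>(\<integral>z. s i z * indicator ((G ^^ m) A) z \<partial>\<mu>) - (\<integral>z. s i z \<partial>\<mu>) * P A\<bar> < e / 3"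
      using LIMSEQ_D[OF lim.IH[of i], of "e / 3"] e by auto
    have "(\<integral>z. k z * indicator (space M) z \<partial>\<mu>) = (\<integral>z. k z \<partial>\<mu>)" for k :: "'a \<Rightarrow> real"
      by (intro Bochner_Integration.integral_cong refl) simp
    then have "\<bar>(\<integral>z. f z \<partial>\<mu>) - (\<integral>z. s i z \<partial>\<mu>)\<bar> \<le> (\<integral>z. \<bar>s i z - f z\<bar> \<partial>\<mu>)"
      using close[OF sets.top, of i] by simp
    then have "\<bar>(\<integral>z. f z \<partial>\<mu>) - (\<integral>z. s i z \<partial>\<mu>)\<bar> * P A \<le> (\<integral>z. \<bar>s i z - f z\<bar> \<partial>\<mu>) * 1"
      by (intro mult_mono) (auto simp: \<mu>.prob_le_1)
    moreover have "\<bar>(\<integral>z. f z \<partial>\<mu>) - (\<integral>z. s i z \<partial>\<mu>)\<bar> * P A = \<bar>(\<integral>z. f z \<partial>\<mu>) * P A - (\<integral>z. s i z \<partial>\<mu>) * P A\<bar>"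
      by (simp add: abs_mult flip: left_diff_distrib)
    ultimately have 1: "\<bar>(\<integral>z. f z \<partial>\<mu>) * P A - (\<integral>z. s i z \<partial>\<mu>) * P A\<bar> < e / 3" using i1 by simp
    show "\<exists>no. \<forall>m\<ge>no. norm ((\<integral>z. f z * indicator ((G ^^ m) A) z \<partial>\<mu>) - (\<integral>z. f z \<partial>\<mu>) * P A) < e"
    proof (intro exI[of _ no] allI impI)
      fix m assume "no \<le> m"
      from no[OF this] close[OF G_funpow_sets[OF A(1), of m], of i] 1 i1
      show "norm ((\<integral>z. f z * indicator ((G ^^ m) A) z \<partial>\<mu>) - (\<integral>z. f z \<partial>\<mu>) * P A) < e"
        unfolding real_norm_def by linarith
    qed
  qed
qed

text \<open>Confining \<open>A\<close> to level \<open>k\<close> bounds the remainder of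
  \<open>decomposition\<close> by the mass of level \<open>n + k\<close>. The level masses tend to 0
  because \<open>emeasure N D = 1\<close> and almost every point of \<open>D\<close>
  returns.\<close>

lemma level_formula:
  assumes sets: "sets N = sets M" and inv: "\<And>A. A \<in> sets M \<Longrightarrow> emeasure N (pre 1 A) = emeasure N A"
    and ac: "absolutely_continuous M N" and ND: "emeasure N D = 1"
    and A: "A \<in> sets M" "A \<subseteq> entry k D"
  shows "(\<lambda>j. emeasure N (D \<inter> pre 1 (entry j A))) sums emeasure N A"
proof -
  have AE_N: "AE z in N. Q z" if "AE z in M. Q z" for Q
    by (rule absolutely_continuous_AE[OF sets ac that])
  have AE_S: "AE z in M. \<exists>k. S z \<in> entry k D"
  proof -
    let ?Z = "space M - (\<Union>k. entry k D)"
    have "AE z in M. z \<notin> ?Z" using AE_entrance by eventually_elim auto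
    then have "?Z \<in> null_sets M" by (subst AE_iff_null_sets) auto
    then have "S -` ?Z \<inter> space M \<in> null_sets M" by (rule nonsingular)
    then have "AE z in M. z \<notin> S -` ?Z \<inter> space M" by (rule AE_not_in)
    then show ?thesis using AE_space
      by eventually_elim (use measurable_space[OF S_measurable] in auto)
  qed
  have level_lim: "(\<lambda>n. emeasure N (entry n D)) \<longlonglongrightarrow> 0"
  proof -
    let ?s = "\<lambda>n. \<Sum>j<n. emeasure N (D \<inter> pre 1 (entry j D))"
    have "(\<lambda>j. emeasure N (D \<inter> pre 1 (entry j D))) sums emeasure N (\<Union>j. D \<inter> pre 1 (entry j D))"
      using entry_disjoint by (intro sums_emeasure) (auto simp: disjoint_family_on_def pre_def sets)
    also have "emeasure N (\<Union>j. D \<inter> pre 1 (entry j D)) = emeasure N D"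
    proof (rule emeasure_eq_AE)
      show "AE z in N. z \<in> (\<Union>j. D \<inter> pre 1 (entry j D)) \<longleftrightarrow> z \<in> D"
        using AE_N[OF AE_S] by eventually_elim (use D_space in \<open>auto simp: pre_def\<close>)
    qed (auto simp: sets)
    finally have s: "?s \<longlonglongrightarrow> 1" by (simp add: ND sums_def)
    have dec: "1 = ?s n + emeasure N (entry n D)" for n
      using decomposition[OF sets inv D_sets, of n] by (simp add: ND)
    have "emeasure N (entry n D) = 1 - ?s n" for n
    proof -
      have "?s n \<le> ?s n + emeasure N (entry n D)" by simp
      then have "?s n \<le> 1" using dec[of n] by simp
      then have "?s n \<noteq> top" by (rule neq_top_trans[OF ennreal_one_neq_top])
      then show ?thesis using dec[of n] by (metis ennreal_add_diff_cancel_left)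
    qed
    moreover have "(\<lambda>n. 1 - ?s n) \<longlonglongrightarrow> 1 - 1" by (intro tendsto_diff_ennreal s tendsto_const) auto
    ultimately show ?thesis by simp
  qed
  show ?thesis
  proof -
    let ?s = "\<lambda>n. \<Sum>j<n. emeasure N (D \<inter> pre 1 (entry j A))"
    have "(\<lambda>n. emeasure N (entry n A)) \<longlonglongrightarrow> 0"
    proof (rule tendsto_sandwich[OF _ _ tendsto_const])
      show "(\<lambda>n. emeasure N (entry (n + k) D)) \<longlonglongrightarrow> 0" by (rule LIMSEQ_ignore_initial_segment[OF level_lim])
      have "entry n A \<subseteq> entry (n + k) D" for n
        unfolding entry_entry_D[symmetric] by (rule entry_mono[OF A(2)])
      then show "\<forall>\<^sub>F n in sequentially. emeasure N (entry n A) \<le> emeasure N (entry (n + k) D)"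
        using A by (intro always_eventually allI emeasure_mono) (auto simp: sets)
    qed auto
    moreover have sm: "?s \<longlonglongrightarrow> (\<Sum>j. emeasure N (D \<inter> pre 1 (entry j A)))"
      using summable_LIMSEQ[of "\<lambda>j. emeasure N (D \<inter> pre 1 (entry j A))"] by simp
    ultimately have "(\<lambda>n. ?s n + emeasure N (entry n A)) \<longlonglongrightarrow> (\<Sum>j. emeasure N (D \<inter> pre 1 (entry j A))) + 0"
      by (intro tendsto_add)
    then have "(\<lambda>n::nat. emeasure N A) \<longlonglongrightarrow> (\<Sum>j. emeasure N (D \<inter> pre 1 (entry j A)))"
      using decomposition[OF sets inv A(1)] by simp
    then have "emeasure N A = (\<Sum>j. emeasure N (D \<inter> pre 1 (entry j A)))"
      by (simp add: LIMSEQ_const_iff)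
    then show ?thesis using sm by (simp add: sums_def)
  qed
qed

text \<open>Invariance under the return map keeps the mass of \<open>(G ^^ m) A\<close> constant in
  \<open>m\<close>. In terms of the density \<open>h\<close> of \<open>N\<close> on \<open>D\<close>
  it is the integral of \<open>h\<close> over that set, which by mixing tends to the integral of
  \<open>h\<close>, that is 1, times \<open>P A\<close>.\<close>

lemma invariant_measure_on_D:
  assumes sets: "sets N = sets M" and inv: "\<And>A. A \<in> sets M \<Longrightarrow> emeasure N (pre 1 A) = emeasure N A"
    and ac: "absolutely_continuous M N" and ND: "emeasure N D = 1"
    and A: "A \<in> sets M" "A \<subseteq> D"
  shows "emeasure N A = ennreal (P A)"
proof -
  have AE_N: "AE z in N. Q z" if "AE z in M. Q z" for Q
    by (rule absolutely_continuous_AE[OF sets ac that])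
  \<comment> \<open>A subset of \<open>D\<close> that is null for \<open>\<mu>\<close> is null for
    \<open>M\<close>, so the branches also cover \<open>D\<close> up to a null set of
    \<open>N\<close>.\<close>
  have AE_B: "AE z in M. z \<in> D \<longrightarrow> z \<in> (\<Union>i. B i)"
  proof -
    let ?X = "D - (\<Union>i. B i)"
    have X: "?X \<in> sets M" by (intro sets.Diff sets.countable_UN'') auto
    have "AE z in \<mu>. z \<notin> ?X" using AE_\<mu>_B by eventually_elim auto
    then have "?X \<in> null_sets \<mu>" using X by (subst AE_iff_null_sets) auto
    then have "emeasure \<mu> ?X = 0" by (rule null_setsD1)
    then have "emeasure M (D \<inter> ?X) / emeasure M D = 0"
      unfolding \<mu>_def using X by (simp add: emeasure_uniform_measure)
    then have "emeasure M (D \<inter> ?X) = 0" using D_finite by (simp add: ennreal_divide_eq_0_iff)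
    then have "emeasure M ?X = 0" by (metis Diff_subset Int_absorb1)
    then have "?X \<in> null_sets M" using X by blast
    then have "AE z in M. z \<notin> ?X" by (rule AE_not_in)
    then show ?thesis by eventually_elim auto
  qed
  have step: "emeasure N A = emeasure N (G A)" if A: "A \<in> sets M" "A \<subseteq> D" for A
  proof -
    have "(\<lambda>j. emeasure N (D \<inter> pre 1 (entry j A))) sums emeasure N (\<Union>j. D \<inter> pre 1 (entry j A))"
    proof (rule sums_emeasure)
      show "disjoint_family (\<lambda>j. D \<inter> pre 1 (entry j A))"
        unfolding disjoint_family_on_def
      proof (intro ballI impI)
        fix m n :: nat assume "m \<noteq> n"
        then have "entry m D \<inter> entry n D = {}" using disjoint_family_onD[OF entry_disjoint] by blast
        then have "entry m A \<inter> entry n A = {}" using entry_mono[OF A(2), of m] entry_mono[OF A(2), of n] by blast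
        then show "D \<inter> pre 1 (entry m A) \<inter> (D \<inter> pre 1 (entry n A)) = {}" unfolding pre_def by blast
      qed
    qed (use A in \<open>auto simp: sets\<close>)
    also have "emeasure N (\<Union>j. D \<inter> pre 1 (entry j A)) = emeasure N (G A)"
    proof (rule emeasure_eq_AE)
      show "AE z in N. z \<in> (\<Union>j. D \<inter> pre 1 (entry j A)) \<longleftrightarrow> z \<in> G A"
        using AE_N[OF AE_B]
      proof eventually_elim
        case (elim z)
        show ?case
        proof (cases "z \<in> D")
          case True
          then obtain i where i: "z \<in> B i" using elim by auto
          obtain j where j: "\<tau> i = Suc j" using \<tau>_pos[of i] by (cases "\<tau> i") auto
          have "z \<in> (\<Union>j. D \<inter> pre 1 (entry j A)) \<longleftrightarrow> z \<in> pre (\<tau> i) A"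
            using pre_entry_AE_eq[OF i A(2)] i j True by blast
          then show ?thesis using G_iff[OF i] by simp
        next
          case False
          then show ?thesis using G_subset by blast
        qed
      qed
      show "(\<Union>j. D \<inter> pre 1 (entry j A)) \<in> sets N" "G A \<in> sets N"
        using A by (auto simp: sets)
    qed
    finally have "(\<lambda>j. emeasure N (D \<inter> pre 1 (entry j A))) sums emeasure N (G A)" .
    moreover have "A \<subseteq> entry 0 D" using A(2) by (simp add: entry_0)
    ultimately show ?thesis using level_formula[OF sets inv ac ND A(1)] sums_unique2 by blast
  qed
  show ?thesis
  proof -
    have iter: "emeasure N A = emeasure N ((G ^^ m) A)" for m
    proof (induction m)
      case (Suc m)
      then show ?case using step[of "(G ^^ m) A"] A G_funpow_sets G_funpow_subset by simp
    qed simp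
    define N' where "N' = density N (indicator D)"
    have N'_sets: "sets N' = sets \<mu>" by (simp add: N'_def sets)
    have N': "emeasure N' X = emeasure N (X \<inter> D)" if "X \<in> sets M" for X
      unfolding N'_def using that
      by (subst emeasure_restricted) (auto simp: sets Int_commute)
    have fin: "finite_measure N'"
    proof (rule finite_measureI)
      have "space N' \<in> sets M" using N'_sets by (metis sets.top sets_\<mu>)
      moreover have "space N' \<inter> D = D" using D_space N'_sets sets_eq_imp_space_eq[OF N'_sets] by auto
      ultimately show "emeasure N' (space N') \<noteq> \<infinity>" by (simp add: N' ND)
    qed
    have acN': "absolutely_continuous \<mu> N'"
      unfolding absolutely_continuous_def
    proof
      fix X assume X: "X \<in> null_sets \<mu>"
      then have Xs: "X \<in> sets M" by auto
      have "emeasure M (D \<inter> X) / emeasure M D = 0"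
        using X Xs unfolding \<mu>_def by (simp add: emeasure_uniform_measure null_sets_def)
      then have "emeasure M (D \<inter> X) = 0" using D_finite by (simp add: ennreal_divide_eq_0_iff)
      then have "D \<inter> X \<in> null_sets M" using Xs by (intro null_setsI) auto
      then have "D \<inter> X \<in> null_sets N" using ac unfolding absolutely_continuous_def by (rule subsetD[rotated])
      then have "emeasure N (D \<inter> X) = 0" by (rule null_setsD1)
      then have "emeasure N' X = 0" unfolding N'[OF Xs] by (simp only: Int_commute)
      then show "X \<in> null_sets N'" using Xs N'_sets by (intro null_setsI) simp_all
    qed
    obtain h where h: "h \<in> borel_measurable \<mu>" "AE x in \<mu>. RN_deriv \<mu> N' x = ennreal (h x)" "\<And>x. 0 \<le> h x"
      using \<mu>.real_RN_deriv[OF fin acN' N'_sets] by metis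
    have "density \<mu> (RN_deriv \<mu> N') = N'" by (rule \<mu>.density_RN_deriv[OF acN' N'_sets])
    moreover have "density \<mu> (RN_deriv \<mu> N') = density \<mu> (\<lambda>x. ennreal (h x))"
      using h by (intro density_cong) auto
    ultimately have dens: "N' = density \<mu> (\<lambda>x. ennreal (h x))" by simp
    have nn: "(\<integral>\<^sup>+z. ennreal (h z * indicator X z) \<partial>\<mu>) = emeasure N (X \<inter> D)" if X: "X \<in> sets M" for X
    proof -
      have "emeasure N' X = (\<integral>\<^sup>+z. ennreal (h z) * indicator X z \<partial>\<mu>)"
        unfolding dens using h X by (subst emeasure_density) auto
      also have "\<dots> = (\<integral>\<^sup>+z. ennreal (h z * indicator X z) \<partial>\<mu>)"
        by (intro nn_integral_cong) (auto simp: indicator_def)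
      finally show ?thesis using N'[OF X] by simp
    qed
    have h_int: "integrable \<mu> h"
    proof (rule integrableI_nonneg)
      have "(\<integral>\<^sup>+z. ennreal (h z) \<partial>\<mu>) = (\<integral>\<^sup>+z. ennreal (h z * indicator (space M) z) \<partial>\<mu>)"
        by (intro nn_integral_cong) simp
      also have "\<dots> = 1" using nn[OF sets.top] ND D_space by (metis Int_absorb1 subsetI)
      finally show "(\<integral>\<^sup>+z. ennreal (h z) \<partial>\<mu>) < \<infinity>" by simp
    qed (use h in auto)
    have int: "ennreal (\<integral>z. h z * indicator X z \<partial>\<mu>) = emeasure N (X \<inter> D)" if X: "X \<in> sets M" for X
    proof -
      have "integrable \<mu> (\<lambda>z. h z * indicator X z)"
        using integrable_mult_indicator[OF _ h_int, of X] X by (simp add: mult.commute)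
      then have "(\<integral>\<^sup>+z. ennreal (h z * indicator X z) \<partial>\<mu>) = ennreal (\<integral>z. h z * indicator X z \<partial>\<mu>)"
        using h by (intro nn_integral_eq_integral) auto
      then show ?thesis using nn[OF X] by simp
    qed
    have h1: "(\<integral>z. h z \<partial>\<mu>) = 1"
    proof -
      have "(\<integral>z. h z \<partial>\<mu>) = (\<integral>z. h z * indicator (space M) z \<partial>\<mu>)"
        by (intro Bochner_Integration.integral_cong refl) simp
      moreover have "ennreal (\<integral>z. h z * indicator (space M) z \<partial>\<mu>) = 1"
        using int[OF sets.top] ND D_space by (metis Int_absorb1 subsetI)
      ultimately show ?thesis by (simp add: ennreal_eq_1)
    qed
    have "ennreal (\<integral>z. h z * indicator ((G ^^ m) A) z \<partial>\<mu>) = emeasure N A" for m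
      using int[OF G_funpow_sets[OF A(1)], of m] iter[of m] G_funpow_subset[OF A(2), of m] by (simp add: Int_absorb2)
    moreover have "(\<lambda>m. ennreal (\<integral>z. h z * indicator ((G ^^ m) A) z \<partial>\<mu>)) \<longlonglongrightarrow> ennreal ((\<integral>z. h z \<partial>\<mu>) * P A)"
      by (intro tendsto_ennrealI mixing_integrable A h_int)
    ultimately have "(\<lambda>m::nat. emeasure N A) \<longlonglongrightarrow> ennreal (P A)" by (simp add: h1)
    then show ?thesis by (simp add: LIMSEQ_const_iff)
  qed
qed

text \<open>On every level both measures are given by \<open>level_formula\<close>, whose terms
  involve subsets of \<open>D\<close> alone, and the levels cover almost everything.\<close>

theorem invariant_measure_unique:
  assumes sets: "sets N = sets M" and inv: "\<And>A. A \<in> sets M \<Longrightarrow> emeasure N (pre 1 A) = emeasure N A"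
    and ac: "absolutely_continuous M N" and ND: "emeasure N D = 1"
  shows "N = \<nu>"
proof (rule measure_eqI)
  have AE_N: "AE z in N. Q z" if "AE z in M. Q z" for Q
    by (rule absolutely_continuous_AE[OF sets ac that])
  have ac\<nu>: "absolutely_continuous M \<nu>"
    by (auto simp: absolutely_continuous_def null_sets_def \<nu>_absolutely_continuous)
  fix A assume "A \<in> sets N"
  then have A: "A \<in> sets M" by (simp add: sets)
  have level: "emeasure N (A \<inter> entry k D) = emeasure \<nu> (A \<inter> entry k D)" for k
  proof -
    let ?A = "A \<inter> entry k D"
    have A': "?A \<in> sets M" using A by simp
    have "(\<lambda>j. emeasure N (D \<inter> pre 1 (entry j ?A))) sums emeasure N ?A"
      by (rule level_formula[OF sets inv ac ND A' Int_lower2])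
    moreover have "(\<lambda>j. emeasure \<nu> (D \<inter> pre 1 (entry j ?A))) sums emeasure \<nu> ?A"
      by (rule level_formula[OF sets_\<nu> \<nu>_invariant ac\<nu> \<nu>_D_1 A' Int_lower2])
    moreover have "emeasure N (D \<inter> pre 1 (entry j ?A)) = emeasure \<nu> (D \<inter> pre 1 (entry j ?A))" for j
      using A' by (simp add: invariant_measure_on_D[OF sets inv ac ND] \<nu>_D)
    ultimately show ?thesis using sums_unique2 by simp
  qed
  have total: "(\<lambda>k. emeasure Q (A \<inter> entry k D)) sums emeasure Q A"
    if Q: "sets Q = sets M" "AE z in Q. \<exists>k. z \<in> entry k D" for Q
  proof -
    have "(\<lambda>k. emeasure Q (A \<inter> entry k D)) sums emeasure Q (\<Union>k. A \<inter> entry k D)"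
      using entry_disjoint A by (intro sums_emeasure) (auto simp: disjoint_family_on_def Q(1))
    also have "emeasure Q (\<Union>k. A \<inter> entry k D) = emeasure Q A"
    proof (rule emeasure_eq_AE)
      show "AE z in Q. z \<in> (\<Union>k. A \<inter> entry k D) \<longleftrightarrow> z \<in> A"
        using Q(2) by eventually_elim auto
    qed (use A in \<open>auto simp: Q(1)\<close>)
    finally show ?thesis .
  qed
  show "emeasure N A = emeasure \<nu> A"
    using total[OF sets AE_N[OF AE_entrance]] total[OF sets_\<nu> AE_\<nu>[OF AE_entrance]] sums_unique2
    unfolding level by blast
qed (simp add: sets)

end

section \<open>Transfer operators\<close>

lemma Linf_bounded:
  assumes "v \<in> Linf \<nu>"
  obtains C where "v \<in> borel_measurable \<nu>" "AE z in \<nu>. \<bar>v z\<bar> \<le> C"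
proof -
  have v: "v \<in> borel_measurable \<nu>" and fin: "esssup \<nu> (\<lambda>z. ereal \<bar>v z\<bar>) < \<infinity>"
    using assms by (auto simp: Linf_def)
  obtain C where C: "esssup \<nu> (\<lambda>z. ereal \<bar>v z\<bar>) \<le> ereal C"
    using fin by (cases "esssup \<nu> (\<lambda>z. ereal \<bar>v z\<bar>)") auto
  have "AE z in \<nu>. ereal \<bar>v z\<bar> \<le> esssup \<nu> (\<lambda>z. ereal \<bar>v z\<bar>)" by (rule esssup_AE)
  then have "AE z in \<nu>. \<bar>v z\<bar> \<le> C"
  proof eventually_elim
    case (elim z)
    then have "ereal \<bar>v z\<bar> \<le> ereal C" using C by (rule order_trans)
    then show ?case by simp
  qed
  with v show ?thesis by (rule that)
qed

lemma indicator_Linf: "A \<in> sets \<nu> \<Longrightarrow> indicat_real A \<in> Linf \<nu>"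
proof -
  assume A: "A \<in> sets \<nu>"
  have "esssup \<nu> (\<lambda>z. ereal \<bar>indicat_real A z\<bar>) \<le> ereal 1"
    using A by (intro esssup_I AE_I2) (auto split: split_indicator)
  also have "\<dots> < \<infinity>" by simp
  finally show ?thesis using A by (simp add: Linf_def)
qed

text \<open>The measure with density \<open>u\<close> is pushed forward by \<open>S\<close>. The
  image is finite, and absolutely continuous because \<open>S\<close> preserves
  \<open>\<nu>\<close>; its Radon-Nikodym derivative is the required function.\<close>

lemma transfer_exists_nonneg:
  fixes u :: "'a \<Rightarrow> real"
  assumes "sigma_finite_measure \<nu>" and "invariant_measure S \<nu>" and u: "integrable \<nu> u" and u0: "\<And>z. 0 \<le> u z"
  obtains w where "integrable \<nu> w" and
    "\<And>v. v \<in> borel_measurable \<nu> \<Longrightarrow> (\<integral>z. w z * v z \<partial>\<nu>) = (\<integral>z. u z * v (S z) \<partial>\<nu>)"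
proof -
  interpret sigma_finite_measure \<nu> by fact
  have S [measurable]: "S \<in> \<nu> \<rightarrow>\<^sub>M \<nu>" and inv: "distr \<nu> \<nu> S = \<nu>"
    using assms(2) by (auto simp: invariant_measure_def)
  have [measurable]: "u \<in> borel_measurable \<nu>" using u by auto
  define N where "N = distr (density \<nu> (\<lambda>z. ennreal (u z))) \<nu> S"
  have N_sets: "sets N = sets \<nu>" by (simp add: N_def)
  have N: "emeasure N A = (\<integral>\<^sup>+z. ennreal (u z) * indicator (S -` A \<inter> space \<nu>) z \<partial>\<nu>)" if "A \<in> sets \<nu>" for A
    unfolding N_def using that by (subst emeasure_distr) (auto simp: emeasure_density)
  have fin: "finite_measure N"
  proof (rule finite_measureI)
    have "emeasure N (space N) = (\<integral>\<^sup>+z. ennreal (u z) * indicator (S -` space \<nu> \<inter> space \<nu>) z \<partial>\<nu>)"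
      using N[OF sets.top] sets_eq_imp_space_eq[OF N_sets] by simp
    also have "\<dots> \<le> (\<integral>\<^sup>+z. ennreal (u z) \<partial>\<nu>)" by (intro nn_integral_mono) (auto split: split_indicator)
    also have "\<dots> < \<infinity>" using u u0 by (simp add: nn_integral_eq_integral)
    finally show "emeasure N (space N) \<noteq> \<infinity>" by simp
  qed
  have ac: "absolutely_continuous \<nu> N"
    unfolding absolutely_continuous_def
  proof
    fix A assume A: "A \<in> null_sets \<nu>"
    then have As: "A \<in> sets \<nu>" by auto
    have "emeasure \<nu> (S -` A \<inter> space \<nu>) = emeasure (distr \<nu> \<nu> S) A" using As by (simp add: emeasure_distr)
    also have "\<dots> = 0" unfolding inv using A by (rule null_setsD1)
    finally have "S -` A \<inter> space \<nu> \<in> null_sets \<nu>" using As by (intro null_setsI) auto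
    then have "AE z in \<nu>. z \<notin> S -` A \<inter> space \<nu>" by (rule AE_not_in)
    then have "AE z in \<nu>. ennreal (u z) * indicator (S -` A \<inter> space \<nu>) z = 0"
      by eventually_elim simp
    then have "emeasure N A = 0" unfolding N[OF As] by (subst nn_integral_cong_AE[where v = "\<lambda>_. 0"]) auto
    then show "A \<in> null_sets N" using As N_sets by (intro null_setsI) auto
  qed
  obtain h where h: "h \<in> borel_measurable \<nu>" "AE x in \<nu>. RN_deriv \<nu> N x = ennreal (h x)" "\<And>x. 0 \<le> h x"
    using real_RN_deriv[OF fin ac N_sets] by metis
  note [measurable] = h(1)
  have "density \<nu> (RN_deriv \<nu> N) = N" by (rule density_RN_deriv[OF ac N_sets])
  moreover have "density \<nu> (RN_deriv \<nu> N) = density \<nu> (\<lambda>x. ennreal (h x))"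
    using h by (intro density_cong) auto
  ultimately have dens: "N = density \<nu> (\<lambda>x. ennreal (h x))" by simp
  have eq: "(\<integral>z. h z * v z \<partial>\<nu>) = (\<integral>z. u z * v (S z) \<partial>\<nu>)" if [measurable]: "v \<in> borel_measurable \<nu>" for v :: "'a \<Rightarrow> real"
  proof -
    have "(\<integral>z. v z \<partial>N) = (\<integral>z. h z * v z \<partial>\<nu>)"
      unfolding dens using h by (subst integral_density) auto
    moreover have "(\<integral>z. v z \<partial>N) = (\<integral>z. u z * v (S z) \<partial>\<nu>)"
      unfolding N_def using u0 by (subst integral_distr) (auto simp: integral_density)
    ultimately show ?thesis by simp
  qed
  have "integrable \<nu> h"
  proof (rule integrableI_nonneg)
    have "(\<integral>\<^sup>+z. ennreal (h z) \<partial>\<nu>) = emeasure N (space \<nu>)"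
      unfolding dens by (subst emeasure_density) (auto intro!: nn_integral_cong)
    then show "(\<integral>\<^sup>+z. ennreal (h z) \<partial>\<nu>) < \<infinity>"
      using finite_measure.emeasure_finite[OF fin, of "space \<nu>"] by (simp add: less_top)
  qed (use h in auto)
  then show ?thesis using eq by (rule that)
qed

lemma integrable_mult_AE_bounded:
  fixes w v :: "'a \<Rightarrow> real"
  assumes w: "integrable M w" and v: "v \<in> borel_measurable M" "AE z in M. \<bar>v z\<bar> \<le> C"
  shows "integrable M (\<lambda>z. w z * v z)"
proof (rule Bochner_Integration.integrable_bound[where f = "\<lambda>z. C * w z"])
  show "integrable M (\<lambda>z. C * w z)" using w by simp
  show "(\<lambda>z. w z * v z) \<in> borel_measurable M" using w v by auto
  show "AE z in M. norm (w z * v z) \<le> norm (C * w z)"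
    using v(2)
  proof eventually_elim
    case (elim z)
    then have "\<bar>w z\<bar> * \<bar>v z\<bar> \<le> \<bar>w z\<bar> * \<bar>C\<bar>" by (intro mult_left_mono) auto
    then show ?case by (simp add: abs_mult mult.commute)
  qed
qed

lemma AE_compose_invariant:
  assumes "invariant_measure S \<nu>" and "AE z in \<nu>. Q z"
  shows "AE z in \<nu>. Q (S z)"
proof -
  have S: "S \<in> \<nu> \<rightarrow>\<^sub>M \<nu>" and inv: "distr \<nu> \<nu> S = \<nu>"
    using assms(1) by (auto simp: invariant_measure_def)
  have "AE z in distr \<nu> \<nu> S. Q z" unfolding inv by (rule assms(2))
  then show ?thesis by (rule AE_distrD[OF S])
qed

text \<open>Existence is what gives the \<open>SOME\<close> in \<open>transfer_op\<close> its
  meaning; it follows from the nonnegative case, applied to the positive and the negative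
  part.\<close>

lemma transfer_op_spec:
  fixes u :: "'a \<Rightarrow> real"
  assumes sf: "sigma_finite_measure \<nu>" and inv: "invariant_measure S \<nu>" and u: "integrable \<nu> u"
  shows "integrable \<nu> (transfer_op \<nu> S u)"
    and "v \<in> Linf \<nu> \<Longrightarrow> (\<integral>z. transfer_op \<nu> S u z * v z \<partial>\<nu>) = (\<integral>z. u z * v (S z) \<partial>\<nu>)"
proof -
  have S [measurable]: "S \<in> \<nu> \<rightarrow>\<^sub>M \<nu>" using inv by (simp add: invariant_measure_def)
  obtain wp where wp: "integrable \<nu> wp"
    "\<And>v. v \<in> borel_measurable \<nu> \<Longrightarrow> (\<integral>z. wp z * v z \<partial>\<nu>) = (\<integral>z. max 0 (u z) * v (S z) \<partial>\<nu>)"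
    using transfer_exists_nonneg[OF sf inv, of "\<lambda>z. max 0 (u z)"] u by auto
  obtain wm where wm: "integrable \<nu> wm"
    "\<And>v. v \<in> borel_measurable \<nu> \<Longrightarrow> (\<integral>z. wm z * v z \<partial>\<nu>) = (\<integral>z. max 0 (- u z) * v (S z) \<partial>\<nu>)"
    using transfer_exists_nonneg[OF sf inv, of "\<lambda>z. max 0 (- u z)"] u by auto
  have "\<exists>w. integrable \<nu> w \<and> (\<forall>v\<in>Linf \<nu>. (\<integral>z. w z * v z \<partial>\<nu>) = (\<integral>z. u z * v (S z) \<partial>\<nu>))"
  proof (intro exI[of _ "\<lambda>z. wp z - wm z"] conjI ballI)
    show "integrable \<nu> (\<lambda>z. wp z - wm z)" using wp wm by auto
    fix v :: "'a \<Rightarrow> real" assume "v \<in> Linf \<nu>"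
    then obtain C where v [measurable]: "v \<in> borel_measurable \<nu>" and C: "AE z in \<nu>. \<bar>v z\<bar> \<le> C"
      by (rule Linf_bounded)
    have CS: "AE z in \<nu>. \<bar>v (S z)\<bar> \<le> C" by (rule AE_compose_invariant[OF inv C])
    have "(\<integral>z. (wp z - wm z) * v z \<partial>\<nu>) = (\<integral>z. wp z * v z \<partial>\<nu>) - (\<integral>z. wm z * v z \<partial>\<nu>)"
      using integrable_mult_AE_bounded[OF wp(1) v C] integrable_mult_AE_bounded[OF wm(1) v C]
      by (simp add: left_diff_distrib)
    also have "\<dots> = (\<integral>z. max 0 (u z) * v (S z) \<partial>\<nu>) - (\<integral>z. max 0 (- u z) * v (S z) \<partial>\<nu>)"
      by (simp add: wp wm)
    also have "\<dots> = (\<integral>z. max 0 (u z) * v (S z) - max 0 (- u z) * v (S z) \<partial>\<nu>)"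
      using u by (intro Bochner_Integration.integral_diff[symmetric] integrable_mult_AE_bounded[OF _ _ CS]) auto
    also have "\<dots> = (\<integral>z. u z * v (S z) \<partial>\<nu>)"
      by (intro Bochner_Integration.integral_cong refl) (auto simp: max_def)
    finally show "(\<integral>z. (wp z - wm z) * v z \<partial>\<nu>) = (\<integral>z. u z * v (S z) \<partial>\<nu>)" .
  qed
  from someI_ex[OF this]
  show "integrable \<nu> (transfer_op \<nu> S u)"
    and "v \<in> Linf \<nu> \<Longrightarrow> (\<integral>z. transfer_op \<nu> S u z * v z \<partial>\<nu>) = (\<integral>z. u z * v (S z) \<partial>\<nu>)"
    unfolding transfer_op_def by auto
qed

lemma funpow_measurable: "S \<in> \<nu> \<rightarrow>\<^sub>M \<nu> \<Longrightarrow> S ^^ n \<in> \<nu> \<rightarrow>\<^sub>M \<nu>"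
  by (rule measurable_compose_n)

lemma invariant_measure_funpow:
  assumes "invariant_measure S \<nu>"
  shows "invariant_measure (S ^^ n) \<nu>"
proof -
  have S: "S \<in> \<nu> \<rightarrow>\<^sub>M \<nu>" and inv: "distr \<nu> \<nu> S = \<nu>"
    using assms by (auto simp: invariant_measure_def)
  have "distr \<nu> \<nu> (S ^^ n) = \<nu>"
  proof (induction n)
    case 0
    show ?case by (simp add: id_def distr_id2)
  next
    case (Suc n)
    have "S ^^ Suc n = S \<circ> S ^^ n" by simp
    then show ?case
      unfolding distr_distr[OF S funpow_measurable[OF S, of n], symmetric] using Suc inv
      by (metis distr_distr[OF S funpow_measurable[OF S, of n]])
  qed
  then show ?thesis using funpow_measurable[OF S] by (simp add: invariant_measure_def)
qed

lemma transfer_op_funpow: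
  fixes f :: "'a \<Rightarrow> real"
  assumes sf: "sigma_finite_measure \<nu>" and inv: "invariant_measure S \<nu>" and f: "integrable \<nu> f"
  shows "integrable \<nu> ((transfer_op \<nu> S ^^ n) f)"
    and "A \<in> sets \<nu> \<Longrightarrow> (\<integral>z. (transfer_op \<nu> S ^^ n) f z * indicator A z \<partial>\<nu>) = (\<integral>z. f z * indicator A ((S ^^ n) z) \<partial>\<nu>)"
proof -
  have S [measurable]: "S \<in> \<nu> \<rightarrow>\<^sub>M \<nu>" using inv by (simp add: invariant_measure_def)
  show int: "integrable \<nu> ((transfer_op \<nu> S ^^ n) f)" for n
    by (induction n) (auto simp: f transfer_op_spec[OF sf inv])
  show "A \<in> sets \<nu> \<Longrightarrow> (\<integral>z. (transfer_op \<nu> S ^^ n) f z * indicator A z \<partial>\<nu>) = (\<integral>z. f z * indicator A ((S ^^ n) z) \<partial>\<nu>)"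
  proof (induction n arbitrary: A)
    case (Suc n)
    have sp: "S z \<in> space \<nu>" if "z \<in> space \<nu>" for z using measurable_space[OF S that] .
    have "(\<integral>z. (transfer_op \<nu> S ^^ Suc n) f z * indicator A z \<partial>\<nu>) =
      (\<integral>z. (transfer_op \<nu> S ^^ n) f z * indicator A (S z) \<partial>\<nu>)"
      using transfer_op_spec(2)[OF sf inv int indicator_Linf[OF Suc.prems]] by simp
    also have "\<dots> = (\<integral>z. (transfer_op \<nu> S ^^ n) f z * indicator (S -` A \<inter> space \<nu>) z \<partial>\<nu>)"
      by (intro Bochner_Integration.integral_cong refl) (auto split: split_indicator)
    also have "\<dots> = (\<integral>z. f z * indicator (S -` A \<inter> space \<nu>) ((S ^^ n) z) \<partial>\<nu>)"
      using Suc.prems by (intro Suc.IH) simp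
    also have "\<dots> = (\<integral>z. f z * indicator A ((S ^^ Suc n) z) \<partial>\<nu>)"
      using measurable_space[OF funpow_measurable[OF S, of n]]
      by (intro Bochner_Integration.integral_cong refl) (auto split: split_indicator)
    finally show ?case .
  qed simp
qed

text \<open>Tested on the part of \<open>D\<close> where \<open>w > k\<close>, the hypothesis leaves
  a nonnegative function with integral at most 0. This converts bounds uniform over sets into
  essential bounds.\<close>

lemma AE_le_of_set_integral_le:
  fixes w :: "'a \<Rightarrow> real"
  assumes w: "integrable N w" and D: "D \<in> sets N" "emeasure N D \<noteq> \<infinity>"
    and le: "\<And>A. A \<in> sets N \<Longrightarrow> A \<subseteq> D \<Longrightarrow> (\<integral>z. w z * indicator A z \<partial>N) \<le> k * measure N A"
  shows "AE z in N. z \<in> D \<longrightarrow> w z \<le> k"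
proof -
  have [measurable]: "w \<in> borel_measurable N" using w by auto
  define A where "A = {z \<in> space N. w z > k} \<inter> D"
  have A: "A \<in> sets N" "A \<subseteq> D" using D by (auto simp: A_def)
  have "emeasure N A \<le> emeasure N D" using A D by (intro emeasure_mono) auto
  then have fin: "emeasure N A < \<infinity>" using D(2) by (auto simp: less_top[symmetric] top_unique)
  have int: "integrable N (\<lambda>z. w z * indicator A z)" "integrable N (\<lambda>z. k * indicat_real A z)"
    using integrable_mult_indicator[OF A(1) w] A(1) fin by (auto simp: mult.commute)
  have "(\<integral>z. w z * indicator A z - k * indicator A z \<partial>N) = (\<integral>z. w z * indicator A z \<partial>N) - k * measure N A"
    using int A sets.sets_into_space[OF A(1)] by (simp add: Int_absorb2)
  also have "\<dots> \<le> 0" using le[OF A] by simp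
  finally have "(\<integral>z. w z * indicator A z - k * indicator A z \<partial>N) \<le> 0" .
  moreover have nn: "AE z in N. 0 \<le> w z * indicator A z - k * indicator A z"
    by (intro AE_I2) (auto simp: A_def split: split_indicator)
  ultimately have "(\<integral>z. w z * indicator A z - k * indicator A z \<partial>N) = 0"
    using integral_nonneg_AE[OF nn] by simp
  then have "AE z in N. w z * indicator A z - k * indicator A z = 0"
    using integral_nonneg_eq_0_iff_AE[OF _ nn] int by auto
  then show ?thesis using AE_space by eventually_elim (auto simp: A_def split: split_indicator_asm)
qed

section \<open>Limit theorems for an arbitrary normalised absolutely continuous invariant
  measure\<close>

context affine_return_system
begin

context
  fixes N :: "'a measure"
  assumes N_sets: "sets N = sets M" and N_inv: "invariant_measure S N"
    and N_ac: "absolutely_continuous M N" and N_sf: "sigma_finite_measure N" and N_D: "emeasure N D = 1"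
begin

lemma N_space: "space N = space M"
  by (rule sets_eq_imp_space_eq[OF N_sets])

lemma N_pre: "A \<in> sets M \<Longrightarrow> emeasure N (pre 1 A) = emeasure N A"
proof -
  assume A: "A \<in> sets M"
  have "emeasure N A = emeasure (distr N N S) A" using N_inv by (simp add: invariant_measure_def)
  also have "\<dots> = emeasure N (pre 1 A)"
    using A N_inv by (subst emeasure_distr) (auto simp: invariant_measure_def N_sets N_space pre_def)
  finally show ?thesis by simp
qed

lemma N_on_D: "A \<in> sets M \<Longrightarrow> A \<subseteq> D \<Longrightarrow> emeasure N A = ennreal (P A)"
  by (rule invariant_measure_on_D[OF N_sets N_pre N_ac N_D])

lemma \<mu>_density: "\<mu> = density N (\<lambda>z. ennreal (indicat_real D z))"
proof (rule measure_eqI)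
  fix X assume "X \<in> sets \<mu>"
  then have X: "X \<in> sets M" by simp
  have "emeasure (density N (\<lambda>z. ennreal (indicat_real D z))) X = emeasure N (D \<inter> X)"
    unfolding ennreal_indicator using X by (subst emeasure_restricted) (auto simp: N_sets)
  also have "\<dots> = ennreal (P (D \<inter> X))" using X by (intro N_on_D) auto
  also have "\<dots> = emeasure \<mu> X" using X by (simp add: P_Int_D \<mu>.emeasure_eq_measure)
  finally show "emeasure \<mu> X = emeasure (density N (\<lambda>z. ennreal (indicat_real D z))) X" by simp
qed (simp add: N_sets)

lemma integral_\<mu>: "h \<in> borel_measurable M \<Longrightarrow> (\<integral>z. h z \<partial>\<mu>) = (\<integral>z. indicator D z * h z \<partial>N)" for h :: "'a \<Rightarrow> real"
  unfolding \<mu>_density using N_sets measurable_cong_sets[OF N_sets refl]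
  by (subst integral_density) auto

lemma integrable_\<mu>_iff: "h \<in> borel_measurable M \<Longrightarrow> integrable \<mu> h \<longleftrightarrow> integrable N (\<lambda>z. indicator D z * h z)" for h :: "'a \<Rightarrow> real"
  unfolding \<mu>_density using N_sets measurable_cong_sets[OF N_sets refl]
  by (subst integrable_density) auto

context
  fixes f :: "'a \<Rightarrow> real" and C L :: real
  assumes f_meas: "f \<in> borel_measurable M" and f_supp: "\<And>z. z \<notin> D \<Longrightarrow> f z = 0"
    and f_bound: "\<And>z. z \<in> D \<Longrightarrow> \<bar>f z\<bar> \<le> C" and C: "0 < C" and f_lip: "L-lipschitz_on D f"
    and u_pos: "\<And>n. 0 < u n" and ratio: "(\<lambda>n. u (Suc n) / u n) \<longlonglongrightarrow> 1"
begin

abbreviation (input) m_f :: real where "m_f \<equiv> \<integral>z. f z \<partial>\<mu>"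

abbreviation (input) w_f :: "nat \<Rightarrow> 'a \<Rightarrow> real" where "w_f n \<equiv> (transfer_op N S ^^ n) f"

lemma f_abs_le: "\<bar>f z\<bar> \<le> C"
  using f_supp[of z] f_bound[of z] C by (cases "z \<in> D") auto

lemma f_indicator: "indicator D z * f z = f z"
  using f_supp[of z] by (cases "z \<in> D") auto

lemma f_integrable: "integrable N f"
proof -
  have "integrable \<mu> f"
    by (rule \<mu>.integrable_const_bound[of _ C]) (use f_meas f_abs_le in auto)
  then show ?thesis using integrable_\<mu>_iff[OF f_meas] by (simp add: f_indicator)
qed

lemma f_oscillation:
  assumes "0 < \<delta>"
  shows "\<exists>m. \<forall>w. length w = m \<longrightarrow> (\<forall>z\<in>cyl w. \<forall>z'\<in>cyl w. \<bar>f z - f z'\<bar> \<le> \<delta>)"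
proof -
  have L: "0 \<le> L" by (rule lipschitz_on_nonneg[OF f_lip])
  obtain m where m: "\<And>w z z'. length w = m \<Longrightarrow> z \<in> cyl w \<Longrightarrow> z' \<in> cyl w \<Longrightarrow> dist z z' \<le> \<delta> / (L + 1)"
    using cyl_dist_small[of "\<delta> / (L + 1)"] assms L by auto
  have "\<bar>f z - f z'\<bar> \<le> \<delta>" if "length w = m" "z \<in> cyl w" "z' \<in> cyl w" for w z z'
  proof -
    have "dist (f z) (f z') \<le> L * dist z z'"
      using that(2,3) cyl_subset by (intro lipschitz_onD[OF f_lip]) auto
    also have "\<dots> \<le> L * (\<delta> / (L + 1))" using m[OF that] L by (rule mult_left_mono)
    also have "\<dots> \<le> \<delta>" using L assms by (simp add: field_simps)
    finally show ?thesis by (simp add: dist_real_def)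
  qed
  then show ?thesis by blast
qed

text \<open>By duality the integral of the iterate over \<open>A\<close> is the correlation of
  \<open>f\<close> with \<open>A\<close>. An error proportional to \<open>P A\<close> for every
  \<open>A\<close> in \<open>D\<close> is an essential bound on the error.\<close>

lemma transfer_op_on_D:
  assumes e: "0 < e"
  shows "\<forall>\<^sub>F n in sequentially. AE z in N. z \<in> D \<longrightarrow> \<bar>w_f n z - u n * m_f\<bar> \<le> e * u n"
proof -
  have "\<forall>\<^sub>F n in sequentially. \<forall>A\<in>sets M. A \<subseteq> D \<longrightarrow>
    \<bar>(\<integral>z. f z * indicator (pre n A) z \<partial>\<mu>) - u n * m_f * P A\<bar> \<le> e * u n * P A"
    by (intro correlation_asymptotic[where C = C] f_meas f_bound C f_oscillation u_pos ratio e)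
  then show ?thesis
  proof eventually_elim
    case (elim n)
    have int: "integrable N (w_f n)" by (rule transfer_op_funpow(1)[OF N_sf N_inv f_integrable])
    have w: "(\<integral>z. w_f n z * indicator A z \<partial>N) = (\<integral>z. f z * indicator (pre n A) z \<partial>\<mu>)" if A: "A \<in> sets M" for A
    proof -
      have "(\<integral>z. w_f n z * indicator A z \<partial>N) = (\<integral>z. f z * indicator A ((S ^^ n) z) \<partial>N)"
        using A by (intro transfer_op_funpow(2)[OF N_sf N_inv f_integrable]) (simp add: N_sets)
      also have "\<dots> = (\<integral>z. indicator D z * (f z * indicator (pre n A) z) \<partial>N)"
        unfolding mult.assoc[symmetric] f_indicator
        by (intro Bochner_Integration.integral_cong refl) (auto simp: pre_def N_space split: split_indicator)
      also have "\<dots> = (\<integral>z. f z * indicator (pre n A) z \<partial>\<mu>)"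
        using A f_meas by (intro integral_\<mu>[symmetric]) auto
      finally show ?thesis .
    qed
    have PN: "measure N A = P A" if "A \<in> sets M" "A \<subseteq> D" for A
      using N_on_D[OF that] by (simp add: measure_def)
    have bd: "\<bar>(\<integral>z. w_f n z * indicator A z \<partial>N) - u n * m_f * P A\<bar> \<le> e * u n * P A" if "A \<in> sets M" "A \<subseteq> D" for A
      using elim that w[OF that(1)] by simp
    have fin: "D \<in> sets N" "emeasure N D \<noteq> \<infinity>" by (simp_all add: N_sets N_D)
    have up: "AE z in N. z \<in> D \<longrightarrow> w_f n z \<le> u n * m_f + e * u n"
    proof (rule AE_le_of_set_integral_le[OF int fin])
      fix A assume "A \<in> sets N" "A \<subseteq> D"
      then have A: "A \<in> sets M" "A \<subseteq> D" by (simp_all add: N_sets)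
      show "(\<integral>z. w_f n z * indicator A z \<partial>N) \<le> (u n * m_f + e * u n) * measure N A"
        using bd[OF A] unfolding PN[OF A] distrib_right abs_le_iff by linarith
    qed
    have "AE z in N. z \<in> D \<longrightarrow> - w_f n z \<le> - (u n * m_f) + e * u n"
    proof (rule AE_le_of_set_integral_le[OF _ fin])
      show "integrable N (\<lambda>z. - w_f n z)" using int by simp
      fix A assume "A \<in> sets N" "A \<subseteq> D"
      then have A: "A \<in> sets M" "A \<subseteq> D" by (simp_all add: N_sets)
      have "(\<integral>z. - w_f n z * indicator A z \<partial>N) = - (\<integral>z. w_f n z * indicator A z \<partial>N)" by simp
      then show "(\<integral>z. - w_f n z * indicator A z \<partial>N) \<le> (- (u n * m_f) + e * u n) * measure N A"
        using bd[OF A] unfolding PN[OF A] distrib_right mult_minus_left abs_le_iff by linarith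
    qed
    with up show ?case by eventually_elim (auto simp: abs_le_iff)
  qed
qed

lemma scaled_transfer_op_on_D:
  assumes lim: "(\<lambda>n. a n * u n) \<longlonglongrightarrow> c" and e: "0 < e"
  shows "\<forall>\<^sub>F n in sequentially. AE z in N. z \<in> D \<longrightarrow> \<bar>a n * w_f n z - c * m_f\<bar> \<le> e"
proof -
  \<comment> \<open>The relative error of the iterate is multiplied by \<open>a n * u n\<close>,
    which is eventually below \<open>\<bar>c\<bar> + 1\<close>, and the error of
    \<open>a n * u n\<close> by the integral of \<open>f\<close>; each product receives half of
    \<open>e\<close>.\<close>
  define e1 where "e1 = e / (2 * (\<bar>c\<bar> + 1))"
  have e1: "0 < e1" using e by (simp add: e1_def)
  define e2 where "e2 = e / (2 * (\<bar>m_f\<bar> + 1))"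
  have e2: "0 < e2" using e by (simp add: e2_def)
  have 1: "\<forall>\<^sub>F n in sequentially. \<bar>a n * u n\<bar> < \<bar>c\<bar> + 1"
    using order_tendstoD(2)[OF tendsto_rabs[OF lim], of "\<bar>c\<bar> + 1"] by simp
  have 2: "\<forall>\<^sub>F n in sequentially. \<bar>a n * u n - c\<bar> < e2"
    using tendstoD[OF lim e2] by (simp add: dist_real_def)
  show ?thesis using transfer_op_on_D[OF e1] 1 2
  proof eventually_elim
    case (elim n)
    have b1: "\<bar>a n\<bar> * (e1 * u n) \<le> e / 2"
    proof -
      have "\<bar>a n\<bar> * (e1 * u n) = e1 * \<bar>a n * u n\<bar>" using u_pos[of n] by (simp add: abs_mult)
      also have "\<dots> \<le> e1 * (\<bar>c\<bar> + 1)" using elim(2) e1 by (intro mult_left_mono) auto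
      also have "\<dots> = e / 2" by (simp add: e1_def field_simps)
      finally show ?thesis .
    qed
    have b2: "\<bar>a n * u n - c\<bar> * \<bar>m_f\<bar> \<le> e / 2"
    proof -
      have "\<bar>a n * u n - c\<bar> * \<bar>m_f\<bar> \<le> e2 * (\<bar>m_f\<bar> + 1)" using elim(3) e2 by (intro mult_mono) auto
      also have "\<dots> = e / 2" by (simp add: e2_def field_simps)
      finally show ?thesis .
    qed
    show ?case using elim(1)
    proof eventually_elim
      case (elim z)
      show ?case
      proof
        assume "z \<in> D"
        then have "\<bar>a n\<bar> * \<bar>w_f n z - u n * m_f\<bar> \<le> \<bar>a n\<bar> * (e1 * u n)"
          using elim by (intro mult_left_mono) auto
        then have 3: "\<bar>a n * (w_f n z - u n * m_f)\<bar> \<le> e / 2" using b1 by (simp add: abs_mult)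
        have "a n * w_f n z - c * m_f = a n * (w_f n z - u n * m_f) + (a n * u n - c) * m_f"
          by (simp add: algebra_simps)
        also have "\<bar>\<dots>\<bar> \<le> \<bar>a n * (w_f n z - u n * m_f)\<bar> + \<bar>(a n * u n - c) * m_f\<bar>" by (rule abs_triangle_ineq)
        also have "\<dots> \<le> e / 2 + e / 2" using 3 b2 by (intro add_mono) (auto simp: abs_mult)
        finally show "\<bar>a n * w_f n z - c * m_f\<bar> \<le> e" by simp
      qed
    qed
  qed
qed

lemma m_f_eq: "(LINT y:D|N. f y) = m_f"
  unfolding set_lebesgue_integral_def using integral_\<mu>[OF f_meas] by simp

lemma transfer_op_sup_norm_limit:
  assumes lim: "(\<lambda>n. a n * u n) \<longlonglongrightarrow> c"
  shows "(\<lambda>n. sup_norm_on N D (\<lambda>z. a n * (indicat_real D z * (transfer_op N S ^^ n) f z) - c * (LINT y:D|N. f y)))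
    \<longlonglongrightarrow> 0"
proof -
  let ?h = "\<lambda>n z. a n * (indicat_real D z * w_f n z) - c * m_f"
  let ?R = "restrict_space N D"
  have D_N: "D \<in> sets N" by (simp add: N_sets)
  have w_meas: "w_f n \<in> borel_measurable N" for n
    using transfer_op_funpow(1)[OF N_sf N_inv f_integrable, of n] by auto
  have h_meas: "(\<lambda>z. ereal \<bar>?h n z\<bar>) \<in> borel_measurable ?R" for n
    using w_meas[of n] D_N by (intro measurable_restrict_space1) auto
  \<comment> \<open>Over a null space \<open>esssup\<close> is minus infinity, so this lower bound
    depends on \<open>D\<close> having positive mass.\<close>
  have nonneg: "0 \<le> sup_norm_on N D (?h n)" for n
  proof -
    have "emeasure ?R (space ?R) = 1"
      using D_N sets.sets_into_space[OF D_N] N_D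
      by (simp add: space_restrict_space emeasure_restrict_space Int_absorb2)
    then have "esssup ?R (\<lambda>z. 0 :: ereal) = 0" by (intro esssup_const) simp
    moreover have "esssup ?R (\<lambda>z. 0 :: ereal) \<le> esssup ?R (\<lambda>z. ereal \<bar>?h n z\<bar>)" by (intro esssup_mono) auto
    ultimately show ?thesis by (simp add: sup_norm_on_def)
  qed
  have "(\<lambda>n. sup_norm_on N D (?h n)) \<longlonglongrightarrow> 0"
  proof (rule order_tendstoI)
    fix x :: ereal assume "x < 0"
    then show "\<forall>\<^sub>F n in sequentially. x < sup_norm_on N D (?h n)"
      by (intro always_eventually allI) (rule less_le_trans[OF _ nonneg])
  next
    fix x :: ereal assume "0 < x"
    from ereal_dense2[OF this] obtain e where e: "0 < ereal e" "ereal e < x" by (elim exE conjE)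
    then have "0 < e" by simp
    from scaled_transfer_op_on_D[OF lim this]
    show "\<forall>\<^sub>F n in sequentially. sup_norm_on N D (?h n) < x"
    proof eventually_elim
      case (elim n)
      have "AE z in ?R. ereal \<bar>?h n z\<bar> \<le> ereal e"
        using D_N elim by (subst AE_restrict_space_iff) (auto elim!: eventually_mono)
      then have "sup_norm_on N D (?h n) \<le> ereal e"
        unfolding sup_norm_on_def using h_meas by (intro esssup_I) auto
      then show ?case using e(2) by (rule le_less_trans)
    qed
  qed
  then show ?thesis unfolding m_f_eq .
qed

text \<open>The defining duality is for essentially bounded test functions. As \<open>f\<close> is
  bounded, and the iterate is bounded on \<open>D\<close> by the first premise, dominated
  convergence extends it to integrable \<open>k\<close>.\<close>

lemma transfer_op_duality_L1:
  assumes w: "AE z in N. z \<in> D \<longrightarrow> \<bar>w_f n z\<bar> \<le> K" and k: "integrable N k"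
  shows "(\<integral>z. f z * (indicator D ((S ^^ n) z) * k ((S ^^ n) z)) \<partial>N) = (\<integral>z. w_f n z * (indicator D z * k z) \<partial>N)"
    and "integrable N (\<lambda>z. w_f n z * (indicator D z * k z))"
proof -
  have Sn: "S ^^ n \<in> N \<rightarrow>\<^sub>M N" and inv: "distr N N (S ^^ n) = N"
    using invariant_measure_funpow[OF N_inv] by (auto simp: invariant_measure_def)
  note [measurable] = Sn
  have [measurable]: "f \<in> borel_measurable N" "D \<in> sets N" "w_f n \<in> borel_measurable N"
    using f_integrable transfer_op_funpow(1)[OF N_sf N_inv f_integrable, of n] by (auto simp: N_sets)
  have kS: "integrable N (\<lambda>z. k ((S ^^ n) z))" if "integrable N k" for k :: "'a \<Rightarrow> real"
    using that by (intro integrable_distr[OF Sn]) (simp add: inv)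
  have b1: "\<bar>f z * (indicator D y * x)\<bar> \<le> C * \<bar>x\<bar>" for z y and x :: real
  proof -
    have "\<bar>f z\<bar> * \<bar>indicator D y * x\<bar> \<le> C * \<bar>x\<bar>" using f_abs_le[of z] C by (intro mult_mono) (auto split: split_indicator)
    then show ?thesis by (simp add: abs_mult)
  qed
  have b2: "AE z in N. \<forall>x. \<bar>w_f n z * (indicator D z * x)\<bar> \<le> \<bar>K\<bar> * \<bar>x\<bar>"
    using w
  proof eventually_elim
    case (elim z)
    show ?case
    proof
      fix x :: real
      show "\<bar>w_f n z * (indicator D z * x)\<bar> \<le> \<bar>K\<bar> * \<bar>x\<bar>"
      proof (cases "z \<in> D")
        case True
        then have "\<bar>w_f n z\<bar> * \<bar>x\<bar> \<le> \<bar>K\<bar> * \<bar>x\<bar>" using elim by (intro mult_right_mono) auto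
        then show ?thesis using True by (simp add: abs_mult)
      qed simp
    qed
  qed
  have i1: "integrable N (\<lambda>z. f z * (indicator D ((S ^^ n) z) * k ((S ^^ n) z)))" if k: "integrable N k" for k :: "'a \<Rightarrow> real"
  proof (rule Bochner_Integration.integrable_bound[where f = "\<lambda>z. C * k ((S ^^ n) z)"])
    show "integrable N (\<lambda>z. C * k ((S ^^ n) z))" using kS[OF k] by simp
    have [measurable]: "k \<in> borel_measurable N" using k by auto
    show "(\<lambda>z. f z * (indicator D ((S ^^ n) z) * k ((S ^^ n) z))) \<in> borel_measurable N" by measurable
    show "AE z in N. norm (f z * (indicator D ((S ^^ n) z) * k ((S ^^ n) z))) \<le> norm (C * k ((S ^^ n) z))"
      using b1 C by (intro AE_I2) (simp add: abs_mult)
  qed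
  have i2: "integrable N (\<lambda>z. w_f n z * (indicator D z * k z))" if k: "integrable N k" for k :: "'a \<Rightarrow> real"
  proof (rule Bochner_Integration.integrable_bound[where f = "\<lambda>z. K * k z"])
    show "integrable N (\<lambda>z. K * k z)" using k by simp
    have [measurable]: "k \<in> borel_measurable N" using k by auto
    show "(\<lambda>z. w_f n z * (indicator D z * k z)) \<in> borel_measurable N" by measurable
    show "AE z in N. norm (w_f n z * (indicator D z * k z)) \<le> norm (K * k z)"
      using b2 by eventually_elim (simp add: abs_mult)
  qed
  show "integrable N (\<lambda>z. w_f n z * (indicator D z * k z))" by (rule i2[OF k])
  show "(\<integral>z. f z * (indicator D ((S ^^ n) z) * k ((S ^^ n) z)) \<partial>N) = (\<integral>z. w_f n z * (indicator D z * k z) \<partial>N)"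
    using k
  proof (induction rule: integrable_induct)
    case (base X x)
    have X: "D \<inter> X \<in> sets N" using base by auto
    have "(\<integral>z. f z * (indicator D ((S ^^ n) z) * (indicat_real X ((S ^^ n) z) *\<^sub>R x)) \<partial>N) =
      (\<integral>z. x * (f z * indicator (D \<inter> X) ((S ^^ n) z)) \<partial>N)"
      by (intro Bochner_Integration.integral_cong refl) (simp add: indicator_inter_arith)
    also have "\<dots> = x * (\<integral>z. f z * indicator (D \<inter> X) ((S ^^ n) z) \<partial>N)" by simp
    also have "\<dots> = x * (\<integral>z. w_f n z * indicator (D \<inter> X) z \<partial>N)"
      using transfer_op_funpow(2)[OF N_sf N_inv f_integrable X, of n] by simp
    also have "\<dots> = (\<integral>z. x * (w_f n z * indicator (D \<inter> X) z) \<partial>N)" by simp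
    also have "\<dots> = (\<integral>z. w_f n z * (indicator D z * (indicat_real X z *\<^sub>R x)) \<partial>N)"
      by (intro Bochner_Integration.integral_cong refl) (simp add: indicator_inter_arith)
    finally show ?case .
  next
    case (add k1 k2)
    have "(\<integral>z. f z * (indicator D ((S ^^ n) z) * (k1 ((S ^^ n) z) + k2 ((S ^^ n) z))) \<partial>N) =
      (\<integral>z. f z * (indicator D ((S ^^ n) z) * k1 ((S ^^ n) z)) \<partial>N) + (\<integral>z. f z * (indicator D ((S ^^ n) z) * k2 ((S ^^ n) z)) \<partial>N)"
      using i1[OF add.hyps(1)] i1[OF add.hyps(2)] by (simp add: distrib_left)
    moreover have "(\<integral>z. w_f n z * (indicator D z * (k1 z + k2 z)) \<partial>N) =
      (\<integral>z. w_f n z * (indicator D z * k1 z) \<partial>N) + (\<integral>z. w_f n z * (indicator D z * k2 z) \<partial>N)"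
      using i2[OF add.hyps(1)] i2[OF add.hyps(2)] by (simp add: distrib_left)
    ultimately show ?case using add.IH by simp
  next
    case (lim k s)
    have [measurable]: "k \<in> borel_measurable N" "\<And>i. s i \<in> borel_measurable N" using lim by auto
    have sp: "(S ^^ n) z \<in> space N" if "z \<in> space N" for z using measurable_space[OF Sn that] .
    have l1: "(\<lambda>i. \<integral>z. f z * (indicator D ((S ^^ n) z) * s i ((S ^^ n) z)) \<partial>N) \<longlonglongrightarrow>
      (\<integral>z. f z * (indicator D ((S ^^ n) z) * k ((S ^^ n) z)) \<partial>N)"
    proof (rule integral_dominated_convergence[where w = "\<lambda>z. C * (2 * \<bar>k ((S ^^ n) z)\<bar>)"])
      show "integrable N (\<lambda>z. C * (2 * \<bar>k ((S ^^ n) z)\<bar>))"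
        using kS[OF lim.hyps(4)] by simp
      show "AE z in N. (\<lambda>i. f z * (indicator D ((S ^^ n) z) * s i ((S ^^ n) z))) \<longlonglongrightarrow> f z * (indicator D ((S ^^ n) z) * k ((S ^^ n) z))"
        using lim.hyps(2)[OF sp] by (intro AE_I2 tendsto_intros) auto
      show "AE z in N. norm (f z * (indicator D ((S ^^ n) z) * s i ((S ^^ n) z))) \<le> C * (2 * \<bar>k ((S ^^ n) z)\<bar>)" for i
      proof (rule AE_I2)
        fix z assume "z \<in> space N"
        have "\<bar>f z * (indicator D ((S ^^ n) z) * s i ((S ^^ n) z))\<bar> \<le> C * \<bar>s i ((S ^^ n) z)\<bar>" by (rule b1)
        also have "\<dots> \<le> C * (2 * \<bar>k ((S ^^ n) z)\<bar>)"
          using lim.hyps(3)[OF sp[OF \<open>z \<in> space N\<close>], of i] C by (intro mult_left_mono) auto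
        finally show "norm (f z * (indicator D ((S ^^ n) z) * s i ((S ^^ n) z))) \<le> C * (2 * \<bar>k ((S ^^ n) z)\<bar>)" by simp
      qed
    qed measurable
    have l2: "(\<lambda>i. \<integral>z. w_f n z * (indicator D z * s i z) \<partial>N) \<longlonglongrightarrow> (\<integral>z. w_f n z * (indicator D z * k z) \<partial>N)"
    proof (rule integral_dominated_convergence[where w = "\<lambda>z. \<bar>K\<bar> * (2 * \<bar>k z\<bar>)"])
      show "integrable N (\<lambda>z. \<bar>K\<bar> * (2 * \<bar>k z\<bar>))" using lim.hyps(4) by simp
      show "AE z in N. (\<lambda>i. w_f n z * (indicator D z * s i z)) \<longlonglongrightarrow> w_f n z * (indicator D z * k z)"
        using lim.hyps(2) by (intro AE_I2 tendsto_intros) auto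
      show "AE z in N. norm (w_f n z * (indicator D z * s i z)) \<le> \<bar>K\<bar> * (2 * \<bar>k z\<bar>)" for i
        using b2 AE_space
      proof eventually_elim
        case (elim z)
        have "\<bar>w_f n z * (indicator D z * s i z)\<bar> \<le> \<bar>K\<bar> * \<bar>s i z\<bar>" using elim(1) by blast
        also have "\<dots> \<le> \<bar>K\<bar> * (2 * \<bar>k z\<bar>)"
          using lim.hyps(3)[OF elim(2), of i] by (intro mult_left_mono) auto
        finally show ?case by simp
      qed
    qed measurable
    show ?case using l1 l2 unfolding lim.IH by (rule LIMSEQ_unique)
  qed
qed

text \<open>After duality the difference is an integral of the error on \<open>D\<close> against
  \<open>k\<close>, so it is at most the essential bound of that error times the L1 norm of
  \<open>k\<close>.\<close>

lemma correlation_L1_limit: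
  assumes lim: "(\<lambda>n. a n * u n) \<longlonglongrightarrow> c" and g: "set_integrable N D g"
  shows "(\<lambda>n. a n * (LINT z:D|N. f z * (\<lambda>y. indicat_real D y * g y) ((S ^^ n) z)))
    \<longlonglongrightarrow> c * (LINT z:D|N. f z) * (LINT z:D|N. g z)"
proof -
  define k where "k y = indicat_real D y * g y" for y
  have "k = (\<lambda>y. indicat_real D y * g y)" by (simp add: k_def fun_eq_iff)
  then have k: "integrable N k" using g by (simp add: set_integrable_def)
  have Dk: "indicator D y * k y = k y" for y by (simp add: k_def indicator_def)
  have kg: "(LINT z:D|N. g z) = (\<integral>z. k z \<partial>N)" by (simp add: set_lebesgue_integral_def k_def)
  have lhs: "(LINT z:D|N. f z * k ((S ^^ n) z)) = (\<integral>z. f z * (indicator D ((S ^^ n) z) * k ((S ^^ n) z)) \<partial>N)" for n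
    unfolding set_lebesgue_integral_def Dk by (simp add: f_indicator flip: mult.assoc)
  define J where "J = (\<integral>z. \<bar>k z\<bar> \<partial>N)"
  have J: "0 \<le> J" by (simp add: J_def)
  have "(\<lambda>n. a n * (LINT z:D|N. f z * k ((S ^^ n) z))) \<longlonglongrightarrow> c * m_f * (\<integral>z. k z \<partial>N)"
  proof (rule LIMSEQ_I)
    fix e :: real assume e: "0 < e"
    have e': "0 < e / (J + 1)" using e J by simp
    have "\<forall>\<^sub>F n in sequentially. norm (a n * (LINT z:D|N. f z * k ((S ^^ n) z)) - c * m_f * (\<integral>z. k z \<partial>N)) < e"
      using transfer_op_on_D[OF zero_less_one] scaled_transfer_op_on_D[OF lim e']
    proof eventually_elim
      case (elim n)
      have "AE z in N. z \<in> D \<longrightarrow> \<bar>w_f n z\<bar> \<le> \<bar>u n * m_f\<bar> + 1 * u n"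
        using elim(1) by eventually_elim linarith
      note dual = transfer_op_duality_L1[OF this k]
      have "a n * (LINT z:D|N. f z * k ((S ^^ n) z)) - c * m_f * (\<integral>z. k z \<partial>N) =
        (\<integral>z. a n * (w_f n z * (indicator D z * k z)) - c * m_f * k z \<partial>N)"
        unfolding lhs dual(1) using dual(2) k by simp
      also have "\<bar>\<dots>\<bar> \<le> (\<integral>z. \<bar>a n * (w_f n z * (indicator D z * k z)) - c * m_f * k z\<bar> \<partial>N)"
        by (rule integral_abs_bound)
      also have "\<dots> \<le> (\<integral>z. e / (J + 1) * \<bar>k z\<bar> \<partial>N)"
      proof (rule integral_mono_AE)
        show "integrable N (\<lambda>z. \<bar>a n * (w_f n z * (indicator D z * k z)) - c * m_f * k z\<bar>)"
          by (rule integrable_abs[OF Bochner_Integration.integrable_diff[OF integrable_mult_right[OF dual(2)] integrable_mult_right[OF k]]])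
        show "integrable N (\<lambda>z. e / (J + 1) * \<bar>k z\<bar>)" using k by (intro integrable_mult_right integrable_abs)
        show "AE z in N. \<bar>a n * (w_f n z * (indicator D z * k z)) - c * m_f * k z\<bar> \<le> e / (J + 1) * \<bar>k z\<bar>"
          using elim(2)
        proof eventually_elim
          case (elim z)
          show ?case
          proof (cases "z \<in> D")
            case True
            have "a n * (w_f n z * (indicator D z * k z)) - c * m_f * k z = (a n * w_f n z - c * m_f) * k z"
              using True by (simp add: algebra_simps)
            also have "\<bar>\<dots>\<bar> \<le> e / (J + 1) * \<bar>k z\<bar>"
              unfolding abs_mult using elim True by (intro mult_right_mono) auto
            finally show ?thesis .
          next
            case False
            then show ?thesis by (simp add: k_def)
          qed
        qed
      qed
      also have "\<dots> = e / (J + 1) * J" by (simp add: J_def)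
      also have "\<dots> < e" using e J by (simp add: field_simps)
      finally show ?case by simp
    qed
    then show "\<exists>no. \<forall>n\<ge>no. norm (a n * (LINT z:D|N. f z * k ((S ^^ n) z)) - c * m_f * (\<integral>z. k z \<partial>N)) < e"
      by (simp add: eventually_sequentially)
  qed
  then show ?thesis unfolding m_f_eq kg k_def .
qed

end

end

end

section \<open>The skew product\<close>

definition diag_affine :: "real \<Rightarrow> real \<Rightarrow> real \<Rightarrow> real \<Rightarrow> real \<times> real \<Rightarrow> real \<times> real" where
  "diag_affine s t s' t' z = (s * fst z + t, s' * snd z + t')"

lemma diag_affine_measurable [measurable]: "diag_affine s t s' t' \<in> borel_measurable borel"
  unfolding diag_affine_def by (intro borel_measurable_continuous_onI continuous_intros)

lemma emeasure_vimage_diag_affine: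
  assumes s: "0 < s" "0 < s'" and A: "A \<in> sets borel"
  shows "emeasure lborel (diag_affine s t s' t' -` A) = emeasure lborel A * ennreal (1 / (s * s'))"
proof -
  define c where "c j = (if j = (1, 0) then s else s')" for j :: "real \<times> real"
  have Basis: "(Basis :: (real \<times> real) set) = {(1, 0), (0, 1)}" by (auto simp: Basis_prod_def)
  have T: "(\<lambda>z. (t, t') + (\<Sum>j\<in>Basis. (c j * (z \<bullet> j)) *\<^sub>R j)) = diag_affine s t s' t'"
    by (auto simp: Basis c_def diag_affine_def fun_eq_iff inner_prod_def add.commute)
  have "lborel = density (distr lborel borel (diag_affine s t s' t')) (\<lambda>_. ennreal (\<Prod>j\<in>Basis. \<bar>c j\<bar>))"
    using lborel_affine_euclidean[where t = "(t, t')" and c = c] s unfolding T by (auto simp: c_def)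
  also have "(\<Prod>j\<in>(Basis :: (real \<times> real) set). \<bar>c j\<bar>) = s * s'"
    using s by (simp add: Basis c_def)
  finally have "emeasure lborel A = emeasure (density (distr lborel borel (diag_affine s t s' t')) (\<lambda>_. ennreal (s * s'))) A"
    by simp
  also have "\<dots> = ennreal (s * s') * emeasure (distr lborel borel (diag_affine s t s' t')) A"
    using A by (subst emeasure_density) (auto simp: nn_integral_cmult_indicator)
  also have "emeasure (distr lborel borel (diag_affine s t s' t')) A = emeasure lborel (diag_affine s t s' t' -` A)"
    using A by (subst emeasure_distr) auto
  finally have "emeasure lborel A * ennreal (1 / (s * s')) =
    emeasure lborel (diag_affine s t s' t' -` A) * (ennreal (s * s') * ennreal (1 / (s * s')))"
    by (simp add: mult_ac)
  also have "ennreal (s * s') * ennreal (1 / (s * s')) = 1"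
    using s by (simp flip: ennreal_mult)
  finally show ?thesis by simp
qed

lemma null_vertical_line: "{a} \<times> UNIV \<in> null_sets (lborel :: (real \<times> real) measure)"
proof -
  have "emeasure (lborel \<Otimes>\<^sub>M lborel) ({a} \<times> (UNIV :: real set)) = emeasure lborel {a} * emeasure lborel (UNIV :: real set)"
    by (intro lborel.emeasure_pair_measure_Times) auto
  moreover have "{a} \<times> (UNIV :: real set) \<in> sets borel"
    by (intro borel_closed closed_Times) auto
  ultimately show ?thesis by (intro null_setsI) (simp_all add: lborel_prod)
qed

lemma null_horizontal_line: "UNIV \<times> {a} \<in> null_sets (lborel :: (real \<times> real) measure)"
proof -
  have "emeasure (lborel \<Otimes>\<^sub>M lborel) ((UNIV :: real set) \<times> {a}) = emeasure lborel (UNIV :: real set) * emeasure lborel {a}"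
    by (intro lborel.emeasure_pair_measure_Times) auto
  moreover have "(UNIV :: real set) \<times> {a} \<in> sets borel"
    by (intro borel_closed closed_Times) auto
  ultimately show ?thesis by (intro null_setsI) (simp_all add: lborel_prod)
qed

section \<open>Symbolic coding of the skew product\<close>

context two_maps
begin

abbreviation X :: "nat \<Rightarrow> real \<Rightarrow> real" where "X \<equiv> xpt \<alpha> \<beta> p1 p2"

abbreviation \<phi> :: "real \<Rightarrow> real" where "\<phi> \<equiv> base_map p1 p2"

abbreviation S :: "real \<times> real \<Rightarrow> real \<times> real" where "S \<equiv> skew \<alpha> \<beta> p1 p2"

definition symb :: "real \<Rightarrow> bool" where "symb \<omega> \<longleftrightarrow> \<omega> < p1"

fun word :: "nat \<Rightarrow> real \<Rightarrow> bool list" where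
  "word 0 \<omega> = []"
| "word (Suc n) \<omega> = symb \<omega> # word n (\<phi> \<omega>)"

definition offset1 :: "bool \<Rightarrow> real" where "offset1 i = (if i then 0 else p1)"

text \<open>Left end point of the interval of all \<open>\<omega>\<close> whose symbol sequence starts with the given word.\<close>

fun offset :: "bool list \<Rightarrow> real" where
  "offset [] = 0"
| "offset (i # w) = offset1 i + pr i * offset w"

lemma length_word [simp]: "length (word n \<omega>) = n"
  by (induction n arbitrary: \<omega>) auto

lemma \<phi>_eq: "\<phi> \<omega> = (\<omega> - offset1 (symb \<omega>)) / pr (symb \<omega>)"
  by (simp add: base_map_def offset1_def symb_def pr_def)

text \<open>The defining recursion starts at index 2. Both branches send 1 to 1/2, so it already
  holds at index 1, and \<open>X n\<close> becomes a composition of \<open>n\<close> inverse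
  branches evaluated at 1.\<close>

lemma X_Suc: "X (Suc n) \<omega> = g (symb \<omega>) (X n (\<phi> \<omega>))"
  by (cases n) (simp_all add: g_1, simp add: g_def symb_def param_def)

lemma X_word: "X n \<omega> = W (word n \<omega>) 1"
  by (induction n arbitrary: \<omega>) (simp_all add: X_Suc del: xpt.simps(2,3))

lemma X_Suc_word: "X (Suc n) \<omega> = W (word n \<omega>) (1/2)"
proof (induction n arbitrary: \<omega>)
  case (Suc n)
  show ?case unfolding X_Suc[of "Suc n"] Suc by simp
qed simp

lemma X_pos: "0 < X n \<omega>" and X_le_1: "X n \<omega> \<le> 1"
  unfolding X_word using W_range[of 1] by auto

lemma X_strict: "X (Suc n) \<omega> < X n \<omega>"
  unfolding X_Suc_word unfolding X_word by (rule W_strict_mono) auto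

lemma X_antimono: "m \<le> n \<Longrightarrow> X n \<omega> \<le> X m \<omega>"
  by (rule lift_Suc_antimono_le) (rule less_imp_le[OF X_strict])

lemma X_le_half: "0 < n \<Longrightarrow> X n \<omega> \<le> 1/2"
  using X_antimono[of "Suc 0" n \<omega>] by simp

lemma X_tendsto: "(\<lambda>n. X n \<omega>) \<longlonglongrightarrow> 0"
proof (rule tendsto_sandwich[OF _ _ tendsto_const b_tendsto_0])
  show "\<forall>\<^sub>F n in sequentially. X n \<omega> \<le> b n"
    unfolding X_word using W_le_b[of "word _ \<omega>"] by (intro always_eventually) simp
qed (use X_pos in \<open>auto intro!: always_eventually less_imp_le\<close>)

lemma level_unique: "X (Suc n) \<omega> < x \<Longrightarrow> x \<le> X n \<omega> \<Longrightarrow> X (Suc m) \<omega> < x \<Longrightarrow> x \<le> X m \<omega> \<Longrightarrow> n = m"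
  using X_antimono[of "Suc n" m \<omega>] X_antimono[of "Suc m" n \<omega>] by (cases n m rule: linorder_cases) auto

lemma level_exists:
  assumes "0 < x" "x \<le> 1"
  shows "X (Suc (LEAST n. X (Suc n) \<omega> < x)) \<omega> < x \<and> x \<le> X (LEAST n. X (Suc n) \<omega> < x) \<omega>"
proof -
  let ?n = "LEAST n. X (Suc n) \<omega> < x"
  have "\<forall>\<^sub>F n in sequentially. X n \<omega> < x"
    by (rule order_tendstoD(2)[OF X_tendsto assms(1)])
  then obtain N where "\<And>n. n \<ge> N \<Longrightarrow> X n \<omega> < x" by (auto simp: eventually_sequentially)
  then have 1: "X (Suc ?n) \<omega> < x" by (intro LeastI[of "\<lambda>n. X (Suc n) \<omega> < x" N]) simp
  have "x \<le> X ?n \<omega>"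
  proof (cases ?n)
    case 0
    then show ?thesis using assms(2) by simp
  next
    case (Suc m)
    have "\<not> X (Suc m) \<omega> < x" using Suc by (intro not_less_Least) simp
    then show ?thesis unfolding Suc by simp
  qed
  with 1 show ?thesis by blast
qed

lemma pw_affine_right: "1/2 < x \<Longrightarrow> pw_affine \<alpha> \<beta> p1 p2 \<omega> x = 2 * x - 1"
  by (simp add: pw_affine_def)

lemma pw_affine_left:
  assumes "X (Suc (Suc n)) \<omega> < x" "x \<le> X (Suc n) \<omega>"
  shows "pw_affine \<alpha> \<beta> p1 p2 \<omega> x =
    (X n (\<phi> \<omega>) - X (Suc n) (\<phi> \<omega>)) / (X (Suc n) \<omega> - X (Suc (Suc n)) \<omega>) * (x - X (Suc (Suc n)) \<omega>) + X (Suc n) (\<phi> \<omega>)"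
proof -
  have x: "0 < x" "\<not> 1/2 < x" using assms X_pos[of "Suc (Suc n)" \<omega>] X_le_half[of "Suc n" \<omega>] by auto
  \<comment> \<open>The index in the definition is that of the lower end point, one more than the
    level \<open>Suc n\<close> of \<open>x\<close>.\<close>
  have the: "(THE n. 2 \<le> n \<and> X n \<omega> < x \<and> x \<le> X (n - 1) \<omega>) = Suc (Suc n)"
  proof (rule the_equality)
    show "2 \<le> Suc (Suc n) \<and> X (Suc (Suc n)) \<omega> < x \<and> x \<le> X (Suc (Suc n) - 1) \<omega>"
      using assms by simp
    fix k assume k: "2 \<le> k \<and> X k \<omega> < x \<and> x \<le> X (k - 1) \<omega>"
    then have "k = Suc (k - 1)" by simp
    then have "k - 1 = Suc n" using k assms level_unique[of "k - 1" \<omega> x "Suc n"] by metis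
    then show "k = Suc (Suc n)" using k by simp
  qed
  have "pw_affine \<alpha> \<beta> p1 p2 \<omega> x =
    (X (Suc (Suc n) - 2) (\<phi> \<omega>) - X (Suc (Suc n) - 1) (\<phi> \<omega>)) / (X (Suc (Suc n) - 1) \<omega> - X (Suc (Suc n)) \<omega>) *
      (x - X (Suc (Suc n)) \<omega>) + X (Suc (Suc n) - 1) (\<phi> \<omega>)"
    unfolding pw_affine_def Let_def the using x by simp
  then show ?thesis by (simp del: xpt.simps)
qed

text \<open>\<open>tile w\<close> is the rectangle over the cylinder of \<open>w\<close> on which \<open>x\<^sub>k\<^sub>+\<^sub>1(\<omega>) < x \<le> x\<^sub>k(\<omega>)\<close>, \<open>k\<close> the length of \<open>w\<close>. The value \<open>\<omega> = 1\<close> is left out, so that the tiles are half-open; this is a null set.\<close>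

definition tile :: "bool list \<Rightarrow> (real \<times> real) set" where
  "tile w = {(x, \<omega>). 0 \<le> \<omega> \<and> \<omega> < 1 \<and> word (length w) \<omega> = w \<and> W w (1/2) < x \<and> x \<le> W w 1}"

definition len :: "bool list \<Rightarrow> real" where "len w = W w 1 - W w (1/2)"

lemma len_pos: "0 < len w" unfolding len_def using W_strict_mono[of "1/2" 1 w] by simp

lemma W_Cons_le_half: "W (i # w) 1 \<le> 1/2"
  using g_mono[of "W w 1" 1 i] W_range[of 1 w] by (simp add: g_1)

lemma len_le_half: "len w \<le> 1/2"
proof (cases w)
  case Nil
  then show ?thesis by (simp add: len_def)
next
  case (Cons i v)
  then show ?thesis using W_Cons_le_half[of i v] W_range[of "1/2" w] unfolding len_def by (simp del: W.simps)
qed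

lemma tile_iff: "(x, \<omega>) \<in> tile w \<longleftrightarrow> 0 \<le> \<omega> \<and> \<omega> < 1 \<and> word (length w) \<omega> = w \<and> X (Suc (length w)) \<omega> < x \<and> x \<le> X (length w) \<omega>"
  unfolding tile_def X_Suc_word unfolding X_word by auto

lemma tile_unique: "z \<in> tile v \<Longrightarrow> z \<in> tile w \<Longrightarrow> v = w"
proof (cases z)
  case (Pair x \<omega>)
  assume "z \<in> tile v" "z \<in> tile w"
  then have v: "word (length v) \<omega> = v" "X (Suc (length v)) \<omega> < x" "x \<le> X (length v) \<omega>"
    and w: "word (length w) \<omega> = w" "X (Suc (length w)) \<omega> < x" "x \<le> X (length w) \<omega>"
    unfolding Pair tile_iff by blast+
  have "length v = length w" by (rule level_unique[OF v(2,3) w(2,3)])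
  then show ?thesis using v(1) w(1) by metis
qed

lemma tile_exists: "0 < x \<Longrightarrow> x \<le> 1 \<Longrightarrow> 0 \<le> \<omega> \<Longrightarrow> \<omega> < 1 \<Longrightarrow> \<exists>w. (x, \<omega>) \<in> tile w"
proof -
  assume x: "0 < x" "x \<le> 1" and \<omega>: "0 \<le> \<omega>" "\<omega> < 1"
  let ?n = "LEAST n. X (Suc n) \<omega> < x"
  have "(x, \<omega>) \<in> tile (word ?n \<omega>)" unfolding tile_iff using level_exists[OF x, of \<omega>] \<omega> by simp
  then show ?thesis ..
qed

lemma \<phi>_range: "0 \<le> \<omega> \<Longrightarrow> \<omega> < 1 \<Longrightarrow> 0 \<le> \<phi> \<omega> \<and> \<phi> \<omega> < 1"
  using p1 p2 p12 by (auto simp: base_map_def)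

lemma \<phi>_range': "0 \<le> \<omega> \<Longrightarrow> \<omega> \<le> 1 \<Longrightarrow> 0 \<le> \<phi> \<omega> \<and> \<phi> \<omega> \<le> 1"
  using p1 p2 p12 by (auto simp: base_map_def)

definition step :: "bool \<Rightarrow> bool list \<Rightarrow> real \<times> real \<Rightarrow> real \<times> real" where
  "step i w = diag_affine (len w / len (i # w)) (W w (1/2) - len w / len (i # w) * W (i # w) (1/2)) (1 / pr i) (- offset1 i / pr i)"

text \<open>The end points in the affine formula depend on \<open>\<omega>\<close> through its first
  letters alone, which are constant on a tile. There \<open>S\<close> is therefore one affine map in
  both coordinates, and it removes the first letter of the code.\<close>

lemma S_tile:
  assumes "z \<in> tile (i # w)"
  shows "S z = step i w z" and "S z \<in> tile w" and "symb (snd z) = i"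
proof -
  obtain x \<omega> where z: "z = (x, \<omega>)" by (cases z)
  from assms have \<omega>: "0 \<le> \<omega>" "\<omega> < 1" and wd: "symb \<omega> = i" "word (length w) (\<phi> \<omega>) = w"
    and x: "X (Suc (Suc (length w))) \<omega> < x" "x \<le> X (Suc (length w)) \<omega>"
    unfolding z tile_iff by (simp_all del: xpt.simps)
  have word_eq: "word (Suc (length w)) \<omega> = i # w" using wd by simp
  let ?n = "length w"
  have eqs: "X (Suc (Suc ?n)) \<omega> = W (i # w) (1/2)" "X (Suc ?n) \<omega> = W (i # w) 1"
    "X ?n (\<phi> \<omega>) = W w 1" "X (Suc ?n) (\<phi> \<omega>) = W w (1/2)"
    using X_Suc_word[of "Suc ?n" \<omega>] X_word[of "Suc ?n" \<omega>] X_word[of ?n "\<phi> \<omega>"] X_Suc_word[of ?n "\<phi> \<omega>"]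
    unfolding word_eq wd by auto
  have pw: "pw_affine \<alpha> \<beta> p1 p2 \<omega> x = len w / len (i # w) * (x - W (i # w) (1/2)) + W w (1/2)"
    using pw_affine_left[OF x] unfolding eqs len_def .
  show "symb (snd z) = i" using wd z by simp
  show eq: "S z = step i w z"
    unfolding z skew_def step_def diag_affine_def by (simp add: pw \<phi>_eq wd diff_divide_distrib right_diff_distrib del: W.simps)
  have l: "0 < len (i # w)" "0 < len w" by (rule len_pos)+
  have "0 < len w / len (i # w) * (x - W (i # w) (1/2))"
    using x(1) l unfolding eqs by simp
  moreover have "len w / len (i # w) * (x - W (i # w) (1/2)) \<le> len w / len (i # w) * len (i # w)"
    using x(2) l unfolding eqs by (intro mult_left_mono) (auto simp: len_def)
  moreover have "len w / len (i # w) * len (i # w) = len w" using l by simp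
  ultimately have "W w (1/2) < pw_affine \<alpha> \<beta> p1 p2 \<omega> x" "pw_affine \<alpha> \<beta> p1 p2 \<omega> x \<le> W w 1"
    unfolding pw by (simp_all add: len_def)
  then show "S z \<in> tile w" unfolding z skew_def tile_def using \<phi>_range[OF \<omega>] wd by auto
qed

lemma tile_Cons_not_Delta0: "z \<in> tile (i # w) \<Longrightarrow> z \<notin> Delta0"
  using W_Cons_le_half[of i w] by (auto simp: tile_def Delta0_def simp del: W.simps)

lemma tile_Nil_Delta0: "z \<in> tile [] \<Longrightarrow> z \<in> Delta0"
  by (auto simp: tile_def Delta0_def)

text \<open>The affine bijection of \<open>tile w\<close> onto \<open>tile []\<close>; on \<open>tile w\<close> it is the iterate of \<open>S\<close> of order \<open>length w\<close>.\<close>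

definition full :: "bool list \<Rightarrow> real \<times> real \<Rightarrow> real \<times> real" where
  "full w = diag_affine (1 / (2 * len w)) (1/2 - W w (1/2) / (2 * len w)) (1 / pw w) (- offset w / pw w)"

lemma full_step: "full w (step i w z) = full (i # w) z"
proof -
  have l: "len w \<noteq> 0" "len (i # w) \<noteq> 0" "pw w \<noteq> 0" "pr i \<noteq> 0"
    using len_pos[of w] len_pos[of "i # w"] pw_pos[of w] pr_pos[of i] by auto
  have 1: "1 / (2 * len w) * (len w / len (i # w) * a + (c - len w / len (i # w) * d)) + (1/2 - c / (2 * len w)) =
    1 / (2 * len (i # w)) * a + (1/2 - d / (2 * len (i # w)))" for a c d
    using l by (simp add: field_simps)
  have 2: "1 / pw w * (1 / pr i * a + - offset1 i / pr i) + - offset w / pw w = 1 / pw (i # w) * a + - offset (i # w) / pw (i # w)" for a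
    using l by (simp add: pw_Cons field_simps)
  show ?thesis unfolding full_def step_def diag_affine_def by (simp only: fst_conv snd_conv 1 2)
qed

lemma S_funpow_tile: "z \<in> tile w \<Longrightarrow> (S ^^ length w) z = full w z"
proof (induction w arbitrary: z)
  case Nil
  show ?case by (simp add: full_def diag_affine_def len_def pw_Nil)
next
  case (Cons i w)
  have "(S ^^ length (i # w)) z = (S ^^ length w) (S z)" by (simp add: funpow_swap1)
  also have "\<dots> = full w (step i w z)" using Cons.IH[OF S_tile(2)[OF Cons.prems]] S_tile(1)[OF Cons.prems] by simp
  finally show ?case by (simp add: full_step)
qed

lemma S_funpow_tile_mem: "z \<in> tile w \<Longrightarrow> (S ^^ length w) z \<in> tile []"
proof (induction w arbitrary: z)
  case (Cons i w)
  have "(S ^^ length (i # w)) z = (S ^^ length w) (S z)" by (simp add: funpow_swap1)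
  then show ?case using Cons.IH[OF S_tile(2)[OF Cons.prems]] by simp
qed simp

lemma S_funpow_tile_not_Delta0: "z \<in> tile w \<Longrightarrow> l < length w \<Longrightarrow> (S ^^ l) z \<notin> Delta0"
proof (induction w arbitrary: z l)
  case (Cons i w)
  show ?case
  proof (cases l)
    case 0
    then show ?thesis using tile_Cons_not_Delta0[OF Cons.prems(1)] by simp
  next
    case (Suc m)
    then show ?thesis using Cons.IH[OF S_tile(2)[OF Cons.prems(1)], of m] Cons.prems(2) by (simp add: funpow_swap1)
  qed
qed simp

text \<open>Prefixing a letter applies an affine inverse branch of \<open>\<phi>\<close>, which
  carries the interval of \<open>w\<close> onto the corresponding interval inside the piece of that
  letter.\<close>

lemma word_iff: "0 \<le> \<omega> \<and> \<omega> < 1 \<and> word (length w) \<omega> = w \<longleftrightarrow> offset w \<le> \<omega> \<and> \<omega> < offset w + pw w"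
proof (induction w arbitrary: \<omega>)
  case Nil
  show ?case by (simp add: pw_Nil)
next
  case (Cons i w)
  have offset_range: "0 \<le> offset w \<and> offset w + pw w \<le> 1"
  proof (induction w)
    case (Cons j v)
    have "pr j * (offset v + pw v) \<le> pr j * 1" using Cons pr_pos[of j] by (intro mult_left_mono) auto
    moreover have "offset1 j + pr j \<le> 1" "0 \<le> offset1 j" using p1 p2 p12 by (auto simp: offset1_def pr_def)
    ultimately show ?case using Cons pr_pos[of j] by (auto simp: pw_Cons distrib_left)
  qed (simp add: pw_Nil)
  have "(0 \<le> \<omega> \<and> \<omega> < 1 \<and> word (length (i # w)) \<omega> = i # w) \<longleftrightarrow>
    symb \<omega> = i \<and> 0 \<le> \<phi> \<omega> \<and> \<phi> \<omega> < 1 \<and> word (length w) (\<phi> \<omega>) = w"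
  proof -
    have "0 \<le> \<omega> \<and> \<omega> < 1 \<longleftrightarrow> 0 \<le> \<phi> \<omega> \<and> \<phi> \<omega> < 1"
      using p1 p2 p12 by (auto simp: base_map_def field_simps)
    then show ?thesis by auto
  qed
  also have "\<dots> \<longleftrightarrow> symb \<omega> = i \<and> offset w \<le> \<phi> \<omega> \<and> \<phi> \<omega> < offset w + pw w"
    using Cons.IH[of "\<phi> \<omega>"] by auto
  also have "\<dots> \<longleftrightarrow> symb \<omega> = i \<and> offset w \<le> (\<omega> - offset1 i) / pr i \<and> (\<omega> - offset1 i) / pr i < offset w + pw w"
    by (auto simp: \<phi>_eq)
  also have "\<dots> \<longleftrightarrow> symb \<omega> = i \<and> offset (i # w) \<le> \<omega> \<and> \<omega> < offset (i # w) + pw (i # w)"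
    using pr_pos[of i] by (simp add: pos_le_divide_eq pos_divide_less_eq pw_Cons) (auto simp: algebra_simps)
  also have "\<dots> \<longleftrightarrow> offset (i # w) \<le> \<omega> \<and> \<omega> < offset (i # w) + pw (i # w)"
  proof -
    have "symb \<omega> = i" if "offset (i # w) \<le> \<omega>" "\<omega> < offset (i # w) + pw (i # w)"
    proof (cases i)
      case True
      have "p1 * (offset w + pw w) \<le> p1 * 1" using offset_range p1 by (intro mult_left_mono) auto
      then show ?thesis using that True by (simp add: symb_def offset1_def pr_def pw_Cons distrib_left)
    next
      case False
      have "0 \<le> p2 * offset w" using offset_range p2 by simp
      then show ?thesis using that False by (simp add: symb_def offset1_def pr_def pw_Cons)
    qed
    then show ?thesis by blast
  qed
  finally show ?case .
qed

lemma full_tile: "full w z \<in> tile [] \<longleftrightarrow> z \<in> tile w"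
proof -
  obtain x \<omega> where z: "z = (x, \<omega>)" by (cases z)
  have l: "len w > 0" "pw w > 0" using len_pos pw_pos by auto
  have fst: "fst (full w z) = 1/2 + (x - W w (1/2)) / (2 * len w)"
    by (simp add: full_def diag_affine_def z diff_divide_distrib)
  have snd: "snd (full w z) = (\<omega> - offset w) / pw w"
    by (simp add: full_def diag_affine_def z diff_divide_distrib)
  have "full w z \<in> tile [] \<longleftrightarrow> 0 \<le> snd (full w z) \<and> snd (full w z) < 1 \<and> 1/2 < fst (full w z) \<and> fst (full w z) \<le> 1"
    by (cases "full w z") (auto simp: tile_def)
  also have "\<dots> \<longleftrightarrow> offset w \<le> \<omega> \<and> \<omega> < offset w + pw w \<and> W w (1/2) < x \<and> x \<le> W w 1"
  proof -
    have "0 \<le> (\<omega> - offset w) / pw w \<longleftrightarrow> offset w \<le> \<omega>" using l by (simp add: zero_le_divide_iff)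
    moreover have "(\<omega> - offset w) / pw w < 1 \<longleftrightarrow> \<omega> < offset w + pw w" using l by (simp add: pos_divide_less_eq) linarith
    moreover have "1/2 < 1/2 + (x - W w (1/2)) / (2 * len w) \<longleftrightarrow> W w (1/2) < x" using l by (simp add: zero_less_divide_iff)
    moreover have "1/2 + (x - W w (1/2)) / (2 * len w) \<le> 1 \<longleftrightarrow> x \<le> W w 1"
    proof -
      have "1/2 + (x - W w (1/2)) / (2 * len w) \<le> 1 \<longleftrightarrow> (x - W w (1/2)) / (2 * len w) \<le> 1/2" by linarith
      also have "\<dots> \<longleftrightarrow> x - W w (1/2) \<le> 1/2 * (2 * len w)" using l by (intro pos_divide_le_eq) simp
      also have "\<dots> \<longleftrightarrow> x \<le> W w 1" by (simp add: len_def)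
      finally show ?thesis .
    qed
    ultimately show ?thesis unfolding fst snd by blast
  qed
  also have "\<dots> \<longleftrightarrow> z \<in> tile w" unfolding z tile_def using word_iff[of \<omega> w] by auto
  finally show ?thesis .
qed

section \<open>The branches of the first-return map\<close>

definition right :: "bool \<Rightarrow> real \<times> real \<Rightarrow> real \<times> real" where
  "right i = diag_affine 2 (- 1) (1 / pr i) (- offset1 i / pr i)"

lemma S_right: "z \<in> Delta0 \<Longrightarrow> S z = right (symb (snd z)) z"
  by (cases z) (auto simp: Delta0_def skew_def right_def diag_affine_def pw_affine_right \<phi>_eq diff_divide_distrib)

text \<open>The letter \<open>i\<close> is spent on the doubling branch, which lands in
  \<open>tile w\<close>; \<open>length w\<close> further steps lead back. This is the return branch
  of the nonempty word \<open>i # w\<close>.\<close>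

definition rect :: "bool \<times> bool list \<Rightarrow> (real \<times> real) set" where
  "rect = (\<lambda>(i, w). {z \<in> tile []. symb (snd z) = i \<and> S z \<in> tile w})"

definition return_time :: "bool \<times> bool list \<Rightarrow> nat" where "return_time = (\<lambda>(i, w). Suc (length w))"

definition branch :: "bool \<times> bool list \<Rightarrow> real \<times> real \<Rightarrow> real \<times> real" where
  "branch = (\<lambda>(i, w). diag_affine (1 / len w) (1/2 - (1 + W w (1/2)) / (2 * len w)) (1 / pw (i # w)) (- offset (i # w) / pw (i # w)))"

lemma full_right: "full w (right i z) = branch (i, w) z"
proof -
  have l: "len w \<noteq> 0" "pw w \<noteq> 0" "pr i \<noteq> 0"
    using len_pos[of w] pw_pos[of w] pr_pos[of i] by auto
  have 1: "1 / (2 * len w) * (2 * a + - 1) + (1/2 - c / (2 * len w)) = 1 / len w * a + (1/2 - (1 + c) / (2 * len w))" for a c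
    using l by (simp add: field_simps)
  have 2: "1 / pw w * (1 / pr i * a + - offset1 i / pr i) + - offset w / pw w = 1 / pw (i # w) * a + - offset (i # w) / pw (i # w)" for a
    using l by (simp add: pw_Cons field_simps)
  show ?thesis unfolding full_def right_def branch_def diag_affine_def by (simp only: fst_conv snd_conv 1 2 prod.case)
qed

lemma S_funpow_rect:
  assumes "z \<in> rect (i, w)"
  shows "(S ^^ return_time (i, w)) z = branch (i, w) z" and "(S ^^ return_time (i, w)) z \<in> tile []"
proof -
  have z: "z \<in> Delta0" "symb (snd z) = i" "S z \<in> tile w" using assms tile_Nil_Delta0 by (auto simp: rect_def)
  have 1: "(S ^^ return_time (i, w)) z = (S ^^ length w) (S z)" by (simp add: return_time_def funpow_swap1)
  show "(S ^^ return_time (i, w)) z = branch (i, w) z"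
    unfolding 1 S_funpow_tile[OF z(3)] full_right[symmetric] using S_right[OF z(1)] z(2) by simp
  show "(S ^^ return_time (i, w)) z \<in> tile []" unfolding 1 by (rule S_funpow_tile_mem[OF z(3)])
qed

text \<open>If \<open>right i\<close> sends a point into \<open>tile w\<close>, the image has second
  coordinate in \<open>[0, 1)\<close>, so the point lies over the interval of the letter
  \<open>i\<close>, where \<open>right i\<close> is the actual map. It makes
  \<open>rect (i, w)\<close> an affine preimage, whose area is explicit.\<close>

lemma branch_rect: "branch (i, w) z \<in> tile [] \<longleftrightarrow> z \<in> rect (i, w)"
proof
  assume "z \<in> rect (i, w)"
  then show "branch (i, w) z \<in> tile []" using S_funpow_rect by metis
next
  assume "branch (i, w) z \<in> tile []"
  then have r: "right i z \<in> tile w" unfolding full_right[symmetric] full_tile .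
  obtain x \<omega> where z: "z = (x, \<omega>)" by (cases z)
  have rz: "right i z = (2 * x - 1, (\<omega> - offset1 i) / pr i)"
    by (simp add: right_def diag_affine_def z diff_divide_distrib)
  have \<omega>': "0 \<le> (\<omega> - offset1 i) / pr i" "(\<omega> - offset1 i) / pr i < 1" using r unfolding rz tile_def by auto
  have \<omega>: "offset1 i \<le> \<omega>" "\<omega> < offset1 i + pr i"
    using \<omega>' pr_pos[of i] by (auto simp: zero_le_divide_iff pos_divide_less_eq)
  have sy: "symb \<omega> = i" "0 \<le> \<omega>" "\<omega> < 1"
    using \<omega> p1 p2 p12 by (auto simp: offset1_def pr_def symb_def split: if_splits)
  have "0 < 2 * x - 1" "2 * x - 1 \<le> 1"
    using r W_range[of "1/2" w] W_range[of 1 w] unfolding rz tile_def by auto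
  then have "z \<in> tile []" using sy by (auto simp: z tile_def)
  moreover from this have "S z = right i z" using S_right[OF tile_Nil_Delta0] sy z by auto
  ultimately show "z \<in> rect (i, w)" using r sy z by (simp add: rect_def)
qed

end

section \<open>Lebesgue measure on the unit square and on \<open>Delta0\<close>\<close>

abbreviation (input) "sq \<equiv> {0..1} \<times> {0..1 :: real} :: (real \<times> real) set"

lemma sq_borel: "sq \<in> sets borel"
  by (intro borel_closed closed_Times) auto

lemma space_square [simp]: "space square_lebesgue = sq"
  by (simp add: square_lebesgue_def space_restrict_space)

lemma sets_square_iff: "A \<in> sets square_lebesgue \<longleftrightarrow> A \<in> sets borel \<and> A \<subseteq> sq"
  unfolding square_lebesgue_def using sq_borel by (subst sets_restrict_space_iff) auto

lemma emeasure_square: "A \<in> sets square_lebesgue \<Longrightarrow> emeasure square_lebesgue A = emeasure lborel A"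
  using sq_borel by (simp add: sets_square_iff) (simp add: square_lebesgue_def emeasure_restrict_space)

lemma null_sets_square_iff: "N \<in> null_sets square_lebesgue \<longleftrightarrow> N \<in> null_sets lborel \<and> N \<subseteq> sq"
  by (auto simp: null_sets_def sets_square_iff emeasure_square)

lemma AE_square: "AE z in lborel. Q z \<Longrightarrow> AE z in square_lebesgue. Q z"
  unfolding square_lebesgue_def using sq_borel by (subst AE_restrict_space_iff) (auto elim: eventually_mono)

lemma AE_off_lines: "AE z in square_lebesgue. fst z \<noteq> 0 \<and> snd z \<noteq> 1"
proof -
  have "AE z in lborel. z \<notin> {0 :: real} \<times> (UNIV :: real set)" by (rule AE_not_in[OF null_vertical_line])
  moreover have "AE z in lborel. z \<notin> (UNIV :: real set) \<times> {1 :: real}" by (rule AE_not_in[OF null_horizontal_line])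
  ultimately have "AE z in lborel. fst z \<noteq> 0 \<and> snd (z :: real \<times> real) \<noteq> 1"
    by eventually_elim (auto simp: mem_Times_iff)
  then show ?thesis by (rule AE_square)
qed

lemma emeasure_lborel_Times:
  "A \<in> sets borel \<Longrightarrow> B \<in> sets borel \<Longrightarrow> emeasure lborel (A \<times> B) = emeasure lborel A * emeasure lborel (B :: real set)"
  for A :: "real set"
  using lborel.emeasure_pair_measure_Times[of A lborel B] by (simp add: lborel_prod)

lemma Delta0_borel: "Delta0 \<in> sets borel"
  unfolding Delta0_def borel_prod[symmetric] by simp

lemma Delta0_square: "Delta0 \<in> sets square_lebesgue"
  unfolding sets_square_iff using Delta0_borel by (auto simp: Delta0_def)

lemma emeasure_Delta0: "emeasure lborel Delta0 = ennreal (1/2)"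
  unfolding Delta0_def by (subst emeasure_lborel_Times) auto

lemma measure_uniform_Delta0:
  assumes "Y \<in> sets borel" "Y \<subseteq> Delta0"
  shows "measure (uniform_measure square_lebesgue Delta0) Y = 2 * measure lborel Y"
proof -
  have Y: "Y \<in> sets square_lebesgue" using assms by (auto simp: sets_square_iff Delta0_def)
  have eq: "measure square_lebesgue Z = measure lborel Z" if "Z \<in> sets square_lebesgue" for Z
    unfolding measure_def emeasure_square[OF that] ..
  have D: "measure lborel Delta0 = 1/2" unfolding measure_def emeasure_Delta0 by (rule enn2real_ennreal) simp
  have "measure (uniform_measure square_lebesgue Delta0) Y = measure square_lebesgue (Delta0 \<inter> Y) / measure square_lebesgue Delta0"
    using Y Delta0_square emeasure_Delta0 by (intro measure_uniform_measure) (simp_all add: emeasure_square)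
  also have "Delta0 \<inter> Y = Y" using assms(2) by auto
  also have "measure square_lebesgue Y / measure square_lebesgue Delta0 = 2 * measure lborel Y"
    unfolding eq[OF Y] eq[OF Delta0_square] D by simp
  finally show ?thesis .
qed

text \<open>Inner regularity of a finite Borel measure by compact sets, which are closed; a gap
  \<open>e\<close> for all compact subsets would contradict the supremum formula.\<close>

lemma uniform_Delta0_inner_regular:
  assumes X: "X \<in> sets square_lebesgue" "X \<subseteq> Delta0" and e: "0 < (e :: real)"
  shows "\<exists>K\<in>sets square_lebesgue. K \<subseteq> X \<and> closed K \<and>
    measure (uniform_measure square_lebesgue Delta0) X < measure (uniform_measure square_lebesgue Delta0) K + e"
proof -
  let ?U = "uniform_measure lborel Delta0"
  have Xb: "X \<in> sets borel" using X by (simp add: sets_square_iff)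
  have fin: "emeasure ?U (space ?U) \<noteq> \<infinity>"
    using prob_space.emeasure_space_1[OF prob_space_uniform_measure[of lborel Delta0]] emeasure_Delta0 by simp
  interpret U: finite_measure ?U using fin by (intro finite_measureI) simp
  have U: "emeasure ?U Y = ennreal (2 * measure lborel Y)" if "Y \<in> sets borel" "Y \<subseteq> Delta0" for Y
  proof -
    have "emeasure lborel Y \<le> emeasure lborel Delta0" using that Delta0_borel by (intro emeasure_mono) auto
    then have fin: "emeasure lborel Y \<noteq> \<infinity>" unfolding emeasure_Delta0 by (auto simp: top_unique)
    have "emeasure ?U Y = emeasure lborel (Delta0 \<inter> Y) / emeasure lborel Delta0"
      using that Delta0_borel by (intro emeasure_uniform_measure) auto
    also have "Delta0 \<inter> Y = Y" using that by auto
    also have "emeasure lborel Y = ennreal (measure lborel Y)" using fin by (simp add: emeasure_eq_ennreal_measure)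
    also have "ennreal (measure lborel Y) / emeasure lborel Delta0 = ennreal (2 * measure lborel Y)"
      unfolding emeasure_Delta0 by (subst divide_ennreal) (auto simp: mult.commute)
    finally show ?thesis .
  qed
  have "emeasure ?U X = (SUP K\<in>{K. K \<subseteq> X \<and> compact K}. emeasure ?U K)"
    using Xb fin by (intro inner_regular) auto
  then have SUP: "ennreal (2 * measure lborel X) = (SUP K\<in>{K. K \<subseteq> X \<and> compact K}. emeasure ?U K)"
    using U[OF Xb X(2)] by simp
  have "\<exists>K. K \<subseteq> X \<and> compact K \<and> 2 * measure lborel X < 2 * measure lborel K + e"
  proof (rule ccontr)
    assume "\<not> ?thesis"
    then have le: "2 * measure lborel K \<le> 2 * measure lborel X - e" if "K \<subseteq> X" "compact K" for K
      using that by force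
    have "(SUP K\<in>{K. K \<subseteq> X \<and> compact K}. emeasure ?U K) \<le> ennreal (2 * measure lborel X - e)"
    proof (rule SUP_least)
      fix K assume "K \<in> {K. K \<subseteq> X \<and> compact K}"
      then have K: "K \<subseteq> X" "compact K" by auto
      have "emeasure ?U K = ennreal (2 * measure lborel K)" using K X by (intro U borel_compact) auto
      also have "\<dots> \<le> ennreal (2 * measure lborel X - e)" by (intro ennreal_leI le K)
      finally show "emeasure ?U K \<le> ennreal (2 * measure lborel X - e)" .
    qed
    then have "ennreal (2 * measure lborel X) \<le> ennreal (2 * measure lborel X - e)" unfolding SUP[symmetric] .
    moreover have "0 \<le> 2 * measure lborel X - e" using le[of "{}"] by simp
    ultimately show False using e by (subst (asm) ennreal_le_iff) auto
  qed
  then obtain K where K: "K \<subseteq> X" "compact K" "2 * measure lborel X < 2 * measure lborel K + e" by blast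
  have Kb: "K \<in> sets borel" using K(2) by (intro borel_compact)
  have KD: "K \<subseteq> Delta0" using K X by auto
  moreover have "K \<in> sets square_lebesgue" using Kb KD by (auto simp: sets_square_iff Delta0_def)
  ultimately show ?thesis
    using K(1,3) compact_imp_closed[OF K(2)] measure_uniform_Delta0[OF Xb X(2)] measure_uniform_Delta0[OF Kb KD] by auto
qed

section \<open>The skew product as an affine return system\<close>

context two_maps
begin

text \<open>Outside \<open>[0, 1]\<close> the values of \<open>left_inv\<close> are unspecified.
  Clamping the argument makes the branch monotone on the whole line, hence Borel.\<close>

lemma g_clamped_measurable: "(\<lambda>y. g i (max 0 (min 1 y))) \<in> borel_measurable borel"
  by (rule borel_measurable_mono) (auto intro!: monoI g_mono)

lemma X_measurable [measurable]: "X n \<in> borel_measurable borel"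
proof (induction n)
  case (Suc n)
  have [measurable]: "X n \<in> borel_measurable borel" by (rule Suc)
  note [measurable] = g_clamped_measurable
  have "X (Suc n) = (\<lambda>\<omega>. if \<omega> < p1 then (\<lambda>y. g True (max 0 (min 1 y))) (X n (\<omega> / p1))
    else (\<lambda>y. g False (max 0 (min 1 y))) (X n ((\<omega> - p1) / p2)))"
  proof
    fix \<omega>
    have "max 0 (min 1 (X n \<omega>')) = X n \<omega>'" for \<omega>' using X_pos[of n \<omega>'] X_le_1[of n \<omega>'] by simp
    then show "X (Suc n) \<omega> = (if \<omega> < p1 then (\<lambda>y. g True (max 0 (min 1 y))) (X n (\<omega> / p1))
      else (\<lambda>y. g False (max 0 (min 1 y))) (X n ((\<omega> - p1) / p2)))"
      by (simp add: X_Suc symb_def base_map_def)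
  qed
  also have "\<dots> \<in> borel_measurable borel" by measurable
  finally show ?case .
qed simp

lemma \<phi>_measurable [measurable]: "\<phi> \<in> borel_measurable borel"
  unfolding base_map_def by measurable

lemma pw_affine_range:
  assumes "0 \<le> x" "x \<le> 1"
  shows "0 \<le> pw_affine \<alpha> \<beta> p1 p2 \<omega> x \<and> pw_affine \<alpha> \<beta> p1 p2 \<omega> x \<le> 1"
proof -
  consider "x = 0" | "1/2 < x" | "0 < x" "x \<le> 1/2" using assms by linarith
  then show ?thesis
  proof cases
    case 1
    then show ?thesis by (simp add: pw_affine_def)
  next
    case 2
    then show ?thesis using assms by (simp add: pw_affine_right)
  next
    case 3
    let ?n = "LEAST n. X (Suc n) \<omega> < x"
    have lev: "X (Suc ?n) \<omega> < x" "x \<le> X ?n \<omega>" using level_exists[of x \<omega>] 3 assms by auto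
    have "?n \<noteq> 0" using lev(1) 3 by (cases ?n) auto
    then obtain m where m: "?n = Suc m" by (cases ?n) auto
    have l: "X (Suc (Suc m)) \<omega> < x" "x \<le> X (Suc m) \<omega>" using lev unfolding m by auto
    let ?num = "X m (\<phi> \<omega>) - X (Suc m) (\<phi> \<omega>)" and ?den = "X (Suc m) \<omega> - X (Suc (Suc m)) \<omega>"
    have pos: "0 < ?num" "0 < ?den" using X_strict[of m "\<phi> \<omega>"] X_strict[of "Suc m" \<omega>] by simp_all
    have "?num / ?den * (x - X (Suc (Suc m)) \<omega>) \<le> ?num / ?den * ?den"
      using pos l by (intro mult_left_mono) auto
    then have "?num / ?den * (x - X (Suc (Suc m)) \<omega>) \<le> ?num" using pos by simp
    moreover have "0 \<le> ?num / ?den * (x - X (Suc (Suc m)) \<omega>)" using pos l by simp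
    ultimately show ?thesis
      unfolding pw_affine_left[OF l] using X_pos[of "Suc m" "\<phi> \<omega>"] X_le_1[of m "\<phi> \<omega>"] by linarith
  qed
qed

lemma S_measurable: "S \<in> square_lebesgue \<rightarrow>\<^sub>M square_lebesgue"
proof -
  \<comment> \<open>With the level frozen the formula is plainly measurable, and \<open>S\<close>
    selects it through the measurable index \<open>lev\<close>. Level 0 means that the first
    coordinate exceeds 1/2, so on the left half \<open>n - 1\<close> is a true predecessor.\<close>
  define piece where "piece n z = (if 1/2 < fst z then 2 * fst z - 1 else if 0 < fst z then
     (X (n - 1) (\<phi> (snd z)) - X n (\<phi> (snd z))) / (X n (snd z) - X (Suc n) (snd z)) * (fst z - X (Suc n) (snd z)) + X n (\<phi> (snd z))
     else 0, \<phi> (snd z))" for n and z :: "real \<times> real"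
  define lev where "lev z = (LEAST n. X (Suc n) (snd z) < fst z)" for z :: "real \<times> real"
  have piece: "piece n \<in> borel_measurable (borel \<Otimes>\<^sub>M borel)" for n
    unfolding piece_def borel_prod[symmetric] by measurable
  have lev: "lev \<in> (borel \<Otimes>\<^sub>M borel) \<rightarrow>\<^sub>M count_space UNIV"
    unfolding lev_def by measurable
  have comp: "(\<lambda>z. piece (lev z) z) \<in> borel_measurable (borel \<Otimes>\<^sub>M borel)"
    by (rule measurable_compose_countable[OF piece lev])
  have eq: "S z = piece (lev z) z" if "z \<in> sq" for z
  proof -
    obtain x \<omega> where z: "z = (x, \<omega>)" by (cases z)
    have x: "0 \<le> x" "x \<le> 1" using that z by auto
    consider "x = 0" | "1/2 < x" | "0 < x" "x \<le> 1/2" using x by linarith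
    then show ?thesis
    proof cases
      case 1
      then show ?thesis by (simp add: z piece_def skew_def pw_affine_def)
    next
      case 2
      then show ?thesis by (simp add: z piece_def skew_def pw_affine_right)
    next
      case 3
      have levx: "X (Suc (lev z)) \<omega> < x" "x \<le> X (lev z) \<omega>"
        using level_exists[of x \<omega>] 3 x unfolding lev_def z by auto
      have "lev z \<noteq> 0" using levx(1) 3 by (cases "lev z") auto
      then obtain m where m: "lev z = Suc m" by (cases "lev z") auto
      have l: "X (Suc (Suc m)) \<omega> < x" "x \<le> X (Suc m) \<omega>" using levx unfolding m by auto
      show ?thesis unfolding m using 3 by (simp add: z piece_def skew_def pw_affine_left[OF l] del: xpt.simps)
    qed
  qed
  have "S \<in> square_lebesgue \<rightarrow>\<^sub>M borel"
  proof (subst measurable_cong)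
    show "S z = piece (lev z) z" if "z \<in> space square_lebesgue" for z using eq that by simp
    show "(\<lambda>z. piece (lev z) z) \<in> square_lebesgue \<rightarrow>\<^sub>M borel"
      using comp unfolding square_lebesgue_def by (intro measurable_restrict_space1) (simp add: borel_prod)
  qed
  moreover have "S \<in> space square_lebesgue \<rightarrow> sq"
    using pw_affine_range \<phi>_range' by (auto simp: skew_def)
  ultimately have "S \<in> square_lebesgue \<rightarrow>\<^sub>M restrict_space lborel sq"
    by (intro measurable_restrict_space2) auto
  then show ?thesis by (simp add: square_lebesgue_def)
qed

lemma null_vimage_diag_affine:
  assumes "0 < s" "0 < s'" "N \<in> null_sets lborel"
  shows "diag_affine s t s' t' -` N \<in> null_sets lborel"
proof (rule null_setsI)
  have N: "N \<in> sets borel" using assms(3) by auto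
  show "emeasure lborel (diag_affine s t s' t' -` N) = 0"
    using emeasure_vimage_diag_affine[OF assms(1,2) N] assms(3) by (simp add: null_setsD1)
  show "diag_affine s t s' t' -` N \<in> sets lborel"
    using measurable_sets[OF diag_affine_measurable N] by simp
qed

text \<open>Off two null lines \<open>S\<close> agrees at each point with one of countably many
  affine maps of positive slopes, and these have null preimages of null sets.\<close>

lemma S_nonsingular:
  assumes "N \<in> null_sets square_lebesgue"
  shows "S -` N \<inter> space square_lebesgue \<in> null_sets square_lebesgue"
proof -
  have N: "N \<in> null_sets lborel" "N \<in> sets square_lebesgue" using assms null_sets_square_iff by auto
  define U where "U = ({0} \<times> UNIV \<union> UNIV \<times> {1}) \<union> ((\<Union>iw. step (fst iw) (snd iw) -` N) \<union> (\<Union>i. right i -` N))"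
  have U: "U \<in> null_sets lborel"
    unfolding U_def step_def right_def using len_pos pr_pos N(1)
    by (intro null_sets.Un null_sets_UN null_vimage_diag_affine null_vertical_line null_horizontal_line) auto
  have sub: "S -` N \<inter> sq \<subseteq> U"
  proof
    fix z assume z: "z \<in> S -` N \<inter> sq"
    obtain x \<omega> where xw: "z = (x, \<omega>)" by (cases z)
    show "z \<in> U"
    proof (cases "x = 0 \<or> \<omega> = 1")
      case True
      then show ?thesis by (auto simp: U_def xw)
    next
      case False
      then have "0 < x" "x \<le> 1" "0 \<le> \<omega>" "\<omega> < 1" using z xw by auto
      from tile_exists[OF this] obtain w where w: "z \<in> tile w" using xw by auto
      show ?thesis
      proof (cases w)
        case Nil
        then have "S z = right (symb (snd z)) z" using w by (intro S_right tile_Nil_Delta0) simp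
        then have "z \<in> right (symb (snd z)) -` N" using z by simp
        then show ?thesis unfolding U_def by blast
      next
        case (Cons i v)
        then have "S z = step i v z" using w S_tile(1) by simp
        then have "z \<in> step (fst (i, v)) (snd (i, v)) -` N" using z by simp
        then show ?thesis unfolding U_def by blast
      qed
    qed
  qed
  have meas: "S -` N \<inter> space square_lebesgue \<in> sets square_lebesgue"
    by (rule measurable_sets[OF S_measurable N(2)])
  then have "S -` N \<inter> space square_lebesgue \<in> null_sets lborel"
    using sub by (intro null_sets_subset[OF U]) (auto simp: sets_square_iff)
  then show ?thesis unfolding null_sets_square_iff by simp
qed

lemma tile_Nil: "tile [] = {1/2<..1} \<times> {0..<1}"
  by (auto simp: tile_def)

lemma tile_Nil_borel: "tile [] \<in> sets borel"
  unfolding tile_Nil borel_prod[symmetric] by simp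

lemma emeasure_vimage_branch:
  "A \<in> sets borel \<Longrightarrow> emeasure lborel (branch (i, w) -` A) = emeasure lborel A * ennreal (len w * pw (i # w))"
  unfolding branch_def prod.case using len_pos[of w] pw_pos[of "i # w"]
  by (subst emeasure_vimage_diag_affine) auto

lemma rect_vimage: "rect (i, w) = branch (i, w) -` tile []"
  by (rule set_eqI) (simp only: vimage_eq branch_rect)

lemma rect_subset: "rect iw \<subseteq> tile []"
  by (cases iw) (auto simp: rect_def)

lemma vimage_branch_borel: "A \<in> sets borel \<Longrightarrow> branch iw -` A \<in> sets borel"
  using measurable_sets[OF diag_affine_measurable, of A] by (cases iw) (simp add: branch_def)

lemma rect_borel: "rect iw \<in> sets borel"
  using vimage_branch_borel[OF tile_Nil_borel] rect_vimage by (cases iw) simp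

lemma measure_vimage_branch:
  assumes "A \<in> sets borel"
  shows "measure lborel (branch (i, w) -` A) = measure lborel A * (len w * pw (i # w))"
  using len_pos[of w] pw_pos[of "i # w"] emeasure_vimage_branch[OF assms, of i w]
  by (simp add: measure_def enn2real_mult)

lemma tile_Nil_subset: "tile [] \<subseteq> Delta0"
  using tile_Nil_Delta0 by blast

lemma emeasure_Int_tile_Nil:
  assumes "A \<in> sets borel" "A \<subseteq> Delta0"
  shows "emeasure lborel (A \<inter> tile []) = emeasure lborel A"
proof (rule emeasure_eq_AE)
  have "AE z in lborel. z \<notin> (UNIV :: real set) \<times> {1 :: real}" by (rule AE_not_in[OF null_horizontal_line])
  then show "AE z in lborel. z \<in> A \<inter> tile [] \<longleftrightarrow> z \<in> A"
    by eventually_elim (use assms(2) in \<open>auto simp: tile_Nil Delta0_def\<close>)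
qed (use assms tile_Nil_borel in auto)

lemma measure_tile_Nil: "measure lborel (tile []) = 1/2"
proof -
  have "emeasure lborel (tile []) = emeasure lborel Delta0"
    using emeasure_Int_tile_Nil[OF Delta0_borel order_refl] tile_Nil_subset by (simp add: Int_absorb1)
  then show ?thesis unfolding measure_def emeasure_Delta0 by (simp only:) (rule enn2real_ennreal, simp)
qed

lemma measure_rect: "measure (uniform_measure square_lebesgue Delta0) (rect (i, w)) = len w * pw (i # w)"
proof -
  have "measure (uniform_measure square_lebesgue Delta0) (rect (i, w)) = 2 * measure lborel (rect (i, w))"
    using rect_borel rect_subset tile_Nil_subset by (intro measure_uniform_Delta0) blast+
  also have "\<dots> = len w * pw (i # w)"
    unfolding rect_vimage measure_vimage_branch[OF tile_Nil_borel] measure_tile_Nil by simp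
  finally show ?thesis .
qed

text \<open>An affine branch multiplies areas by a constant, and its image \<open>tile []\<close> is
  \<open>Delta0\<close> up to a null line.\<close>

lemma rect_full_branch:
  assumes A: "A \<in> sets square_lebesgue" "A \<subseteq> Delta0"
  shows "measure (uniform_measure square_lebesgue Delta0) (rect iw \<inter> (S ^^ return_time iw) -` A) =
    measure (uniform_measure square_lebesgue Delta0) (rect iw) * measure (uniform_measure square_lebesgue Delta0) A"
proof -
  obtain i w where iw: "iw = (i, w)" by (cases iw)
  have Ab: "A \<in> sets borel" using A by (simp add: sets_square_iff)
  have AP: "A \<inter> tile [] \<in> sets borel" using Ab tile_Nil_borel by auto
  have eq: "rect (i, w) \<inter> (S ^^ return_time (i, w)) -` A = branch (i, w) -` (A \<inter> tile [])"
  proof (intro set_eqI iffI)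
    fix z assume "z \<in> rect (i, w) \<inter> (S ^^ return_time (i, w)) -` A"
    then show "z \<in> branch (i, w) -` (A \<inter> tile [])" using S_funpow_rect[of z i w] by simp
  next
    fix z assume z: "z \<in> branch (i, w) -` (A \<inter> tile [])"
    then have "z \<in> rect (i, w)" using branch_rect by simp
    then show "z \<in> rect (i, w) \<inter> (S ^^ return_time (i, w)) -` A" using S_funpow_rect(1)[of z i w] z by simp
  qed
  have "branch (i, w) -` (A \<inter> tile []) \<subseteq> Delta0" using eq rect_subset tile_Nil_subset by blast
  then have "measure (uniform_measure square_lebesgue Delta0) (branch (i, w) -` (A \<inter> tile [])) =
    2 * measure lborel (branch (i, w) -` (A \<inter> tile []))"
    by (intro measure_uniform_Delta0 vimage_branch_borel AP)
  also have "\<dots> = 2 * (measure lborel A * (len w * pw (i # w)))"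
    unfolding measure_vimage_branch[OF AP] using emeasure_Int_tile_Nil[OF Ab A(2)] by (simp add: measure_def)
  also have "\<dots> = (len w * pw (i # w)) * measure (uniform_measure square_lebesgue Delta0) A"
    unfolding measure_uniform_Delta0[OF Ab A(2)] by simp
  finally show ?thesis unfolding iw eq measure_rect .
qed

lemma pw_Cons_le: "pw (i # w) \<le> max p1 p2"
proof -
  have "pw w \<le> 1"
  proof (induction w)
    case (Cons j v)
    have "pr j * pw v \<le> 1 * 1" using Cons pr_pos[of j] pw_pos[of v] p1 p2 p12
      by (intro mult_mono) (auto simp: pr_def)
    then show ?case by (simp add: pw_Cons)
  qed (simp add: pw_Nil)
  then have "pr i * pw w \<le> pr i * 1" using pr_pos[of i] by (intro mult_left_mono) auto
  then show ?thesis by (auto simp: pw_Cons pr_def)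
qed

text \<open>The inverse branch scales the coordinates by \<open>len w \<le> 1/2\<close> and
  \<open>pw (i # w) \<le> max p1 p2\<close>; moreover 1/2 is at most \<open>max p1 p2\<close>,
  because the two probabilities add up to 1.\<close>

lemma rect_contraction:
  assumes "z \<in> rect iw" "z' \<in> rect iw"
  shows "dist z z' \<le> max p1 p2 * dist ((S ^^ return_time iw) z) ((S ^^ return_time iw) z')"
proof -
  obtain i w where iw: "iw = (i, w)" by (cases iw)
  define a where "a = len w"
  define c where "c = pw (i # w)"
  have ac: "0 < a" "0 < c" "a \<le> max p1 p2" "c \<le> max p1 p2"
    using len_pos[of w] pw_pos[of "i # w"] len_le_half[of w] pw_Cons_le[of i w] p12 by (auto simp: a_def c_def)
  have d: "dist (x / a) (y / a) = dist x y / a" if "0 < a" for a x y :: real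
    using that by (simp add: dist_real_def flip: diff_divide_distrib)
  have img: "dist ((S ^^ return_time iw) z) ((S ^^ return_time iw) z') = sqrt ((dist (fst z) (fst z') / a)\<^sup>2 + (dist (snd z) (snd z') / c)\<^sup>2)"
    unfolding iw using S_funpow_rect(1)[of z i w] S_funpow_rect(1)[of z' i w] assms
    unfolding iw by (simp add: branch_def diag_affine_def dist_Pair_Pair a_def[symmetric] c_def[symmetric] d ac)
  let ?\<theta> = "max p1 p2"
  have \<theta>: "0 \<le> ?\<theta>" using p1 by simp
  have le: "y \<le> ?\<theta> * (y / s)" if "0 < s" "s \<le> ?\<theta>" "0 \<le> y" for y s
    using mult_right_mono[OF that(2,3)] that(1) by (simp add: field_simps)
  have "dist z z' = sqrt ((dist (fst z) (fst z'))\<^sup>2 + (dist (snd z) (snd z'))\<^sup>2)"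
    by (simp add: dist_prod_def)
  also have "\<dots> \<le> sqrt ((?\<theta> * (dist (fst z) (fst z') / a))\<^sup>2 + (?\<theta> * (dist (snd z) (snd z') / c))\<^sup>2)"
    using ac by (intro real_sqrt_le_mono add_mono power_mono le) auto
  also have "\<dots> = sqrt (?\<theta>\<^sup>2 * ((dist (fst z) (fst z') / a)\<^sup>2 + (dist (snd z) (snd z') / c)\<^sup>2))"
    by (simp only: power_mult_distrib distrib_left)
  also have "\<dots> = ?\<theta> * sqrt ((dist (fst z) (fst z') / a)\<^sup>2 + (dist (snd z) (snd z') / c)\<^sup>2)"
    using \<theta> by (simp add: real_sqrt_mult)
  finally show ?thesis unfolding img .
qed

sublocale ret: affine_return_system square_lebesgue S Delta0 rect return_time "max p1 p2"
proof
  show "S \<in> square_lebesgue \<rightarrow>\<^sub>M square_lebesgue" by (rule S_measurable)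
  show "Delta0 \<in> sets square_lebesgue" by (rule Delta0_square)
  show "emeasure square_lebesgue Delta0 \<noteq> 0" "emeasure square_lebesgue Delta0 \<noteq> \<infinity>"
    by (simp_all add: emeasure_square Delta0_square emeasure_Delta0)
  show "S -` N \<inter> space square_lebesgue \<in> null_sets square_lebesgue" if "N \<in> null_sets square_lebesgue" for N
    by (rule S_nonsingular[OF that])
  show "AE z in square_lebesgue. \<exists>k. (S ^^ k) z \<in> Delta0"
    using AE_off_lines AE_space
  proof eventually_elim
    case (elim z)
    obtain w where "z \<in> tile w" using tile_exists[of "fst z" "snd z"] elim by (cases z) fastforce
    from tile_Nil_Delta0[OF S_funpow_tile_mem[OF this]] show ?case by blast
  qed
  show "rect iw \<in> sets square_lebesgue" for iw
    using rect_borel[of iw] rect_subset[of iw] unfolding sets_square_iff by (auto simp: tile_Nil)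
  show "rect iw \<subseteq> Delta0" for iw using rect_subset tile_Nil_subset by blast
  show "disjoint_family rect"
    unfolding disjoint_family_on_def
  proof (intro ballI impI)
    fix a c :: "bool \<times> bool list" assume "a \<noteq> c"
    moreover obtain i v where a: "a = (i, v)" by (cases a)
    moreover obtain j w where c: "c = (j, w)" by (cases c)
    ultimately have "i \<noteq> j \<or> v \<noteq> w" by blast
    then show "rect a \<inter> rect c = {}"
      unfolding a c rect_def prod.case using tile_unique by blast
  qed
  show "AE z in uniform_measure square_lebesgue Delta0. z \<in> (\<Union>iw. rect iw)"
  proof (rule AE_uniform_measureI[OF Delta0_square])
    show "AE z in square_lebesgue. z \<in> Delta0 \<longrightarrow> z \<in> (\<Union>iw. rect iw)"
      using AE_off_lines
    proof eventually_elim
      case (elim z)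
      show ?case
      proof
        assume z: "z \<in> Delta0"
        obtain x \<omega> where xw: "z = (x, \<omega>)" by (cases z)
        have x: "1/2 < x" "x \<le> 1" "0 \<le> \<omega>" "\<omega> < 1" using z elim xw by (auto simp: Delta0_def)
        obtain w where w: "(2 * x - 1, \<phi> \<omega>) \<in> tile w"
          using tile_exists[of "2 * x - 1" "\<phi> \<omega>"] x \<phi>_range[of \<omega>] by auto
        have "z \<in> rect (symb \<omega>, w)" using x w by (simp add: rect_def xw tile_Nil skew_def pw_affine_right)
        then show "z \<in> (\<Union>iw. rect iw)" by blast
      qed
    qed
  qed
  show "0 < return_time iw" for iw by (cases iw) (simp add: return_time_def)
  show "finite {iw. return_time iw \<le> n}" for n
  proof (rule finite_subset)
    show "finite ((UNIV :: bool set) \<times> {w. set w \<subseteq> (UNIV :: bool set) \<and> length w \<le> n})"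
      by (intro finite_cartesian_product finite_lists_length_le) auto
    show "{iw. return_time iw \<le> n} \<subseteq> UNIV \<times> {w. set w \<subseteq> UNIV \<and> length w \<le> n}"
      by (auto simp: return_time_def)
  qed
  show "(S ^^ return_time iw) z \<in> Delta0" if "z \<in> rect iw" for iw z
    using that S_funpow_rect(2) tile_Nil_Delta0 by (cases iw) blast
  show "(S ^^ j) z \<notin> Delta0" if z: "z \<in> rect iw" and j: "0 < j" "j < return_time iw" for iw z j
  proof -
    obtain i w where iw: "iw = (i, w)" by (cases iw)
    obtain l where l: "j = Suc l" using j(1) by (cases j) auto
    have "S z \<in> tile w" using z by (simp add: iw rect_def)
    then have "(S ^^ l) (S z) \<notin> Delta0" using j(2) by (intro S_funpow_tile_not_Delta0) (auto simp: iw l return_time_def)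
    then show ?thesis by (simp add: l funpow_swap1)
  qed
  show "measure (uniform_measure square_lebesgue Delta0) (rect iw \<inter> (S ^^ return_time iw) -` A) =
      measure (uniform_measure square_lebesgue Delta0) (rect iw) * measure (uniform_measure square_lebesgue Delta0) A"
    if "A \<in> sets square_lebesgue" "A \<subseteq> Delta0" for iw A
    by (rule rect_full_branch[OF that])
  show "0 \<le> max p1 p2" "max p1 p2 < 1" using p1 p2 p12 by auto
  show "dist z z' \<le> max p1 p2 * dist ((S ^^ return_time iw) z) ((S ^^ return_time iw) z')" if "z \<in> rect iw" "z' \<in> rect iw" for iw z z'
    by (rule rect_contraction[OF that])
  show "bounded Delta0" unfolding Delta0_def by (intro bounded_Times) auto
  show "\<exists>K\<in>sets square_lebesgue. K \<subseteq> Y \<and> closed K \<and>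
      measure (uniform_measure square_lebesgue Delta0) Y < measure (uniform_measure square_lebesgue Delta0) K + e"
    if "Y \<in> sets square_lebesgue" "Y \<subseteq> Delta0" "0 < e" for Y and e :: real
    by (rule uniform_Delta0_inner_regular[OF that])
qed

end

section \<open>Asymptotics of the renewal sequence of the skew product\<close>

context two_maps
begin

text \<open>A branch with return time \<open>Suc k\<close> has measure
  \<open>len w * pw (i # w)\<close>. Summing over \<open>i\<close> removes that letter, and the two
  end points behind \<open>len w\<close> give consecutive means.\<close>

lemma q_eq: "ret.q (Suc k) = r k - r (Suc k)"
proof -
  have "{iw. return_time iw = Suc k} = (UNIV :: bool set) \<times> words k"
    by (auto simp: return_time_def words_def)
  then have "ret.q (Suc k) = (\<Sum>iw\<in>(UNIV :: bool set) \<times> words k. len (snd iw) * pw (fst iw # snd iw))"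
    unfolding ret.q_def ret.\<mu>_def using measure_rect by (intro sum.cong) auto
  also have "\<dots> = (\<Sum>i\<in>(UNIV :: bool set). \<Sum>w\<in>words k. len w * pw (i # w))"
    by (simp add: sum.cartesian_product split_def)
  also have "\<dots> = (\<Sum>w\<in>words k. (p1 + p2) * (len w * pw w))"
    by (simp add: UNIV_bool pw_Cons pr_def sum.distrib[symmetric] algebra_simps)
  also have "\<dots> = (\<Sum>w\<in>words k. pw w * W w 1) - (\<Sum>w\<in>words k. pw w * W w (1/2))"
    by (simp add: p12 len_def sum_subtractf[symmetric] algebra_simps)
  also have "\<dots> = r k - r (Suc k)"
    using sum_words_half[where n = k and h = "\<lambda>y. y"] by (simp add: r_def mean_def)
  finally show ?thesis .
qed

lemma renewal: "(\<Sum>k\<le>n. ret.u k * r (n - k)) = 1"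
  by (rule ret.renewal_tail[OF r_0 q_eq])

lemma tail_eq: "ret.tail n = r n"
proof -
  have "(\<Sum>j<n. r j - r (Suc j)) = r 0 - r n"
    by (induction n) auto
  then show ?thesis by (simp add: ret.tail_def q_eq r_0)
qed

lemma u_decreasing: "decseq ret.u"
  by (rule Kaluza_decreasing[OF r_0 r_pos r_logconvex renewal])

lemma u_nonneg: "0 \<le> ret.u n"
  by (simp add: ret.u_def)

lemma r_constant_pos: "0 < (\<alpha> * (p1 * 2 powr \<alpha>)) powr (- 1 / \<alpha>)"
  using exps p1 by simp

lemma u_asymptotic_power:
  assumes "1 < \<alpha>"
  obtains c where "0 < c" "(\<lambda>n. real n powr (1 - 1 / \<alpha>) * ret.u n) \<longlonglongrightarrow> c"
proof -
  let ?\<rho> = "(\<alpha> * (p1 * 2 powr \<alpha>)) powr (- 1 / \<alpha>)"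
  have s: "0 < 1 / \<alpha>" "1 / \<alpha> < 1" using assms by auto
  have "0 < 1 / (?\<rho> * Gamma (1 - 1 / \<alpha>) * Gamma (1 / \<alpha>))"
    using r_constant_pos s by (simp add: Gamma_real_pos)
  then show ?thesis
    using renewal_power_asymptotic[OF s u_decreasing u_nonneg less_imp_le[OF r_pos] r_0 renewal r_asymptotic r_constant_pos]
    by (rule that)
qed

lemma u_asymptotic_log:
  assumes "\<alpha> = 1"
  obtains c where "0 < c" "(\<lambda>n. ln (real n) * ret.u n) \<longlonglongrightarrow> c"
proof -
  let ?\<rho> = "(\<alpha> * (p1 * 2 powr \<alpha>)) powr (- 1 / \<alpha>)"
  have "(\<lambda>n. real n * r n) \<longlonglongrightarrow> ?\<rho>"
    using r_asymptotic by (rule Lim_transform_eventually) (simp add: assms)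
  from renewal_log_asymptotic[OF u_decreasing u_nonneg less_imp_le[OF r_pos] r_0 renewal this r_constant_pos]
  show ?thesis using r_constant_pos by (intro that[of "1 / ?\<rho>"]) auto
qed

text \<open>\<open>u\<close> is decreasing and positive at arbitrarily late times, hence positive
  throughout. The quotient of consecutive values inherits its limit from the normalising sequence
  because the limit \<open>c\<close> is nonzero.\<close>

lemma u_pos_and_ratio:
  assumes lim: "(\<lambda>n. a n * ret.u n) \<longlonglongrightarrow> c" and c: "0 < c"
    and a: "(\<lambda>n. a n / a (Suc n)) \<longlonglongrightarrow> 1" and a0: "\<forall>\<^sub>F n in sequentially. 0 < a n"
  shows "0 < ret.u n" and "(\<lambda>n. ret.u (Suc n) / ret.u n) \<longlonglongrightarrow> 1"
proof -
  show pos: "0 < ret.u n" for n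
  proof -
    have "\<forall>\<^sub>F m in sequentially. 0 < a m * ret.u m" using lim c by (rule order_tendstoD(1))
    then have "\<forall>\<^sub>F m in sequentially. 0 < ret.u m \<and> n \<le> m"
      using a0 eventually_ge_at_top[of n] by eventually_elim (auto simp: zero_less_mult_iff)
    then obtain m where "0 < ret.u m" "n \<le> m" by (auto simp: eventually_sequentially)
    then show ?thesis using decseqD[OF u_decreasing, of n m] by simp
  qed
  have "(\<lambda>n. (a (Suc n) * ret.u (Suc n)) / (a n * ret.u n) * (a n / a (Suc n))) \<longlonglongrightarrow> c / c * 1"
    using c by (intro tendsto_mult tendsto_divide LIMSEQ_Suc[OF lim] lim a) auto
  then have "(\<lambda>n. (a (Suc n) * ret.u (Suc n)) / (a n * ret.u n) * (a n / a (Suc n))) \<longlonglongrightarrow> 1" using c by simp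
  then show "(\<lambda>n. ret.u (Suc n) / ret.u n) \<longlonglongrightarrow> 1"
  proof (rule Lim_transform_eventually)
    have "\<forall>\<^sub>F n in sequentially. 0 < a (Suc n)" using a0 by (subst eventually_sequentially_Suc)
    then show "\<forall>\<^sub>F n in sequentially. (a (Suc n) * ret.u (Suc n)) / (a n * ret.u n) * (a n / a (Suc n)) = ret.u (Suc n) / ret.u n"
      using a0 by eventually_elim simp
  qed
qed

text \<open>As \<open>1 / \<alpha> \<le> 1\<close>, the sequence is eventually at least a multiple
  of \<open>1 / n\<close>. This is what makes the invariant measure infinite.\<close>

lemma r_not_summable: "\<not> summable r"
proof
  assume sum: "summable r"
  let ?\<rho> = "(\<alpha> * (p1 * 2 powr \<alpha>)) powr (- 1 / \<alpha>)"
  have "\<forall>\<^sub>F n in sequentially. ?\<rho> / 2 < real n powr (1 / \<alpha>) * r n"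
    using r_constant_pos by (intro order_tendstoD(1)[OF r_asymptotic]) simp
  then have "\<forall>\<^sub>F n in sequentially. norm (?\<rho> / 2 * (1 / real n)) \<le> r n"
    using eventually_gt_at_top[of 0]
  proof eventually_elim
    case (elim n)
    have "1 / \<alpha> \<le> 1" using \<alpha> by simp
    then have "real n powr (1 / \<alpha>) \<le> real n powr 1" using elim(2) by (intro powr_mono) auto
    then have "real n powr (1 / \<alpha>) * r n \<le> real n * r n" using r_pos[of n] by (simp add: mult_right_mono)
    then have "?\<rho> / 2 \<le> real n * r n" using elim(1) by linarith
    then show ?case using elim(2) r_constant_pos by (simp add: field_simps)
  qed
  then have "summable (\<lambda>n. ?\<rho> / 2 * (1 / real n))"
    using sum by (rule summable_comparison_test_ev)
  then have "summable (\<lambda>n. 1 / real n)"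
    using r_constant_pos by (subst (asm) summable_cmult_iff) auto
  then show False using not_summable_harmonic[where 'a = real] by (simp add: inverse_eq_divide)
qed

lemma infinite_acim_\<nu>: "infinite_acim S ret.\<nu>"
  unfolding infinite_acim_def invariant_measure_def
proof (intro conjI)
  show "absolutely_continuous square_lebesgue ret.\<nu>"
    by (auto simp: absolutely_continuous_def null_sets_def ret.\<nu>_absolutely_continuous)
  show S: "S \<in> ret.\<nu> \<rightarrow>\<^sub>M ret.\<nu>"
    using S_measurable measurable_cong_sets[OF ret.sets_\<nu> ret.sets_\<nu>] by simp
  show "distr ret.\<nu> ret.\<nu> S = ret.\<nu>"
  proof (rule measure_eqI)
    fix A assume "A \<in> sets (distr ret.\<nu> ret.\<nu> S)"
    then have A: "A \<in> sets square_lebesgue" by simp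
    have "emeasure (distr ret.\<nu> ret.\<nu> S) A = emeasure ret.\<nu> (S -` A \<inter> space ret.\<nu>)"
      using A S by (intro emeasure_distr) auto
    also have "S -` A \<inter> space ret.\<nu> = ret.pre 1 A" unfolding ret.pre_def by simp
    also have "emeasure ret.\<nu> (ret.pre 1 A) = emeasure ret.\<nu> A" by (rule ret.\<nu>_invariant[OF A])
    finally show "emeasure (distr ret.\<nu> ret.\<nu> S) A = emeasure ret.\<nu> A" .
  qed simp
  show "emeasure ret.\<nu> (space ret.\<nu>) = \<infinity>"
    by (rule ret.\<nu>_infinite) (use r_not_summable tail_eq in \<open>simp add: ext[of ret.tail r]\<close>)
qed (simp_all add: ret.\<nu>_sigma_finite)

lemma infinite_acim_unique:
  assumes "infinite_acim S N" "emeasure N Delta0 = 1"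
  shows "N = ret.\<nu>"
proof -
  have N: "sets N = sets square_lebesgue" "absolutely_continuous square_lebesgue N" "invariant_measure S N"
    "sigma_finite_measure N" using assms(1) by (auto simp: infinite_acim_def)
  show ?thesis
    by (rule ret.invariant_measure_unique[OF N(1) ret.N_pre[OF N(1,3,2,4) assms(2)] N(2) assms(2)])
qed

lemma lipschitz_supported_properties:
  assumes "lipschitz_supported Delta0 f"
  obtains L C where "L-lipschitz_on Delta0 f" "f \<in> borel_measurable square_lebesgue"
    "\<forall>z. z \<notin> Delta0 \<longrightarrow> f z = 0" "0 < C" "\<forall>z\<in>Delta0. \<bar>f z\<bar> \<le> C"
proof -
  obtain L where L: "L-lipschitz_on Delta0 f" and f0: "\<And>z. z \<notin> Delta0 \<Longrightarrow> f z = 0"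
    using assms by (auto simp: lipschitz_supported_def)
  have "(\<lambda>z. indicator Delta0 z *\<^sub>R f z) \<in> borel_measurable borel"
    by (rule borel_measurable_continuous_on_indicator[OF Delta0_borel lipschitz_on_continuous_on[OF L]])
  also have "(\<lambda>z. indicator Delta0 z *\<^sub>R f z) = f" using f0 by (auto simp: fun_eq_iff indicator_def)
  finally have "f \<in> borel_measurable square_lebesgue"
    unfolding square_lebesgue_def by (intro measurable_restrict_space1) simp
  moreover obtain C where "0 < C" "\<And>z. z \<in> Delta0 \<Longrightarrow> \<bar>f z\<bar> \<le> C"
  proof -
    have z0: "(1, 0) \<in> Delta0" by (simp add: Delta0_def)
    have L0: "0 \<le> L" by (rule lipschitz_on_nonneg[OF L])
    have "\<bar>f z\<bar> \<le> \<bar>f (1, 0)\<bar> + L * diameter Delta0 + 1" if z: "z \<in> Delta0" for z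
    proof -
      have "dist (f z) (f (1, 0)) \<le> L * dist z (1, 0)" by (rule lipschitz_onD[OF L z z0])
      also have "\<dots> \<le> L * diameter Delta0"
        using L0 diameter_bounded_bound[OF ret.D_bounded z z0] by (rule mult_left_mono[rotated])
      finally show ?thesis unfolding dist_real_def by linarith
    qed
    moreover have "0 < \<bar>f (1, 0)\<bar> + L * diameter Delta0 + 1"
      using L0 diameter_ge_0[OF ret.D_bounded] by (intro add_nonneg_pos add_nonneg_nonneg mult_nonneg_nonneg) auto
    ultimately show ?thesis using that by blast
  qed
  ultimately show ?thesis using that L f0 by blast
qed

text \<open>Common to both regimes, which differ in the normalising sequence
  \<open>a\<close>.\<close>

lemma limit_statements:
  assumes N: "infinite_acim S N" "emeasure N Delta0 = 1"
    and lim: "(\<lambda>n. a n * ret.u n) \<longlonglongrightarrow> c" and c: "0 < c"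
    and a: "(\<lambda>n. a n / a (Suc n)) \<longlonglongrightarrow> 1" "\<forall>\<^sub>F n in sequentially. 0 < a n"
    and f: "lipschitz_supported Delta0 f"
  shows "(\<lambda>n. sup_norm_on N Delta0 (\<lambda>z. a n * (indicat_real Delta0 z * (transfer_op N S ^^ n) f z)
      - c * (LINT y:Delta0|N. f y))) \<longlonglongrightarrow> 0"
    and "set_integrable N Delta0 v \<Longrightarrow>
      (\<lambda>n. a n * (LINT z:Delta0|N. f z * (\<lambda>y. indicat_real Delta0 y * v y) ((S ^^ n) z)))
        \<longlonglongrightarrow> c * (LINT z:Delta0|N. f z) * (LINT z:Delta0|N. v z)"
proof -
  have N': "sets N = sets square_lebesgue" "invariant_measure S N" "absolutely_continuous square_lebesgue N"
    "sigma_finite_measure N" using N(1) by (auto simp: infinite_acim_def)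
  obtain L C where f': "L-lipschitz_on Delta0 f" "f \<in> borel_measurable square_lebesgue"
    "\<forall>z. z \<notin> Delta0 \<longrightarrow> f z = 0" "0 < C" "\<forall>z\<in>Delta0. \<bar>f z\<bar> \<le> C"
    by (rule lipschitz_supported_properties[OF f])
  note u = u_pos_and_ratio[OF lim c a]
  show "(\<lambda>n. sup_norm_on N Delta0 (\<lambda>z. a n * (indicat_real Delta0 z * (transfer_op N S ^^ n) f z)
      - c * (LINT y:Delta0|N. f y))) \<longlonglongrightarrow> 0"
    by (rule ret.transfer_op_sup_norm_limit[OF N' N(2) f'(2) f'(3)[rule_format] f'(5)[rule_format] f'(4,1) u lim])
  show "(\<lambda>n. a n * (LINT z:Delta0|N. f z * (\<lambda>y. indicat_real Delta0 y * v y) ((S ^^ n) z)))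
        \<longlonglongrightarrow> c * (LINT z:Delta0|N. f z) * (LINT z:Delta0|N. v z)"
    if "set_integrable N Delta0 v"
    by (rule ret.correlation_L1_limit[OF N' N(2) f'(2) f'(3)[rule_format] f'(5)[rule_format] f'(4,1) u lim that])
qed

end

theorem theorem4p1:
  fixes \<alpha> \<beta> p1 p2 :: real
  assumes "1 \<le> \<alpha>" and "\<alpha> < \<beta>" and "0 < p1" and "0 < p2" and "p1 + p2 = 1"
  shows
    "(\<exists>!\<nu>. infinite_acim (skew \<alpha> \<beta> p1 p2) \<nu> \<and> emeasure \<nu> Delta0 = 1) \<and>
     (\<forall>\<nu>. infinite_acim (skew \<alpha> \<beta> p1 p2) \<nu> \<and> emeasure \<nu> Delta0 = 1 \<longrightarrow>
       (\<alpha> > 1 \<longrightarrow> (\<exists>c::real. \<forall>f. lipschitz_supported Delta0 f \<longrightarrow>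
          (\<lambda>n. sup_norm_on \<nu> Delta0 (\<lambda>z.
              real n powr (1 - 1 / \<alpha>) *
                (indicat_real Delta0 z * (transfer_op \<nu> (skew \<alpha> \<beta> p1 p2) ^^ n) f z)
              - c * (LINT y:Delta0|\<nu>. f y))) \<longlonglongrightarrow> 0 \<and>
          (\<forall>g. set_integrable \<nu> Delta0 g \<longrightarrow>
            (\<lambda>n. real n powr (1 - 1 / \<alpha>) *
               (LINT z:Delta0|\<nu>. f z * (\<lambda>y. indicat_real Delta0 y * g y) ((skew \<alpha> \<beta> p1 p2 ^^ n) z)))
            \<longlonglongrightarrow> c * (LINT z:Delta0|\<nu>. f z) * (LINT z:Delta0|\<nu>. g z)))) \<and>
       (\<alpha> = 1 \<longrightarrow> (\<exists>c::real. \<forall>f. lipschitz_supported Delta0 f \<longrightarrow>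
          (\<lambda>n. sup_norm_on \<nu> Delta0 (\<lambda>z.
              ln (real n) *
                (indicat_real Delta0 z * (transfer_op \<nu> (skew \<alpha> \<beta> p1 p2) ^^ n) f z)
              - c * (LINT y:Delta0|\<nu>. f y))) \<longlonglongrightarrow> 0 \<and>
          (\<forall>g. set_integrable \<nu> Delta0 g \<longrightarrow>
            (\<lambda>n. ln (real n) *
               (LINT z:Delta0|\<nu>. f z * (\<lambda>y. indicat_real Delta0 y * g y) ((skew \<alpha> \<beta> p1 p2 ^^ n) z)))
            \<longlonglongrightarrow> c * (LINT z:Delta0|\<nu>. f z) * (LINT z:Delta0|\<nu>. g z)))))"
proof -
  interpret two_maps \<alpha> \<beta> p1 p2 by (rule two_maps.intro[OF assms])
  show ?thesis
  proof (intro conjI allI impI)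
    show "\<exists>!\<nu>. infinite_acim (skew \<alpha> \<beta> p1 p2) \<nu> \<and> emeasure \<nu> Delta0 = 1"
    proof (rule ex1I[of _ ret.\<nu>])
      show "infinite_acim (skew \<alpha> \<beta> p1 p2) ret.\<nu> \<and> emeasure ret.\<nu> Delta0 = 1"
        by (intro conjI infinite_acim_\<nu> ret.\<nu>_D_1)
      show "N = ret.\<nu>" if "infinite_acim (skew \<alpha> \<beta> p1 p2) N \<and> emeasure N Delta0 = 1" for N
        using that by (elim conjE) (rule infinite_acim_unique)
    qed
  next
    fix \<nu> assume \<nu>: "infinite_acim (skew \<alpha> \<beta> p1 p2) \<nu> \<and> emeasure \<nu> Delta0 = 1" and \<alpha>: "1 < \<alpha>"
    \<comment> \<open>The constant is read off from the renewal sequence before any \<open>f\<close>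
      is fixed, hence its independence of \<open>f\<close>.\<close>
    obtain c where c: "0 < c" "(\<lambda>n. real n powr (1 - 1 / \<alpha>) * ret.u n) \<longlonglongrightarrow> c"
      by (rule u_asymptotic_power[OF \<alpha>])
    have a: "(\<lambda>n. real n powr (1 - 1 / \<alpha>) / real (Suc n) powr (1 - 1 / \<alpha>)) \<longlonglongrightarrow> 1"
      by real_asymp
    have a0: "\<forall>\<^sub>F n in sequentially. 0 < real n powr (1 - 1 / \<alpha>)"
      using eventually_gt_at_top[of 0] by eventually_elim simp
    note lims = limit_statements[OF conjunct1[OF \<nu>] conjunct2[OF \<nu>] c(2,1) a a0]
    show "\<exists>c::real. \<forall>f. lipschitz_supported Delta0 f \<longrightarrow>
          (\<lambda>n. sup_norm_on \<nu> Delta0 (\<lambda>z.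
              real n powr (1 - 1 / \<alpha>) *
                (indicat_real Delta0 z * (transfer_op \<nu> (skew \<alpha> \<beta> p1 p2) ^^ n) f z)
              - c * (LINT y:Delta0|\<nu>. f y))) \<longlonglongrightarrow> 0 \<and>
          (\<forall>g. set_integrable \<nu> Delta0 g \<longrightarrow>
            (\<lambda>n. real n powr (1 - 1 / \<alpha>) *
               (LINT z:Delta0|\<nu>. f z * (\<lambda>y. indicat_real Delta0 y * g y) ((skew \<alpha> \<beta> p1 p2 ^^ n) z)))
            \<longlonglongrightarrow> c * (LINT z:Delta0|\<nu>. f z) * (LINT z:Delta0|\<nu>. g z))"
      by (intro exI[of _ c] allI impI conjI lims)
  next
    fix \<nu> assume \<nu>: "infinite_acim (skew \<alpha> \<beta> p1 p2) \<nu> \<and> emeasure \<nu> Delta0 = 1" and \<alpha>: "\<alpha> = 1"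
    obtain c where c: "0 < c" "(\<lambda>n. ln (real n) * ret.u n) \<longlonglongrightarrow> c"
      by (rule u_asymptotic_log[OF \<alpha>])
    have a: "(\<lambda>n. ln (real n) / ln (real (Suc n))) \<longlonglongrightarrow> 1"
      by real_asymp
    have a0: "\<forall>\<^sub>F n in sequentially. 0 < ln (real n)"
      using eventually_gt_at_top[of 1] by eventually_elim simp
    note lims = limit_statements[OF conjunct1[OF \<nu>] conjunct2[OF \<nu>] c(2,1) a a0]
    show "\<exists>c::real. \<forall>f. lipschitz_supported Delta0 f \<longrightarrow>
          (\<lambda>n. sup_norm_on \<nu> Delta0 (\<lambda>z.
              ln (real n) *
                (indicat_real Delta0 z * (transfer_op \<nu> (skew \<alpha> \<beta> p1 p2) ^^ n) f z)
              - c * (LINT y:Delta0|\<nu>. f y))) \<longlonglongrightarrow> 0 \<and>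
          (\<forall>g. set_integrable \<nu> Delta0 g \<longrightarrow>
            (\<lambda>n. ln (real n) *
               (LINT z:Delta0|\<nu>. f z * (\<lambda>y. indicat_real Delta0 y * g y) ((skew \<alpha> \<beta> p1 p2 ^^ n) z)))
            \<longlonglongrightarrow> c * (LINT z:Delta0|\<nu>. f z) * (LINT z:Delta0|\<nu>. g z))"
      by (intro exI[of _ c] allI impI conjI lims)
  qed
qed

end
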